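(* Let $\rho:\Gamma\to GL_3(\mathbb{C})$ be an irreducible representation with $\rho(T)=\mathrm{diag}(e^{2\pi i r_1},e^{2\pi i r_2},e^{2\pi i r_3})$, $0\le r_j<1$ real, let $\upsilon$ be a multiplier system for $\Gamma$, and let $\{\lambda_1,\lambda_2,\lambda_3\}$ be the minimal admissible set of $(\rho,\upsilon)$. Then $$\mathcal{H}(\rho,\upsilon)=\bigoplus_{k\geq0}\mathcal{H}(k_0+2k,\rho,\upsilon)=\mathcal{R}F_0$$ is cyclic as an $\mathcal{R}$-module (with generator $F_0\in\mathcal{H}(k_0,\rho,\upsilon)$), where $k_0=4(\lambda_1+\lambda_2+\lambda_3)-2$ is the minimal weight, and the components of $F_0$ form a fundamental system of solutions of a third order MMDE in weight $k_0$.
   Context: $\Gamma=SL_2(\mathbb{Z})$, $T=\begin{pmatrix}1&1\\0&1\end{pmatrix}$, $\mathbb{H}$ is the upper half-plane, $q=e^{2\pi iz}$, $q^\lambda=e^{2\pi i\lambda z}$. For $k\in\mathbb{R}$, a multiplier system in weight $k$ is a function $\upsilon:\Gamma\to\{z\in\mathbb{C}:|z|=1\}$ such that $f|_k^\upsilon\gamma(z)=\upsilon(\gamma)^{-1}(cz+d)^{-k}f\left(\frac{az+b}{cz+d}\right)$, $\gamma=\begin{pmatrix}a&b\\c&d\end{pmatrix}\in\Gamma$, defines a right action of $\Gamma$ on the holomorphic functions on $\mathbb{H}$ (real powers are taken with a fixed branch of the argument, e.g. $-\pi<\arg\le\pi$); it is then a multiplier system exactly in the weights congruent to $k$ mod $\mathbb{Z}$.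 The cusp parameter of $\upsilon$ is the unique $0\le m<12$ with $\upsilon(T)=e^{2\pi im/12}$. Vector-valued modular forms: for $\rho:\Gamma\to GL_d(\mathbb{C})$, $\mathcal{H}(k,\rho,\upsilon)$ is the space of $F=(f_1,\dots,f_d)^t:\mathbb{H}\to\mathbb{C}^d$ with each $f_j$ holomorphic and of moderate growth at infinity (there is an integer $N\ge0$ with $|f_j(x+iy)|<y^N$ for any fixed $x$ and $y\gg0$) and $F|_k^\upsilon\gamma=\rho(\gamma)F$ for all $\gamma\in\Gamma$ (slash action componentwise). $\mathcal{H}(\rho,\upsilon)$ is the graded space which is the direct sum of the $\mathcal{H}(k,\rho,\upsilon)$ over all weights $k$ of $\upsilon$. When $\rho(-I)$ is scalar (in particular for irreducible $\rho$), $\mathcal{H}(\rho,\upsilon)=\bigoplus_{k\ge0}\mathcal{H}(k_0+2k,\rho,\upsilon)$, where $k_0$, the minimal weight, is the least weight $k$ with $\mathcal{H}(k,\rho,\upsilon)\ne0$. Minimal admissible set: if $\rho(T)=\mathrm{diag}(e^{2\pi i r_1},\dots,e^{2\pi i r_d})$, $0\le r_j<1$, the minimal admissible set of $(\rho,\upsilon)$ is $\{\lambda_1,\dots,\lambda_d\}$, where $0\le\lambda_j<1$ and $\lambda_j\equiv r_j+\frac{m}{12}\pmod{\mathbb{Z}}$. Differential structure: $\mathcal{M}=\bigoplus_{k\ge0}\mathcal{M}_{2k}=\mathbb{C}[E_4,E_6]$ is the graded ring of holomorphic modular forms for $\Gamma$; $E_2=1-24\sum_{n\ge1}\left(\sum_{d\mid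 n}d\right)q^n$; $D_k=q\frac{d}{dq}-\frac{k}{12}E_2$ maps $\mathcal{H}(k,\rho,\upsilon)$ to $\mathcal{H}(k+2,\rho,\upsilon)$; $D$ is the operator acting as $D_k$ in weight $k$, and $D_k^n=D_{k+2(n-1)}\circ\cdots\circ D_{k+2}\circ D_k$. $\mathcal{R}=\{f_0+f_1d+\cdots+f_nd^n: f_j\in\mathcal{M},n\ge0\}$ is the skew polynomial ring with multiplication $df=fd+Df$; it acts on $\mathcal{H}(\rho,\upsilon)$ with $\mathcal{M}$ acting by multiplication and $d$ acting as $D$. MMDE: a $d$-th order monic modular differential equation in weight $k$ is $D_k^df+M_4D_k^{d-2}f+\cdots+M_{2(d-1)}D_kf+M_{2d}f=0$ with $M_j\in\mathcal{M}_j$. A fundamental system of solutions is a basis of its solution space (viewed as holomorphic functions on $\mathbb{H}$) consisting of functions of the form $q^{\lambda}\sum_{n\ge0}a(n)q^n$.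
   Formalization: Moderate growth is taken with the bound y^N valid from a threshold for y independent of x; if the threshold may depend on x, the claim fails: g(j(z))F_0, with g nonconstant entire and tending to 0 along each curve y -> j(x+iy), would lie in H(k_0) but not in RF_0. *)

theory Defs
  imports
    "HOL-Complex_Analysis.Complex_Analysis"
    "HOL-Library.Function_Algebras"
    "HOL-Algebra.Ring"
begin

text \<open>
  Conventions. Functions on the upper half-plane are total functions of a complex variable that
  vanish off the half-plane; with this normalisation equality of HOL functions is equality of
  functions on the half-plane, and the pointwise operations of
  \<^theory>\<open>HOL-Library.Function_Algebras\<close> are the vector space operations.
  Direct sums are external: their elements are families indexed by the weight with finite support.
\<close>

section \<open>The modular group and the slash action\<close>

definition upper_half_plane :: "complex set"
  where "upper_half_plane = {z. Im z > 0}"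

definition modular_group :: "(int^2^2) set"
  where "modular_group = {A. det A = 1}"

definition T_mat :: "int^2^2"
  where "T_mat = vector [vector [1, 1], vector [0, 1]]"

definition aut_factor :: "int^2^2 \<Rightarrow> complex \<Rightarrow> complex"
  where "aut_factor A z = of_int (A$2$1) * z + of_int (A$2$2)"

definition moebius_act :: "int^2^2 \<Rightarrow> complex \<Rightarrow> complex"
  where "moebius_act A z = (of_int (A$1$1) * z + of_int (A$1$2)) / aut_factor A z"

text \<open>On complex numbers \<^term>\<open>w powr s\<close> is \<open>exp (s * Ln w)\<close> with the principal
  branch \<open>- pi < Im (Ln w) \<le> pi\<close>.\<close>

definition slash ::
  "real \<Rightarrow> (int^2^2 \<Rightarrow> complex) \<Rightarrow> int^2^2 \<Rightarrow> (complex \<Rightarrow> complex) \<Rightarrow> complex \<Rightarrow> complex"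
  where "slash k \<upsilon> A f z =
    inverse (\<upsilon> A) * aut_factor A z powr of_real (- k) * f (moebius_act A z)"

definition multiplier_system :: "real \<Rightarrow> (int^2^2 \<Rightarrow> complex) \<Rightarrow> bool"
  where "multiplier_system k \<upsilon> \<longleftrightarrow>
    (\<forall>A\<in>modular_group. norm (\<upsilon> A) = 1) \<and>
    (\<forall>f. f holomorphic_on upper_half_plane \<longrightarrow>
      (\<forall>A\<in>modular_group. slash k \<upsilon> A f holomorphic_on upper_half_plane) \<and>
      (\<forall>z\<in>upper_half_plane. slash k \<upsilon> (mat 1) f z = f z) \<and>
      (\<forall>A\<in>modular_group. \<forall>B\<in>modular_group. \<forall>z\<in>upper_half_plane.
        slash k \<upsilon> (A ** B) f z = slash k \<upsilon> B (slash k \<upsilon> A f) z))"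

definition multiplier_weights :: "(int^2^2 \<Rightarrow> complex) \<Rightarrow> real set"
  where "multiplier_weights \<upsilon> = {k. multiplier_system k \<upsilon>}"

definition cusp_parameter :: "(int^2^2 \<Rightarrow> complex) \<Rightarrow> real"
  where "cusp_parameter \<upsilon> =
    (THE m. 0 \<le> m \<and> m < 12 \<and> \<upsilon> T_mat = exp (2 * of_real pi * \<i> * of_real m / 12))"


section \<open>Representations\<close>

definition representation :: "(int^2^2 \<Rightarrow> complex^'n^'n) \<Rightarrow> bool"
  where "representation \<rho> \<longleftrightarrow>
    (\<forall>A\<in>modular_group. invertible (\<rho> A)) \<and>
    (\<forall>A\<in>modular_group. \<forall>B\<in>modular_group. \<rho> (A ** B) = \<rho> A ** \<rho> B)"

text \<open>The space \<^typ>\<open>complex^'n\<close> is nonzero because index types are inhabited.\<close>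

definition irreducible_representation :: "(int^2^2 \<Rightarrow> complex^'n^'n) \<Rightarrow> bool"
  where "irreducible_representation \<rho> \<longleftrightarrow> representation \<rho> \<and>
    (\<forall>W. vec.subspace W \<and> (\<forall>A\<in>modular_group. \<forall>w\<in>W. \<rho> A *v w \<in> W) \<longrightarrow> W = {0} \<or> W = UNIV)"

text \<open>The first argument is the vector of exponents \<open>r\<close> of the diagonal of \<open>\<rho> T\<close>; the set is
  kept as a vector with the same indexing.\<close>

definition minimal_admissible :: "real^'n \<Rightarrow> (int^2^2 \<Rightarrow> complex) \<Rightarrow> real^'n \<Rightarrow> bool"
  where "minimal_admissible r \<upsilon> l \<longleftrightarrow>
    (\<forall>j. 0 \<le> l$j \<and> l$j < 1 \<and> l$j - (r$j + cusp_parameter \<upsilon> / 12) \<in> \<int>)"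


section \<open>Vector-valued modular forms\<close>

text \<open>The bound is uniform in \<open>x\<close>. A threshold for \<open>y\<close> depending on \<open>x\<close> would admit
  forms with an essential singularity at the cusp: if \<open>g\<close> is a nonconstant entire function that
  tends to zero off a thin curved region which every translated ray eventually leaves, and \<open>j\<close>
  is the modular invariant, then \<open>g (j z)\<close> tends to zero along every vertical half-line.\<close>

definition moderate_growth :: "(complex \<Rightarrow> complex) \<Rightarrow> bool"
  where "moderate_growth f \<longleftrightarrow>
    (\<exists>N::nat. \<forall>\<^sub>F y in at_top. \<forall>x::real. norm (f (Complex x y)) < y ^ N)"

definition vv_forms ::
  "real \<Rightarrow> (int^2^2 \<Rightarrow> complex^'n^'n) \<Rightarrow> (int^2^2 \<Rightarrow> complex) \<Rightarrow> (complex \<Rightarrow> complex^'n) set"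
  where "vv_forms k \<rho> \<upsilon> = {F.
    (\<forall>z. z \<notin> upper_half_plane \<longrightarrow> F z = 0) \<and>
    (\<forall>j. (\<lambda>z. F z $ j) holomorphic_on upper_half_plane \<and> moderate_growth (\<lambda>z. F z $ j)) \<and>
    (\<forall>A\<in>modular_group. \<forall>z\<in>upper_half_plane. \<forall>j.
      slash k \<upsilon> A (\<lambda>w. F w $ j) z = (\<rho> A *v F z) $ j)}"

definition direct_sum :: "'i set \<Rightarrow> ('i \<Rightarrow> ('a \<Rightarrow> 'b::zero) set) \<Rightarrow> ('i \<Rightarrow> 'a \<Rightarrow> 'b) set"
  where "direct_sum I V =
    {G. (\<forall>i\<in>I. G i \<in> V i) \<and> (\<forall>i. i \<notin> I \<longrightarrow> G i = 0) \<and> finite {i. G i \<noteq> 0}}"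

definition homogeneous :: "'i \<Rightarrow> ('a \<Rightarrow> 'b::zero) \<Rightarrow> 'i \<Rightarrow> 'a \<Rightarrow> 'b"
  where "homogeneous i F = (\<lambda>j. if j = i then F else 0)"

definition graded_vv_forms ::
  "(int^2^2 \<Rightarrow> complex^'n^'n) \<Rightarrow> (int^2^2 \<Rightarrow> complex) \<Rightarrow> (real \<Rightarrow> complex \<Rightarrow> complex^'n) set"
  where "graded_vv_forms \<rho> \<upsilon> = direct_sum (multiplier_weights \<upsilon>) (\<lambda>k. vv_forms k \<rho> \<upsilon>)"

definition minimal_weight ::
  "(int^2^2 \<Rightarrow> complex^'n^'n) \<Rightarrow> (int^2^2 \<Rightarrow> complex) \<Rightarrow> real \<Rightarrow> bool"
  where "minimal_weight \<rho> \<upsilon> k0 \<longleftrightarrow>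
    k0 \<in> multiplier_weights \<upsilon> \<and> vv_forms k0 \<rho> \<upsilon> \<noteq> {0} \<and>
    (\<forall>k\<in>multiplier_weights \<upsilon>. vv_forms k \<rho> \<upsilon> \<noteq> {0} \<longrightarrow> k0 \<le> k)"


section \<open>Scalar modular forms and the modular derivative\<close>

definition modular_forms :: "nat \<Rightarrow> (complex \<Rightarrow> complex) set"
  where "modular_forms k = {f.
    (\<forall>z. z \<notin> upper_half_plane \<longrightarrow> f z = 0) \<and>
    f holomorphic_on upper_half_plane \<and>
    (\<forall>A\<in>modular_group. \<forall>z\<in>upper_half_plane. f (moebius_act A z) = aut_factor A z ^ k * f z) \<and>
    (\<exists>Y B. \<forall>z. Im z > Y \<longrightarrow> norm (f z) \<le> B)}"

text \<open>An element \<open>g\<close> of the ring \<open>\<M>\<close> of modular forms is a family in which \<open>g k\<close> has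
  weight \<open>2 * k\<close>, so families are indexed by half the weight.\<close>

definition graded_modular_forms :: "(nat \<Rightarrow> complex \<Rightarrow> complex) set"
  where "graded_modular_forms = direct_sum UNIV (\<lambda>k. modular_forms (2 * k))"

definition E2 :: "complex \<Rightarrow> complex"
  where "E2 z = 1 - 24 * (\<Sum>n. of_nat (\<Sum>d | d dvd Suc n. d) * exp (2 * of_real pi * \<i> * z) ^ Suc n)"

text \<open>With \<open>q = exp (2 * pi * i * z)\<close> the operator \<open>q d/dq\<close> is \<open>1 / (2 * pi * i)\<close> times
  the derivative in \<open>z\<close>.\<close>

definition mod_deriv :: "real \<Rightarrow> (complex \<Rightarrow> complex) \<Rightarrow> complex \<Rightarrow> complex"
  where "mod_deriv k f z =
    (if z \<in> upper_half_plane
     then deriv f z / (2 * of_real pi * \<i>) - of_real (k / 12) * E2 z * f z else 0)"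

primrec mod_deriv_iter :: "real \<Rightarrow> nat \<Rightarrow> (complex \<Rightarrow> complex) \<Rightarrow> complex \<Rightarrow> complex"
  where
    "mod_deriv_iter k 0 f = f"
  | "mod_deriv_iter k (Suc n) f = mod_deriv (k + 2 * real n) (mod_deriv_iter k n f)"

text \<open>The operator \<open>D\<close> on \<open>\<M>\<close> and on families of vector-valued functions; it raises the
  weight by two.\<close>

definition D_scalar :: "(nat \<Rightarrow> complex \<Rightarrow> complex) \<Rightarrow> nat \<Rightarrow> complex \<Rightarrow> complex"
  where "D_scalar g k = (case k of 0 \<Rightarrow> 0 | Suc l \<Rightarrow> mod_deriv (2 * real l) (g l))"

definition D_vec :: "(real \<Rightarrow> complex \<Rightarrow> complex^'n) \<Rightarrow> real \<Rightarrow> complex \<Rightarrow> complex^'n"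
  where "D_vec G w = (\<lambda>z. \<chi> j. mod_deriv (w - 2) (\<lambda>u. G (w - 2) u $ j) z)"


section \<open>The skew polynomial ring and its action\<close>

definition scalar_mult ::
  "(nat \<Rightarrow> complex \<Rightarrow> complex) \<Rightarrow> (nat \<Rightarrow> complex \<Rightarrow> complex) \<Rightarrow> nat \<Rightarrow> complex \<Rightarrow> complex"
  where "scalar_mult g h n = (\<Sum>k\<le>n. g k * h (n - k))"

definition scalar_act ::
  "(nat \<Rightarrow> complex \<Rightarrow> complex) \<Rightarrow> (real \<Rightarrow> complex \<Rightarrow> complex^'n) \<Rightarrow> real \<Rightarrow> complex \<Rightarrow> complex^'n"
  where "scalar_act g G w = (\<lambda>z. \<Sum>k | g k \<noteq> 0. g k z *s G (w - 2 * real k) z)"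

text \<open>A skew polynomial \<open>f\<^sub>0 + f\<^sub>1 d + \<dots> + f\<^sub>n d\<^sup>n\<close> is the sequence of its coefficients.
  Left multiplication by \<open>d\<close> is forced by \<open>d f = f d + D f\<close>, and it determines the product.\<close>

definition skew_d_mult :: "(nat \<Rightarrow> nat \<Rightarrow> complex \<Rightarrow> complex) \<Rightarrow> nat \<Rightarrow> nat \<Rightarrow> complex \<Rightarrow> complex"
  where "skew_d_mult Q j = (case j of 0 \<Rightarrow> 0 | Suc i \<Rightarrow> Q i) + D_scalar (Q j)"

definition skew_ring :: "(nat \<Rightarrow> nat \<Rightarrow> complex \<Rightarrow> complex) ring"
  where "skew_ring =
    \<lparr>carrier = {P. (\<forall>j. P j \<in> graded_modular_forms) \<and> finite {j. P j \<noteq> 0}},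
     mult = (\<lambda>P Q. \<Sum>i | P i \<noteq> 0. (\<lambda>j. scalar_mult (P i) ((skew_d_mult ^^ i) Q j))),
     one = (\<lambda>j k z. if j = 0 \<and> k = 0 \<and> z \<in> upper_half_plane then 1 else 0),
     zero = 0,
     add = (+)\<rparr>"

definition skew_act ::
  "(nat \<Rightarrow> nat \<Rightarrow> complex \<Rightarrow> complex) \<Rightarrow> (real \<Rightarrow> complex \<Rightarrow> complex^'n) \<Rightarrow> real \<Rightarrow> complex \<Rightarrow> complex^'n"
  where "skew_act P G = (\<Sum>j | P j \<noteq> 0. scalar_act (P j) ((D_vec ^^ j) G))"

definition cyclic_submodule ::
  "(real \<Rightarrow> complex \<Rightarrow> complex^'n) \<Rightarrow> (real \<Rightarrow> complex \<Rightarrow> complex^'n) set"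
  where "cyclic_submodule G = (\<lambda>P. skew_act P G) ` carrier skew_ring"


section \<open>Monic modular differential equations\<close>

text \<open>Only the values \<open>M 4, M 6, \<dots>, M (2 * d)\<close> are used.\<close>

definition mmde_coeffs :: "nat \<Rightarrow> (nat \<Rightarrow> complex \<Rightarrow> complex) \<Rightarrow> bool"
  where "mmde_coeffs d M \<longleftrightarrow> (\<forall>i\<in>{2..d}. M (2 * i) \<in> modular_forms (2 * i))"

definition mmde_operator ::
  "real \<Rightarrow> nat \<Rightarrow> (nat \<Rightarrow> complex \<Rightarrow> complex) \<Rightarrow> (complex \<Rightarrow> complex) \<Rightarrow> complex \<Rightarrow> complex"
  where "mmde_operator k d M f =
    mod_deriv_iter k d f + (\<Sum>i=2..d. M (2 * i) * mod_deriv_iter k (d - i) f)"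

definition mmde_solutions ::
  "real \<Rightarrow> nat \<Rightarrow> (nat \<Rightarrow> complex \<Rightarrow> complex) \<Rightarrow> (complex \<Rightarrow> complex) set"
  where "mmde_solutions k d M = {f.
    (\<forall>z. z \<notin> upper_half_plane \<longrightarrow> f z = 0) \<and> f holomorphic_on upper_half_plane \<and>
    (\<forall>z\<in>upper_half_plane. mmde_operator k d M f z = 0)}"

global_interpretation cfun: vector_space "\<lambda>(c::complex) (f::complex \<Rightarrow> complex) z. c * f z"
  by unfold_locales (auto simp: fun_eq_iff algebra_simps)

definition has_q_expansion :: "(complex \<Rightarrow> complex) \<Rightarrow> bool"
  where "has_q_expansion f \<longleftrightarrow> (\<exists>(l::real) (a :: nat \<Rightarrow> complex). \<forall>z\<in>upper_half_plane.
    summable (\<lambda>n. a n * exp (2 * of_real pi * \<i> * z) ^ n) \<and>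
    f z = exp (2 * of_real pi * \<i> * of_real l * z) * (\<Sum>n. a n * exp (2 * of_real pi * \<i> * z) ^ n))"

text \<open>A fundamental system is an indexed basis, hence the injectivity.\<close>

definition fundamental_system ::
  "real \<Rightarrow> nat \<Rightarrow> (nat \<Rightarrow> complex \<Rightarrow> complex) \<Rightarrow> ('n \<Rightarrow> complex \<Rightarrow> complex) \<Rightarrow> bool"
  where "fundamental_system k d M \<phi> \<longleftrightarrow>
    inj \<phi> \<and> cfun.independent (range \<phi>) \<and> cfun.span (range \<phi>) = mmde_solutions k d M \<and>
    (\<forall>j. has_q_expansion (\<phi> j))"

end

theory Submission
  imports Defs
begin

text \<open>
  In weight \<open>k0 = 4 (l1 + l2 + l3) - 2\<close> there is exactly one third order monic modular differential
  equation \<open>D\<^sup>3 f + a E4 D f + b E6 f = 0\<close> with indicial roots \<open>l1, l2, l3\<close>, and Frobenius' method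
  solves it. Its solution space is stable under the modular group. The Wronskian satisfies
  \<open>D W = 0\<close>, hence has no zeros, and evaluating the Wronskian matrix at the elliptic points \<open>i\<close> and
  \<open>exp (2 pi i / 3)\<close> gives the spectra of \<open>S\<close> and \<open>S T\<close> on the solutions. An irreducible
  three-dimensional representation with diagonal \<open>T\<close> has the same spectra; it is generated by \<open>T\<close> and
  a reflection \<open>s (1 - 2 u v\<^sup>T)\<close>, where \<open>s\<close> and the products \<open>u\<^sub>j v\<^sub>j \<noteq> 0\<close> are determined by \<open>T\<close>. So
  the two representations are conjugate by a diagonal matrix, and rescaling the solutions gives
  \<open>F0\<close>. Cramer's rule writes every form as a combination of \<open>F0, D F0, D\<^sup>2 F0\<close> whose coefficients
  are holomorphic and bounded at the cusp, because \<open>W\<close> vanishes there to the minimal order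
  \<open>l1 + l2 + l3\<close>; forms of negative weight vanish.

  The transformation law of \<open>E2\<close> comes from the two orders of summation of a double series, and \<open>E4\<close>
  and \<open>E6\<close> are obtained from \<open>E2\<close> by differentiation.
\<close>

text \<open>The weight is forced: a third order equation without second order term has a Wronskian
  of weight 3 k + 6, and \<open>D W = 0\<close> gives it the order (3 k + 6) / 12 at the cusp, which
  must be l1 + l2 + l3. The coefficients of weight 4 and 6 supply two constants, as many as the
  symmetric functions of the exponents that k leaves open. Distinct exponents in [0, 1) never differ
  by an integer, so Frobenius' method meets no logarithms. The obstacle is that the equation knows
  only the exponents, hence \<open>\<rho> T\<close>, and not \<open>\<rho> S\<close>. No form for
  \<open>\<rho>\<close> is available beforehand; the generator is found by showing that
  \<open>T\<close> leaves no freedom for \<open>S\<close> beyond diagonal conjugation. The same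
  invariants, \<open>s t1 t2 t3 = -1\<close> and \<open>s^4 = 1\<close>, show that k is a weight of
  the multiplier system. The interval [0, 1) enters twice at the cusp: nonnegative exponents make
  the solutions grow moderately, and exponents below 1 force component j of every form to vanish to
  order at least l_j, which bounds the numerators in Cramer's rule.\<close>

no_notation fps_nth (infixl "$" 75)

section \<open>Inversion of E2\<close>

lemma filterlim_symmetric_int:
  "filterlim (\<lambda>N::nat. {-int N..int N}) (finite_subsets_at_top UNIV) sequentially"
proof (subst filterlim_finite_subsets_at_top, safe)
  fix X :: "int set" assume "finite X"
  define M where "M = Max (insert 0 ((\<lambda>x. nat \<bar>x\<bar>) ` X))"
  have M: "nat \<bar>x\<bar> \<le> M" if "x \<in> X" for x
    unfolding M_def using \<open>finite X\<close> that by (intro Max_ge) auto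
  have "X \<subseteq> {-int N..int N}" if "N \<ge> M" for N
  proof
    fix x assume "x \<in> X"
    from M[OF this] that show "x \<in> {-int N..int N}" by auto
  qed
  then show "\<forall>\<^sub>F N in sequentially. finite {- int N..int N} \<and> X \<subseteq> {- int N..int N} \<and> {- int N..int N} \<subseteq> UNIV"
    unfolding eventually_sequentially by auto
qed

text \<open>The cotangent series converges only along symmetric partial sums, so the unconditional
  sums compared with it are evaluated along these too.\<close>

lemma has_sum_int_LIMSEQ:
  assumes "(f has_sum S) (UNIV::int set)"
  shows "(\<lambda>N. sum f {-int N..int N}) \<longlonglongrightarrow> S"
  using assms unfolding has_sum_def
  by (rule filterlim_compose[OF _ filterlim_symmetric_int])

lemma int_range_Suc: "{-int (Suc N)..int (Suc N)} = insert (int N + 1) (insert (-1 - int N) {-int N..int N})"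
  by auto

lemma sum_int_symmetric:
  fixes f :: "int \<Rightarrow> 'a::comm_monoid_add"
  shows "sum f {-int N..int N} = f 0 + (\<Sum>k=1..N. f (int k) + f (- int k))"
proof (induction N)
  case (Suc N)
  have "sum f {-int (Suc N)..int (Suc N)} = f (int N + 1) + (f (-1 - int N) + sum f {-int N..int N})"
    by (subst int_range_Suc) auto
  then show ?case using Suc by (simp add: algebra_simps)
qed auto

lemma sum_int_telescope:
  fixes f :: "int \<Rightarrow> 'a::ab_group_add"
  shows "(\<Sum>n=-int N..int N. f n - f (n + 1)) = f (- int N) - f (int N + 1)"
proof (induction N)
  case (Suc N)
  have "(\<Sum>n=-int (Suc N)..int (Suc N). f n - f (n + 1)) = (f (int N + 1) - f (int N + 2)) +
     ((f (-1 - int N) - f (- int N)) + (\<Sum>n=-int N..int N. f n - f (n + 1)))"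
    by (subst int_range_Suc) (auto simp: algebra_simps)
  then show ?case using Suc by (simp add: algebra_simps)
qed auto

lemma has_sum_int_nat:
  fixes f :: "int \<Rightarrow> 'a::{real_normed_vector}"
  assumes "((\<lambda>n. f (int (Suc n))) has_sum A) UNIV" "((\<lambda>n. f (- int (Suc n))) has_sum B) UNIV"
  shows "(f has_sum (f 0 + A + B)) UNIV"
proof -
  have P: "(f has_sum A) {0<..}"
  proof -
    have "bij_betw (\<lambda>n::nat. int (Suc n)) UNIV {0<..}"
      by (rule bij_betwI[of _ _ _ "\<lambda>i. nat i - 1"]) auto
    from has_sum_reindex_bij_betw[OF this, of f A] assms(1) show ?thesis by simp
  qed
  have N: "(f has_sum B) {..<0}"
  proof -
    have "bij_betw (\<lambda>n::nat. - int (Suc n)) UNIV {..<0}"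
      by (rule bij_betwI[of _ _ _ "\<lambda>i. nat (-i) - 1"]) auto
    from has_sum_reindex_bij_betw[OF this, of f B] assms(2) show ?thesis by simp
  qed
  have "(f has_sum (f 0 + A)) (insert 0 {0<..})"
    by (rule has_sum_insert[OF _ P]) auto
  then have "(f has_sum (f 0 + A + B)) (insert 0 {0<..} \<union> {..<0})"
    by (rule has_sum_Un_disjoint[OF _ N]) auto
  moreover have "insert 0 {0<..} \<union> {..<0} = (UNIV::int set)" by auto
  ultimately show ?thesis by simp
qed

text \<open>The exponent 3/2 is half of the cubic decay of \<open>eis_corr\<close>: shared equally
  between the two indices, that decay leaves two convergent single series.\<close>

lemma summable_on_int_powr:
  "(\<lambda>n::int. (1 + \<bar>real_of_int n\<bar>) powr (- (3 / 2))) summable_on UNIV"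
proof -
  have "summable (\<lambda>n. real n powr (- (3 / 2)))" by (subst summable_real_powr_iff) auto
  then have "summable (\<lambda>n. real (n + 2) powr (- (3 / 2)))"
    by (subst summable_iff_shift)
  then have s: "(\<lambda>n. (1 + real (Suc n)) powr (- (3 / 2))) summable_on UNIV"
    by (subst summable_on_UNIV_nonneg_real_iff) (auto simp: algebra_simps)
  show ?thesis unfolding summable_on_def
    by (rule exI, rule has_sum_int_nat[OF has_sum_infsum has_sum_infsum])
       (use s in \<open>auto simp: algebra_simps\<close>)
qed

text \<open>Both expansions come from Euler's reflection formula for \<open>rGamma\<close>: its
  logarithmic derivative expresses the cotangent as a difference of two \<open>Digamma\<close>
  values, whose limit formula gives the symmetric sums; one more derivative gives
  \<open>Polygamma 1\<close> and the inverse squares.\<close>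

lemma cot_partial_fractions:
  fixes z :: complex
  assumes "z \<notin> \<int>"
  shows "(\<lambda>N. \<Sum>k=-int N..int N. 1 / (z + of_int k)) \<longlonglongrightarrow> of_real pi * cot (of_real pi * z)"
    and "((\<lambda>k::int. 1 / (z + of_int k)^2) has_sum (of_real pi / sin (of_real pi * z))^2) UNIV"
proof -
  have int1: "1 - w \<notin> \<int>" if "w \<notin> \<int>" for w :: complex
    using that Ints_diff[OF Ints_1, of "1 - w"] by auto
  have nonpos: "w \<notin> \<int>\<^sub>\<le>\<^sub>0" if "w \<notin> \<int>" for w :: complex
    using that nonpos_Ints_subset_Ints by blast
  have sin0: "sin (of_real pi * w) \<noteq> 0" if "w \<notin> \<int>" for w :: complex
  proof
    assume "sin (of_real pi * w) = 0"
    then obtain n :: int where "of_real pi * w = of_real (of_int n * pi)"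
      by (auto simp: sin_eq_0)
    then have "w = of_int n" by (simp add: field_simps)
    with that show False by simp
  qed
  have refl: "Digamma w - Digamma (1 - w) = - of_real pi * cot (of_real pi * w)" if w: "w \<notin> \<int>" for w :: complex
  proof -
    let ?f = "\<lambda>w. rGamma w * rGamma (1 - w :: complex)"
    have "(?f has_field_derivative
        (- rGamma w * Digamma w * rGamma (1 - w) + rGamma w * (rGamma (1 - w) * Digamma (1 - w)))) (at w)"
    proof -
      have "((\<lambda>w. rGamma (1 - w)) has_field_derivative (- rGamma (1 - w) * Digamma (1 - w)) * (0 - 1)) (at w)"
        by (intro DERIV_chain2[where f = rGamma] has_field_derivative_rGamma_no_nonpos_int nonpos int1 w
            DERIV_diff DERIV_const DERIV_ident)
      from DERIV_mult[OF has_field_derivative_rGamma_no_nonpos_int[OF nonpos[OF w]] this]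
      show ?thesis by (simp add: algebra_simps)
    qed
    then have D1: "((\<lambda>w. sin (of_real pi * w) / of_real pi) has_field_derivative
        (- rGamma w * Digamma w * rGamma (1 - w) + rGamma w * (rGamma (1 - w) * Digamma (1 - w)))) (at w)"
      by (simp only: rGamma_reflection_complex)
    have "((\<lambda>w. sin (of_real pi * w) / of_real pi) has_field_derivative cos (of_real pi * w)) (at w)"
      by (auto intro!: derivative_eq_intros)
    from DERIV_unique[OF D1 this]
    have "- rGamma w * Digamma w * rGamma (1 - w) + rGamma w * (rGamma (1 - w) * Digamma (1 - w))
        = cos (of_real pi * w)" .
    then have "?f w * (Digamma w - Digamma (1 - w)) = - cos (of_real pi * w)"
      by (simp add: algebra_simps)
    then have "sin (of_real pi * w) / of_real pi * (Digamma w - Digamma (1 - w)) = - cos (of_real pi * w)"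
      by (simp add: rGamma_reflection_complex)
    then show ?thesis using sin0[OF w] by (simp add: cot_def field_simps)
  qed
  have z0: "z \<noteq> 0" "1 - z \<noteq> 0" using assms by auto
  define h where "h n = inverse (1 - z + of_nat n)" for n
  \<comment> \<open>The terms with \<open>k \<ge> 0\<close> outnumber the others by one; the surplus
    \<open>1 / (z + N)\<close> tends to 0. The logarithms in the two \<open>Digamma\<close> limits
    cancel.\<close>
  have partial_sum: "(\<Sum>k=-int N..int N. 1 / (z + of_int k)) =
      ((\<Sum>n<N. inverse (z + of_nat n)) - (\<Sum>n<N. h n)) + 1 / (z + of_nat N)" for N
  proof (induction N)
    case (Suc N)
    have "z + of_int (- 1 - int N) = - (1 - z + of_nat N)" by simp
    then have "1 / (z + of_int (- 1 - int N)) = - h N"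
      by (simp only: h_def inverse_eq_divide minus_divide_right)
    moreover have "(\<Sum>k=-int (Suc N)..int (Suc N). 1 / (z + of_int k)) = 1 / (z + of_int (int N + 1)) +
      (1 / (z + of_int (- 1 - int N)) + (\<Sum>k=-int N..int N. 1 / (z + of_int k)))"
      by (subst int_range_Suc) auto
    ultimately show ?case using Suc by (simp add: algebra_simps inverse_eq_divide)
  qed auto
  have "(\<lambda>m. (of_real (ln (real m)) - (\<Sum>n<m. h n)) - (of_real (ln (real m)) - (\<Sum>n<m. inverse (z + of_nat n))))
     \<longlonglongrightarrow> Digamma (1 - z) - Digamma z"
    unfolding h_def by (intro tendsto_diff Digamma_LIMSEQ z0)
  then have *: "(\<lambda>m. (\<Sum>n<m. inverse (z + of_nat n)) - (\<Sum>n<m. h n)) \<longlonglongrightarrow> Digamma (1 - z) - Digamma z"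
    by simp
  have l: "(\<lambda>m. (\<Sum>n<m. inverse (z + of_nat n)) - (\<Sum>n<m. h n)) \<longlonglongrightarrow> of_real pi * cot (of_real pi * z)"
  proof -
    have "Digamma (1 - z) - Digamma z = of_real pi * cot (of_real pi * z)"
      using refl[OF assms] by (metis minus_diff_eq minus_mult_left minus_minus)
    with * show ?thesis by simp
  qed
  have "(\<lambda>N. 1 / (z + of_nat N)) \<longlonglongrightarrow> 0"
    using tendsto_divide_0[OF tendsto_const tendsto_add_filterlim_at_infinity[OF tendsto_const tendsto_of_nat]] by blast
  from tendsto_add[OF l this]
  show "(\<lambda>N. \<Sum>k=-int N..int N. 1 / (z + of_int k)) \<longlonglongrightarrow> of_real pi * cot (of_real pi * z)"
    by (simp add: partial_sum)
  have openZ: "open (- (\<int> :: complex set))" by (auto intro: closed_Ints)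
  have der: "Polygamma 1 z + Polygamma 1 (1 - z) = (of_real pi / sin (of_real pi * z))^2"
  proof -
    have "((\<lambda>w. Digamma w - Digamma (1 - w)) has_field_derivative (Polygamma 1 z + Polygamma 1 (1 - z))) (at z)"
      by (auto intro!: derivative_eq_intros nonpos assms int1)
    then have "((\<lambda>w. - of_real pi * cot (of_real pi * w)) has_field_derivative (Polygamma 1 z + Polygamma 1 (1 - z))) (at z)"
      by (rule has_field_derivative_transform_within_open[OF _ openZ]) (use assms refl in auto)
    moreover have "((\<lambda>w. - of_real pi * (cos (of_real pi * w) / sin (of_real pi * w))) has_field_derivative
        - of_real pi * ((- sin (of_real pi * z) * of_real pi * sin (of_real pi * z) - cos (of_real pi * z) * (cos (of_real pi * z) * of_real pi)) / (sin (of_real pi * z) * sin (of_real pi * z)))) (at z)"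
      by (auto intro!: derivative_eq_intros simp: sin0[OF assms]) (simp add: algebra_simps)
    ultimately have "Polygamma 1 z + Polygamma 1 (1 - z) = - of_real pi * ((- sin (of_real pi * z) * of_real pi * sin (of_real pi * z) - cos (of_real pi * z) * (cos (of_real pi * z) * of_real pi)) / (sin (of_real pi * z) * sin (of_real pi * z)))"
      unfolding cot_def using DERIV_unique by blast
    also have "- p * ((- s * p * s - c * (c * p)) / (s * s)) = p^2 * (s^2 + c^2) / s^2" for p s c :: complex
      by (cases "s = 0") (simp_all add: field_simps power2_eq_square)
    finally show ?thesis by (simp only: sin_cos_squared_add) (simp add: power_divide)
  qed
  have abs: "(\<lambda>n. inverse ((w + of_nat n)^2)) summable_on UNIV" if "w \<noteq> 0" for w :: complex
  proof -
    have "summable (\<lambda>n. norm (inverse ((w + of_nat n)^2)))"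
    proof (rule summable_comparison_test_ev)
      show "summable (\<lambda>n. 4 * inverse (real n ^ 2))"
        by (intro summable_mult inverse_power_summable) auto
      obtain N :: nat where N: "real N > 2 * norm w" using reals_Archimedean2 by blast
      show "\<forall>\<^sub>F n in sequentially. norm (norm (inverse ((w + of_nat n)^2))) \<le> 4 * inverse (real n ^ 2)"
        using eventually_ge_at_top[of "Suc N"]
      proof eventually_elim
        case (elim n)
        have "norm (of_nat n :: complex) \<le> norm (w + of_nat n) + norm w"
          by (metis add_diff_cancel_left' norm_triangle_ineq4)
        then have "real n / 2 \<le> norm (w + of_nat n)" using N elim by simp
        then have "(real n / 2)^2 \<le> norm (w + of_nat n)^2" by (rule power_mono) auto
        then have "inverse (norm (w + of_nat n)^2) \<le> inverse ((real n / 2)^2)"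
          by (rule le_imp_inverse_le) (use elim in auto)
        then show ?case by (simp add: norm_inverse norm_power norm_divide power_divide field_simps)
      qed
    qed
    then show ?thesis by (rule norm_summable_imp_summable_on)
  qed
  have sum1: "((\<lambda>n. inverse ((w + of_nat n)^2)) has_sum Polygamma 1 w) UNIV" if "w \<noteq> 0" for w :: complex
  proof -
    have "(\<lambda>k. inverse ((w + of_nat k)^Suc 1)) sums ((-1) ^ Suc 1 * Polygamma 1 w / fact 1)"
      by (rule Polygamma_LIMSEQ) (use that in auto)
    then have "(\<lambda>k. inverse ((w + of_nat k)^2)) sums Polygamma 1 w" by (simp add: numeral_2_eq_2)
    from sums_unique2[OF has_sum_imp_sums[OF has_sum_infsum[OF abs[OF that]]] this]
    show ?thesis using has_sum_infsum[OF abs[OF that]] by simp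
  qed
  have A: "((\<lambda>n. 1 / (z + of_int (int (Suc n)))^2) has_sum (Polygamma 1 z - 1 / z^2)) UNIV"
  proof -
    have "((\<lambda>n. inverse ((z + of_nat n)^2)) has_sum Polygamma 1 z - inverse ((z + of_nat 0)^2)) (UNIV - {0})"
      by (rule has_sum_Diff[OF sum1[OF z0(1)]]) (auto intro!: has_sum_finiteI)
    moreover have bij: "bij_betw Suc UNIV (UNIV - {0})"
      by (rule bij_betwI[of _ _ _ "\<lambda>i. i - 1"]) auto
    ultimately have "((\<lambda>n. inverse ((z + of_nat (Suc n))^2)) has_sum Polygamma 1 z - inverse ((z + of_nat 0)^2)) UNIV"
      by (subst has_sum_reindex_bij_betw[OF bij, of "\<lambda>n. inverse ((z + of_nat n)^2)"])
    then show ?thesis by (simp add: inverse_eq_divide)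
  qed
  have B: "((\<lambda>n. 1 / (z + of_int (- int (Suc n)))^2) has_sum Polygamma 1 (1 - z)) UNIV"
  proof -
    have "1 / (z + of_int (- int (Suc n)))^2 = inverse ((1 - z + of_nat n)^2)" for n
    proof -
      have "z + of_int (- int (Suc n)) = - (1 - z + of_nat n)" by simp
      then show ?thesis by (simp only: power2_minus inverse_eq_divide)
    qed
    with sum1[OF z0(2)] show ?thesis by simp
  qed
  have "((\<lambda>k. 1 / (z + of_int k)^2) has_sum (1 / (z + of_int 0)^2 + (Polygamma 1 z - 1 / z^2) + Polygamma 1 (1 - z))) UNIV"
    by (rule has_sum_int_nat[OF A B])
  then show "((\<lambda>k::int. 1 / (z + of_int k)^2) has_sum (of_real pi / sin (of_real pi * z))^2) UNIV"
    using der by simp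
qed


section \<open>Sums of inverse squares in terms of q\<close>

definition qexp :: "complex \<Rightarrow> complex"
  where "qexp z = exp (2 * of_real pi * \<i> * z)"

lemma norm_qexp: "norm (qexp z) = exp (- (2 * pi * Im z))"
  by (simp add: qexp_def)

lemma norm_qexp_less_1: "Im z > 0 \<Longrightarrow> norm (qexp z) < 1"
  by (simp add: norm_qexp)

lemma qexp_nonzero [simp]: "qexp z \<noteq> 0"
  by (simp add: qexp_def)

lemma qexp_of_nat_mult: "qexp (of_nat n * z) = qexp z ^ n"
  by (simp add: qexp_def exp_of_nat_mult [symmetric] algebra_simps)

text \<open>Lipschitz's formula in weight two, with the series of all \<open>n q^n\<close> summed to
  \<open>q / (1 - q)^2\<close>.\<close>

lemma has_sum_inverse_squares_upper:
  assumes "Im w > 0"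
  shows "((\<lambda>k::int. 1 / (w + of_int k)^2) has_sum (- 4 * of_real pi ^ 2 * (qexp w / (1 - qexp w)^2))) UNIV"
proof -
  have "w \<notin> \<int>" using assms by (auto elim!: Ints_cases)
  have ne: "qexp w \<noteq> 1" using norm_qexp_less_1[OF assms] by auto
  define e where "e = exp (\<i> * of_real pi * w)"
  have e: "e \<noteq> 0" "e^2 = qexp w"
    by (auto simp: e_def qexp_def exp_of_nat_mult [symmetric] power2_eq_square exp_add [symmetric] algebra_simps)
  have "exp (- (\<i> * (of_real pi * w))) = inverse e" by (simp add: e_def exp_minus mult.assoc)
  then have "sin (of_real pi * w) = (e - inverse e) / (2 * \<i>)"
    by (simp add: sin_exp_eq e_def mult.assoc)
  then have "sin (of_real pi * w) ^ 2 = - ((e - inverse e) ^ 2) / 4"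
    by (simp add: power_divide power_mult_distrib)
  also have "(e - inverse e)^2 = (1 - e^2)^2 / e^2"
    using e(1) by (simp add: field_simps power2_eq_square)
  finally have "sin (of_real pi * w) ^ 2 = - ((1 - qexp w)^2 / qexp w) / 4" using e(2) by simp
  then have "(of_real pi / sin (of_real pi * w))^2 = - 4 * of_real pi ^ 2 * (qexp w / (1 - qexp w)^2)"
    using ne by (simp add: power_divide)
  with cot_partial_fractions(2)[OF \<open>w \<notin> \<int>\<close>] show ?thesis by simp
qed

section \<open>The corrected Eisenstein series over the lattice\<close>

lemma Im_inversion: "Im (- 1 / z) = Im z / norm z ^ 2"
  by (simp add: Im_divide cmod_power2)

lemma Im_inversion_pos: "Im z > 0 \<Longrightarrow> Im (- 1 / z) > 0"
  by (subst Im_inversion) (auto intro!: divide_pos_pos)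

text \<open>At \<open>m = n = 0\<close> the value is \<open>0\<close>, because \<open>1 / 0 = 0\<close>.\<close>

definition eis :: "complex \<Rightarrow> int \<Rightarrow> int \<Rightarrow> complex"
  where "eis z m n = 1 / (of_int m * z + of_int n)"

text \<open>With \<open>w = m z + n\<close> the subtracted difference is
  \<open>1 / (w (w + 1))\<close>, which leaves \<open>1 / (w^2 (w + 1))\<close> unless
  \<open>w\<close> or \<open>w + 1\<close> is 0. Cubic decay makes the double series absolutely
  convergent, while the inverse squares alone depend on the order of summation.\<close>

definition eis_corr :: "complex \<Rightarrow> int \<Rightarrow> int \<Rightarrow> complex"
  where "eis_corr z m n = eis z m n ^ 2 - (eis z m n - eis z m (n + 1))"

lemma lattice_point_bound:
  assumes "Im z > 0"
  obtains c where "c > 0" "\<And>m n. \<bar>real_of_int m\<bar> + \<bar>real_of_int n\<bar> \<le> c * norm (of_int m * z + of_int n)"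
proof -
  define c where "c = 1 / Im z + 1 + norm z / Im z"
  have "c > 0" unfolding c_def using assms by (intro add_pos_nonneg) auto
  moreover have "\<bar>real_of_int m\<bar> + \<bar>real_of_int n\<bar> \<le> c * norm (of_int m * z + of_int n)" for m n
  proof -
    let ?w = "of_int m * z + of_int n :: complex"
    have "\<bar>Im ?w\<bar> \<le> norm ?w" by (rule abs_Im_le_cmod)
    then have 1: "\<bar>real_of_int m\<bar> \<le> norm ?w / Im z" using assms by (simp add: abs_mult field_simps)
    have "norm (of_int n :: complex) \<le> norm ?w + norm (of_int m * z)"
      by (metis add_diff_cancel_left' norm_triangle_ineq4)
    then have "\<bar>real_of_int n\<bar> \<le> norm ?w + \<bar>real_of_int m\<bar> * norm z" by (simp add: norm_mult)
    also have "\<dots> \<le> norm ?w + norm ?w / Im z * norm z"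
      using mult_right_mono[OF 1, of "norm z"] by simp
    finally show ?thesis using 1 by (simp add: c_def field_simps)
  qed
  ultimately show ?thesis by (rule that)
qed

lemma lattice_point_nonzero:
  assumes "Im z > 0" "(m, n) \<noteq> (0, 0)"
  shows "of_int m * z + of_int n \<noteq> (0::complex)"
proof
  assume "of_int m * z + of_int n = (0::complex)"
  then have "Im (of_int m * z + of_int n) = 0" "Re (of_int m * z + of_int n) = 0" by auto
  then show False using assms by auto
qed

lemma eis_corr_summable:
  assumes "Im z > 0"
  shows "(\<lambda>(m, n). eis_corr z m n) summable_on UNIV \<times> UNIV"
proof -
  obtain c where c: "c > 0" "\<And>m n. \<bar>real_of_int m\<bar> + \<bar>real_of_int n\<bar> \<le> c * norm (of_int m * z + of_int n)"
    using lattice_point_bound[OF assms] by blast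
  \<comment> \<open>At these two points \<open>w\<close> or \<open>w + 1\<close> is 0 and the
    partial fraction identity fails.\<close>
  define E where "E = {(0::int, 0::int), (0, -1)}"
  let ?p = "\<lambda>n::int. (1 + \<bar>real_of_int n\<bar>) powr (- (3 / 2))"
  have partial: "(1 / w)^2 - (1 / w - 1 / (w + 1)) = 1 / (w^2 * (w + 1))"
    if "w \<noteq> 0" "w + 1 \<noteq> 0" for w :: complex
    using that by (simp add: divide_simps power2_eq_square)
  have "(\<lambda>(m, n). ?p m * ?p n) summable_on UNIV \<times> UNIV"
    by (rule summable_on_SigmaI[where g = "\<lambda>m. ?p m * infsum ?p UNIV"])
       (auto intro!: has_sum_cmult_right has_sum_infsum summable_on_cmult_left summable_on_int_powr)
  then have s: "(\<lambda>x. (12 * c^3) * (case x of (m, n) \<Rightarrow> ?p m * ?p n)) summable_on (UNIV - E)"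
    by (intro summable_on_cmult_right) (auto intro: summable_on_subset)
  have "(\<lambda>(m, n). eis_corr z m n) summable_on (UNIV - E)"
  proof (rule abs_summable_summable, rule Infinite_Sum.abs_summable_on_comparison_test'[OF s], safe)
    fix m n assume mn: "(m, n) \<notin> E"
    let ?w = "of_int m * z + of_int n :: complex"
    have w: "?w \<noteq> 0" using lattice_point_nonzero[OF assms, of m n] mn by (auto simp: E_def)
    have w1: "?w + 1 \<noteq> 0" using lattice_point_nonzero[OF assms, of m "n + 1"] mn by (auto simp: E_def add.assoc)
    have e: "eis_corr z m n = 1 / (?w^2 * (?w + 1))"
      using partial[OF w w1] by (simp add: eis_corr_def eis_def add.assoc)
    define a where "a = 1 + \<bar>real_of_int m\<bar>"
    define b where "b = 1 + \<bar>real_of_int n\<bar>"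
    define s where "s = 1 + \<bar>real_of_int m\<bar> + \<bar>real_of_int n\<bar>"
    have "s \<le> 2 * (\<bar>real_of_int m\<bar> + \<bar>real_of_int n\<bar>)" using mn unfolding E_def s_def
      by (cases "m = 0"; cases "n = 0") auto
    also have "\<dots> \<le> 2 * (c * norm ?w)" by (intro mult_left_mono c) auto
    finally have b1: "s \<le> 2 * c * norm ?w" by simp
    have "1 + \<bar>m\<bar> + \<bar>n\<bar> \<le> 3 * (\<bar>m\<bar> + \<bar>n + 1\<bar>)"
    proof -
      have "\<bar>n\<bar> \<le> \<bar>n + 1\<bar> + 1" by simp
      moreover have "1 \<le> \<bar>m\<bar> \<or> 1 \<le> \<bar>n + 1\<bar>"
        using mn unfolding E_def by (cases "m = 0") auto
      ultimately show ?thesis by (smt (verit) abs_ge_zero)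
    qed
    then have "real_of_int (1 + \<bar>m\<bar> + \<bar>n\<bar>) \<le> real_of_int (3 * (\<bar>m\<bar> + \<bar>n + 1\<bar>))"
      by (simp only: of_int_le_iff)
    then have "s \<le> 3 * (\<bar>real_of_int m\<bar> + \<bar>real_of_int (n + 1)\<bar>)" by (simp add: s_def)
    also have "\<dots> \<le> 3 * (c * norm (of_int m * z + of_int (n + 1)))" by (intro mult_left_mono c) auto
    finally have b2: "s \<le> 3 * c * norm (?w + 1)" by (simp add: add.assoc)
    have s1: "s \<ge> 1" by (simp add: s_def)
    have "s * s * s \<le> (2 * c * norm ?w) * (2 * c * norm ?w) * (3 * c * norm (?w + 1))"
      using s1 c(1) by (intro mult_mono b1 b2) auto
    then have b3: "s^3 \<le> 12 * c^3 * norm (?w^2 * (?w + 1))"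
      unfolding norm_mult norm_power power2_eq_square power3_eq_cube by (simp only: mult_ac)
    \<comment> \<open>\<open>s\<close> dominates both \<open>a\<close> and \<open>b\<close>, so
      \<open>s^3\<close> dominates \<open>(a b)^(3/2)\<close>.\<close>
    have "a * b \<le> s * s"
      unfolding a_def b_def s_def by (intro mult_mono) auto
    then have "(a * b) powr (3/2) \<le> (s * s) powr (3/2)"
      by (intro powr_mono2) (auto simp: a_def b_def)
    also have "(s * s) powr (3/2) = (s powr 2) powr (3/2)" using s1 by (simp add: power2_eq_square)
    also have "\<dots> = s ^ 3" using s1 by (simp add: powr_powr del: powr_numeral) (simp add: powr_numeral)
    finally have "(a * b) powr (3/2) \<le> 12 * c^3 * norm (?w^2 * (?w + 1))" using b3 by simp
    moreover have "0 < (a * b) powr (3/2)" "0 < norm (?w^2 * (?w + 1))"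
      using w w1 by (auto simp: a_def b_def)
    ultimately have "1 / norm (?w^2 * (?w + 1)) \<le> 12 * c^3 / (a * b) powr (3/2)"
      by (simp add: field_simps)
    also have "\<dots> = 12 * c^3 * (a powr (- (3 / 2)) * b powr (- (3 / 2)))"
      by (simp add: powr_minus_divide powr_mult a_def b_def)
    finally show "norm (eis_corr z m n) \<le> 12 * c ^ 3 * (?p m * ?p n)"
      unfolding e a_def b_def by (simp add: norm_divide)
  qed
  moreover have "(\<lambda>(m, n). eis_corr z m n) summable_on E"
    by (rule summable_on_finite) (simp add: E_def)
  ultimately have "(\<lambda>(m, n). eis_corr z m n) summable_on ((UNIV - E) \<union> E)"
    by (rule summable_on_union)
  then show ?thesis by (simp add: Un_absorb2)
qed

text \<open>At \<open>w = 0\<close> the term \<open>n = 0\<close> is \<open>1 / 0 = 0\<close>, so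
  the value there is 2 zeta(2); this is the row \<open>m = 0\<close> of the double series.\<close>

definition inv_sq_sum :: "complex \<Rightarrow> complex"
  where "inv_sq_sum w = (\<Sum>\<^sub>\<infinity>n::int. 1 / (w + of_int n)^2)"

lemma has_sum_inv_sq_sum:
  assumes "w = 0 \<or> Im w \<noteq> 0"
  shows "((\<lambda>n::int. 1 / (w + of_int n)^2) has_sum inv_sq_sum w) UNIV"
    and "inv_sq_sum 0 = of_real pi ^ 2 / 3"
proof -
  have "((\<lambda>n. 1 / (real n + 1)^2) has_sum (pi^2/6)) UNIV"
    using inverse_squares_sums by (intro sums_nonneg_imp_has_sum) (auto simp: add_ac)
  then have *: "((\<lambda>n. of_real (1 / (real n + 1)^2)) has_sum (of_real (pi^2/6) :: complex)) (UNIV::nat set)"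
    by (rule has_sum_of_real)
  have e: "of_real (1 / (real n + 1)^2) = 1 / (0 + of_int (int (Suc n)) :: complex)^2"
    "of_real (1 / (real n + 1)^2) = 1 / (0 + of_int (- int (Suc n)) :: complex)^2" for n :: nat
  proof -
    have "(0 + of_int (- int (Suc n)) :: complex) = - (1 + of_nat n)" by simp
    then show "of_real (1 / (real n + 1)^2) = 1 / (0 + of_int (- int (Suc n)) :: complex)^2"
      by (simp only: power2_minus) (simp add: add.commute)
  qed (simp add: add.commute)
  from has_sum_int_nat[OF *[unfolded e(1)] *[unfolded e(2)]]
  have 0: "((\<lambda>n::int. 1 / (0 + of_int n)^2) has_sum (of_real pi ^ 2 / 3 :: complex)) UNIV"
    by simp
  then show "inv_sq_sum 0 = of_real pi ^ 2 / 3"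
    unfolding inv_sq_sum_def by (rule infsumI)
  show "((\<lambda>n::int. 1 / (w + of_int n)^2) has_sum inv_sq_sum w) UNIV"
  proof (cases "w = 0")
    case True
    with 0 show ?thesis unfolding inv_sq_sum_def using has_sum_infsum summable_on_def by blast
  next
    case False
    with assms have "w \<notin> \<int>" by (auto elim!: Ints_cases)
    from cot_partial_fractions(2)[OF this] show ?thesis
      unfolding inv_sq_sum_def using has_sum_infsum summable_on_def by blast
  qed
qed

lemma inv_sq_sum_minus: "inv_sq_sum (- w) = inv_sq_sum w"
proof -
  have "bij_betw (\<lambda>n::int. - n) UNIV UNIV" by (rule bij_betwI[of _ _ _ uminus]) auto
  then have "(\<Sum>\<^sub>\<infinity>n::int. 1 / (- w + of_int (- n))^2) = (\<Sum>\<^sub>\<infinity>n::int. 1 / (- w + of_int n)^2)"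
    by (rule infsum_reindex_bij_betw)
  moreover have "(- w + of_int (- n))^2 = (w + of_int n)^2" for n
    by (simp add: power2_eq_square algebra_simps)
  ultimately show ?thesis by (simp add: inv_sq_sum_def)
qed


lemma LIMSEQ_inverse_shift:
  fixes w :: complex
  shows "(\<lambda>N. 1 / (w + of_nat N)) \<longlonglongrightarrow> 0" "(\<lambda>N. 1 / (w - of_nat N)) \<longlonglongrightarrow> 0"
proof -
  have *: "(\<lambda>N. 1 / (w + of_nat N)) \<longlonglongrightarrow> 0" for w :: complex
    using tendsto_divide_0[OF tendsto_const tendsto_add_filterlim_at_infinity[OF tendsto_const tendsto_of_nat]] by blast
  show "(\<lambda>N. 1 / (w + of_nat N)) \<longlonglongrightarrow> 0" by (rule *)
  have "(\<lambda>N. - (1 / (- w + of_nat N))) \<longlonglongrightarrow> - 0" by (intro tendsto_minus *)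
  moreover have "- (1 / (- w + of_nat N)) = 1 / (w - of_nat N)" for N
    by (metis add_uminus_conv_diff minus_add_distrib minus_divide_right minus_minus)
  ultimately show "(\<lambda>N. 1 / (w - of_nat N)) \<longlonglongrightarrow> 0" by simp
qed

text \<open>Along a row the difference telescopes between two ends that tend to 0, so only the
  inverse squares remain.\<close>

lemma eis_corr_row:
  assumes "Im z > 0"
  shows "((\<lambda>n. eis_corr z m n) has_sum inv_sq_sum (of_int m * z)) UNIV"
proof -
  let ?w = "of_int m * z"
  have "(\<lambda>n. eis_corr z m n) summable_on UNIV"
    using summable_on_SigmaD1[OF eis_corr_summable[OF assms]] by blast
  then have h: "((\<lambda>n. eis_corr z m n) has_sum infsum (\<lambda>n. eis_corr z m n) UNIV) UNIV" by simp
  have "(\<lambda>N. \<Sum>n=-int N..int N. eis_corr z m n) \<longlonglongrightarrow> inv_sq_sum ?w - (0 - 0)"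
    unfolding eis_corr_def sum_subtractf[of _ "\<lambda>n. eis z m n - eis z m (n + 1)"] sum_int_telescope
  proof (intro tendsto_diff)
    have "?w = 0 \<or> Im ?w \<noteq> 0" using assms by auto
    from has_sum_int_LIMSEQ[OF has_sum_inv_sq_sum(1)[OF this]]
    show "(\<lambda>N. \<Sum>n=-int N..int N. eis z m n ^ 2) \<longlonglongrightarrow> inv_sq_sum ?w"
      by (simp add: eis_def power_divide)
    show "(\<lambda>N. eis z m (- int N)) \<longlonglongrightarrow> 0"
      using LIMSEQ_inverse_shift(2)[of ?w] by (simp add: eis_def)
    show "(\<lambda>N. eis z m (int N + 1)) \<longlonglongrightarrow> 0"
      using LIMSEQ_inverse_shift(1)[of "?w + 1"] by (simp add: eis_def add_ac)
  qed
  with has_sum_int_LIMSEQ[OF h] have "infsum (\<lambda>n. eis_corr z m n) UNIV = inv_sq_sum ?w"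
    using LIMSEQ_unique by fastforce
  with h show ?thesis by simp
qed

text \<open>Along a column the difference does not telescope but is summed by the cotangent series
  at \<open>n / z\<close>; this contribution is what survives in
  \<open>G2_inversion\<close>.\<close>

lemma eis_corr_column:
  assumes "Im z > 0"
  defines "c \<equiv> \<lambda>n::int. of_real pi / z * cot (of_real pi * (of_int n / z))"
  shows "((\<lambda>m. eis_corr z m n) has_sum (inv_sq_sum (of_int n / z) / z^2 - (c n - c (n + 1)))) UNIV"
proof -
  have z: "z \<noteq> 0" using assms by auto
  have eis: "eis z m n = 1 / z * (1 / (of_int n / z + of_int m))" for m n
    using z by (simp add: eis_def field_simps)
  have im: "of_int n / z = 0 \<or> Im (of_int n / z) \<noteq> 0" for n
    using assms z by (cases "n = 0") (auto simp: Im_divide)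
  have cn: "(\<lambda>N. \<Sum>m=-int N..int N. eis z m n) \<longlonglongrightarrow> c n" for n
  proof (cases "n = 0")
    case True
    have "(\<Sum>m=-int N..int N. eis z m n) = 0" for N
      by (subst sum_int_symmetric) (simp add: True eis_def)
    \<comment> \<open>The totalised quotient \<open>cot 0 = 1 / 0 = 0\<close> agrees with the
      vanishing of the odd sum.\<close>
    moreover have "c n = 0" using True by (simp add: c_def cot_def)
    ultimately show ?thesis by simp
  next
    case False
    have "of_int n / z \<notin> \<int>" using im[of n] False z by (auto elim!: Ints_cases)
    from tendsto_mult[OF tendsto_const[of "1 / z"] cot_partial_fractions(1)[OF this]]
    show ?thesis by (simp add: eis sum_distrib_left c_def)
  qed
  have "(\<lambda>(n, m). eis_corr z m n) summable_on UNIV \<times> UNIV"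
    using eis_corr_summable[OF assms(1)] summable_on_swap[of "\<lambda>(m, n). eis_corr z m n" UNIV UNIV]
    by simp
  then have "(\<lambda>m. eis_corr z m n) summable_on UNIV"
    using summable_on_SigmaD1[of "\<lambda>n m. eis_corr z m n" UNIV "\<lambda>_. UNIV" n] by blast
  then have h: "((\<lambda>m. eis_corr z m n) has_sum infsum (\<lambda>m. eis_corr z m n) UNIV) UNIV" by simp
  have "(\<lambda>N. \<Sum>m=-int N..int N. eis_corr z m n) \<longlonglongrightarrow> inv_sq_sum (of_int n / z) / z^2 - (c n - c (n + 1))"
    unfolding eis_corr_def sum_subtractf
  proof (intro tendsto_diff cn)
    from tendsto_mult[OF tendsto_const[of "1 / z^2"] has_sum_int_LIMSEQ[OF has_sum_inv_sq_sum(1)[OF im[of n]]]]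
    show "(\<lambda>N. \<Sum>m=-int N..int N. eis z m n ^ 2) \<longlonglongrightarrow> inv_sq_sum (of_int n / z) / z^2"
      by (simp add: eis power_divide power_mult_distrib sum_distrib_left)
  qed
  with has_sum_int_LIMSEQ[OF h] have "infsum (\<lambda>m. eis_corr z m n) UNIV = inv_sq_sum (of_int n / z) / z^2 - (c n - c (n + 1))"
    using LIMSEQ_unique by fastforce
  with h show ?thesis by simp
qed

text \<open>Valid without exception: at integral \<open>u\<close> both sides are quotients by 0. The
  form in \<open>q\<close> shows the limit high up in the half-plane.\<close>

lemma cot_eq_qexp: "cot (of_real pi * u) = \<i> * (qexp u + 1) / (qexp u - 1)"
proof -
  define e where "e = exp (\<i> * of_real pi * u)"
  have e: "e \<noteq> 0" "e^2 = qexp u"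
    by (auto simp: e_def qexp_def power2_eq_square exp_add [symmetric] algebra_simps)
  have i: "exp (- (\<i> * (of_real pi * u))) = inverse e" by (simp add: e_def exp_minus mult.assoc)
  have s: "sin (of_real pi * u) = (e - inverse e) / (2 * \<i>)"
    using i by (simp add: sin_exp_eq e_def mult.assoc)
  have c: "cos (of_real pi * u) = (e + inverse e) / 2"
    using i by (simp add: cos_exp_eq e_def mult.assoc)
  have "a / 2 / (b / (2 * \<i>)) = \<i> * a / b" for a b :: complex by (simp add: field_simps)
  then have "cot (of_real pi * u) = \<i> * (e + inverse e) / (e - inverse e)"
    unfolding cot_def s c .
  also have "\<dots> = (\<i> * (e + inverse e) * e) / ((e - inverse e) * e)"
    using e(1) by (subst mult_divide_mult_cancel_right) auto
  also have "\<dots> = \<i> * (e^2 + 1) / (e^2 - 1)"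
    using e(1) by (simp add: algebra_simps power2_eq_square)
  finally show ?thesis using e(2) by simp
qed

definition G2 :: "complex \<Rightarrow> complex"
  where "G2 z = (\<Sum>\<^sub>\<infinity>m::int. inv_sq_sum (of_int m * z))"

lemma has_sum_G2:
  assumes "Im z > 0"
  shows "((\<lambda>m. inv_sq_sum (of_int m * z)) has_sum G2 z) UNIV"
    and "((\<lambda>(m, n). eis_corr z m n) has_sum G2 z) (UNIV \<times> UNIV)"
proof -
  obtain S where S: "((\<lambda>(m, n). eis_corr z m n) has_sum S) (UNIV \<times> UNIV)"
    using eis_corr_summable[OF assms] by (auto simp: summable_on_def)
  have *: "((\<lambda>m. inv_sq_sum (of_int m * z)) has_sum S) UNIV"
    by (rule has_sum_SigmaD[OF S]) (use eis_corr_row[OF assms] in auto)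
  then have "S = G2 z" unfolding G2_def by (rule infsumI[symmetric])
  with * S show "((\<lambda>m. inv_sq_sum (of_int m * z)) has_sum G2 z) UNIV"
    "((\<lambda>(m, n). eis_corr z m n) has_sum G2 z) (UNIV \<times> UNIV)" by auto
qed

text \<open>Summing \<^const>\<open>eis_corr\<close> by rows gives \<open>G2 z\<close>; by columns it gives \<open>G2 (- 1 / z) / z\<^sup>2\<close>
  up to a telescoping sum of cotangents, whose limits at both ends produce the defect
  \<open>2 pi i / z\<close>.\<close>

lemma G2_inversion:
  assumes "Im z > 0"
  shows "G2 z = G2 (- 1 / z) / z^2 + 2 * of_real pi * \<i> / z"
proof -
  have z: "z \<noteq> 0" using assms by auto
  define v where "v = - 1 / z"
  have v: "Im v > 0" unfolding v_def by (rule Im_inversion_pos[OF assms])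
  define c where "c n = of_real pi / z * cot (of_real pi * (of_int n / z))" for n :: int
  have "((\<lambda>(n, m). eis_corr z m n) has_sum G2 z) (UNIV \<times> UNIV)"
    using has_sum_G2(2)[OF assms] by (subst has_sum_swap) simp
  then have 1: "((\<lambda>n. inv_sq_sum (of_int n / z) / z^2 - (c n - c (n + 1))) has_sum G2 z) UNIV"
    by (rule has_sum_SigmaD) (use eis_corr_column[OF assms] in \<open>auto simp: c_def\<close>)
  have inv: "inv_sq_sum (of_int n * v) = inv_sq_sum (of_int n / z)" for n
    using inv_sq_sum_minus[of "of_int n / z"] by (simp add: v_def)
  have "((\<lambda>n. inv_sq_sum (of_int n / z) * (1 / z^2)) has_sum G2 v * (1 / z^2)) UNIV"
    by (rule has_sum_cmult_left) (use has_sum_G2(1)[OF v] in \<open>simp add: inv\<close>)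
  then have 2: "((\<lambda>n. inv_sq_sum (of_int n / z) / z^2) has_sum G2 v / z^2) UNIV" by simp
  have "((\<lambda>n. inv_sq_sum (of_int n / z) / z^2 - (inv_sq_sum (of_int n / z) / z^2 - (c n - c (n + 1))))
      has_sum G2 v / z^2 - G2 z) UNIV"
    using has_sum_add[OF 2 has_sum_uminusI[OF 1]] by simp
  then have "((\<lambda>n. c n - c (n + 1)) has_sum G2 v / z^2 - G2 z) UNIV" by simp
  from has_sum_int_LIMSEQ[OF this] have L: "(\<lambda>N. c (- int N) - c (int N + 1)) \<longlonglongrightarrow> G2 v / z^2 - G2 z"
    by (simp add: sum_int_telescope)
  have cN: "c (- int N) = of_real pi / z * (\<i> * (qexp v ^ N + 1) / (qexp v ^ N - 1))" for N
  proof -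
    have "of_int (- int N) / z = of_nat N * v" by (simp add: v_def)
    then show ?thesis by (simp only: c_def cot_eq_qexp qexp_of_nat_mult)
  qed
  \<comment> \<open>\<open>v\<close> lies in the half-plane, so the powers of \<open>qexp v\<close>
    tend to 0 and the cotangent to \<open>-\<i>\<close>; the opposite end follows because
    \<open>c\<close> is odd.\<close>
  have "(\<lambda>N. c (- int N)) \<longlonglongrightarrow> of_real pi / z * (\<i> * (0 + 1) / (0 - 1))"
    unfolding cN by (intro tendsto_intros LIMSEQ_power_zero norm_qexp_less_1 v) auto
  then have l1: "(\<lambda>N. c (- int N)) \<longlonglongrightarrow> - of_real pi * \<i> / z" by simp
  have "c (- n) = - c n" for n by (simp add: c_def cot_def)
  then have "c (int N + 1) = - c (- int (Suc N))" for N by (metis add.inverse_inverse of_nat_Suc add.commute)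
  then have "(\<lambda>N. c (- int N) - c (int N + 1)) \<longlonglongrightarrow> - of_real pi * \<i> / z - - (- of_real pi * \<i> / z)"
    using tendsto_diff[OF l1 tendsto_minus[OF LIMSEQ_Suc[OF l1]]] by simp
  from LIMSEQ_unique[OF this L] show ?thesis by (simp add: v_def field_simps)
qed


section \<open>Lambert series and the identification with E2\<close>

lemma has_sum_nat_times_power:
  fixes x :: "'a::{real_normed_field,banach}"
  assumes "norm x < 1"
  shows "((\<lambda>n. of_nat (Suc n) * x ^ Suc n) has_sum (x / (1 - x)^2)) UNIV"
proof (rule norm_summable_imp_has_sum)
  have "(\<lambda>n. x * (of_nat (Suc n) * x ^ n)) sums (x * (1 / (1 - x)^2))"
    by (intro sums_mult geometric_deriv_sums assms)
  then show "(\<lambda>n. of_nat (Suc n) * x ^ Suc n) sums (x / (1 - x)^2)" by (simp add: mult_ac)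
  have "(\<lambda>n. norm x * (of_nat (Suc n) * norm x ^ n)) sums (norm x * (1 / (1 - norm x)^2))"
    using assms by (intro sums_mult geometric_deriv_sums) auto
  then show "summable (\<lambda>n. norm (of_nat (Suc n) * x ^ Suc n))"
    by (auto simp: sums_iff norm_mult norm_power mult_ac simp del: of_nat_Suc)
qed

text \<open>Each Lambert term expands as the sum of \<open>d q^(k d)\<close>; the absolutely
  convergent double series is regrouped by \<open>n = k d\<close>.\<close>

lemma lambert_sigma:
  fixes q :: complex
  assumes q: "norm q < 1"
  shows "(\<lambda>k. q ^ Suc k / (1 - q ^ Suc k)^2) sums
      (\<Sum>n. of_nat (\<Sum>d | d dvd Suc n. d) * q ^ Suc n)" (is "?f sums _")
    and "summable (\<lambda>n. of_nat (\<Sum>d | d dvd Suc n. d) * q ^ Suc n)"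
proof -
  let ?g = "\<lambda>(k, d). of_nat (Suc d) * q ^ (Suc k * Suc d)"
  have pow: "norm (x ^ Suc k) < 1" if "norm x < 1" for x :: "'b::real_normed_field" and k
    using that power_decreasing[of 1 "Suc k" "norm x"] by (simp add: norm_power norm_mult)
  have "(\<lambda>x. norm (?g x)) summable_on UNIV \<times> UNIV"
  proof (rule summable_on_SigmaI)
    define r where "r = norm q"
    have r: "0 \<le> r" "r < 1" using q by (auto simp: r_def)
    have rs: "r ^ Suc k \<le> r" for k using power_decreasing[of 1 "Suc k" r] r by simp
    show "((\<lambda>d. norm (?g (k, d))) has_sum (r ^ Suc k / (1 - r ^ Suc k)^2)) UNIV" for k
      using has_sum_nat_times_power[OF pow[of r k]] r
      by (simp add: norm_mult norm_power power_mult [symmetric] r_def del: power_Suc of_nat_Suc)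
    show "(\<lambda>k. r ^ Suc k / (1 - r ^ Suc k)^2) summable_on UNIV"
    proof (rule summable_on_comparison_test)
      have "summable (\<lambda>k. r ^ k * (r / (1 - r)^2))"
        using r by (intro summable_mult2 summable_geometric) auto
      then show "(\<lambda>k. r ^ k * (r / (1 - r)^2)) summable_on UNIV"
        using r by (subst summable_on_UNIV_nonneg_real_iff) auto
      have "(1 - r)^2 \<le> (1 - r ^ Suc k)^2" for k
        using rs[of k] r by (intro power_mono) auto
      moreover have "0 < 1 - r ^ Suc k" for k using rs[of k] r by linarith
      ultimately have "r ^ Suc k / (1 - r ^ Suc k)^2 \<le> r ^ Suc k / (1 - r)^2" for k
        using r by (intro divide_left_mono) (auto intro!: mult_pos_pos zero_less_power simp del: power_Suc)
      then show "r ^ Suc k / (1 - r ^ Suc k)^2 \<le> r ^ k * (r / (1 - r)^2)" for k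
        by (simp add: mult_ac)
      show "0 \<le> r ^ Suc k / (1 - r ^ Suc k)^2" for k using r by simp
    qed
  qed auto
  then have "?g summable_on UNIV \<times> UNIV" by (rule abs_summable_summable)
  then obtain S where S: "(?g has_sum S) (UNIV \<times> UNIV)" by (auto simp: summable_on_def)
  have "((\<lambda>k. q ^ Suc k / (1 - q ^ Suc k)^2) has_sum S) UNIV"
  proof (rule has_sum_SigmaD[OF S])
    fix k
    show "((\<lambda>d. ?g (k, d)) has_sum q ^ Suc k / (1 - q ^ Suc k)^2) UNIV"
      using has_sum_nat_times_power[OF pow[OF q, of k]]
      by (simp only: prod.case power_mult)
  qed
  then have 1: "?f sums S" by (rule has_sum_imp_sums)
  let ?B = "SIGMA n:UNIV. {d::nat. d dvd Suc n}"
  \<comment> \<open>All indices start at 0, so \<open>(k, d)\<close> stands for the factorisation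
    \<open>Suc n = Suc k * Suc d\<close>; the second component keeps the divisor itself.\<close>
  have "bij_betw (\<lambda>(k, d). (Suc k * Suc d - 1, Suc d)) (UNIV \<times> UNIV) ?B"
  proof (rule bij_betw_byWitness[where f' = "\<lambda>(n, d). (Suc n div d - 1, d - 1)"])
    show "\<forall>x\<in>UNIV \<times> UNIV. (\<lambda>(n, d). (Suc n div d - 1, d - 1))
        ((\<lambda>(k, d). (Suc k * Suc d - 1, Suc d)) x) = x"
    proof
      fix x :: "nat \<times> nat"
      obtain k d where x: "x = (k, d)" by (cases x)
      have "Suc (Suc k * Suc d - 1) = Suc k * Suc d" by simp
      then show "(\<lambda>(n, d). (Suc n div d - 1, d - 1)) ((\<lambda>(k, d). (Suc k * Suc d - 1, Suc d)) x) = x"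
        unfolding x by (simp only: prod.case nonzero_mult_div_cancel_right[OF nat.simps(3)] diff_Suc_1)
    qed
    have *: "\<exists>k e. d = Suc e \<and> Suc n = Suc k * Suc e" if dvd: "d dvd Suc n" for n d :: nat
    proof -
      obtain c where "Suc n = d * c" using dvd by (auto simp: dvd_def)
      then show ?thesis by (cases d; cases c) (auto simp: mult.commute)
    qed
    show "\<forall>x\<in>?B. (\<lambda>(k, d). (Suc k * Suc d - 1, Suc d)) ((\<lambda>(n, d). (Suc n div d - 1, d - 1)) x) = x"
    proof
      fix x assume "x \<in> ?B"
      then obtain n d where x: "x = (n, d)" "d dvd Suc n" by blast
      with * obtain k e where "d = Suc e" "Suc n = Suc k * Suc e" by blast
      then show "(\<lambda>(k, d). (Suc k * Suc d - 1, Suc d)) ((\<lambda>(n, d). (Suc n div d - 1, d - 1)) x) = x"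
        unfolding x by (simp only: prod.case nonzero_mult_div_cancel_right[OF nat.simps(3)] diff_Suc_1) simp
    qed
  qed (auto simp del: mult_Suc mult_Suc_right)
  from has_sum_reindex_bij_betw[OF this, of "\<lambda>(n, d). of_nat d * q ^ Suc n" S]
  have "((\<lambda>(n, d). of_nat d * q ^ Suc n) has_sum S) ?B"
    using S by (simp add: case_prod_unfold)
  then have "((\<lambda>n. of_nat (\<Sum>d | d dvd Suc n. d) * q ^ Suc n) has_sum S) UNIV"
    by (rule has_sum_SigmaD) (auto intro!: has_sum_finiteI simp: sum_distrib_right)
  then have "(\<lambda>n. of_nat (\<Sum>d | d dvd Suc n. d) * q ^ Suc n) sums S" by (rule has_sum_imp_sums)
  with 1 show "?f sums (\<Sum>n. of_nat (\<Sum>d | d dvd Suc n. d) * q ^ Suc n)"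
    and "summable (\<lambda>n. of_nat (\<Sum>d | d dvd Suc n. d) * q ^ Suc n)" by (auto simp: sums_iff)
qed

text \<open>The row \<open>m = 0\<close> gives \<open>pi^2 / 3\<close>, the rows \<open>m\<close>
  and \<open>-m\<close> agree, and \<open>-8 pi^2 = -24 pi^2 / 3\<close> is the origin of the
  coefficient -24.\<close>

lemma G2_eq_E2:
  assumes "Im z > 0"
  shows "G2 z = of_real pi ^ 2 / 3 * E2 z"
proof -
  let ?s = "\<Sum>n. of_nat (\<Sum>d | d dvd Suc n. d) * qexp z ^ Suc n"
  have inv: "inv_sq_sum (of_int (int (Suc k)) * z) = - 4 * of_real pi ^ 2 * (qexp z ^ Suc k / (1 - qexp z ^ Suc k)^2)" for k
  proof -
    have "Im (of_int (int (Suc k)) * z) > 0" using assms by (simp add: add_pos_nonneg)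
    then have "inv_sq_sum (of_int (int (Suc k)) * z) = - 4 * of_real pi ^ 2 *
       (qexp (of_int (int (Suc k)) * z) / (1 - qexp (of_int (int (Suc k)) * z))^2)"
      unfolding inv_sq_sum_def by (intro infsumI has_sum_inverse_squares_upper)
    moreover have "qexp (of_int (int (Suc k)) * z) = qexp z ^ Suc k"
      using qexp_of_nat_mult[of "Suc k" z] by simp
    ultimately show ?thesis by simp
  qed
  have neg: "inv_sq_sum (of_int (- int k) * z) = inv_sq_sum (of_int (int k) * z)" for k
    using inv_sq_sum_minus[of "of_int (int k) * z"] by simp
  have "(\<lambda>N. \<Sum>m=-int N..int N. inv_sq_sum (of_int m * z)) \<longlonglongrightarrow> G2 z"
    by (rule has_sum_int_LIMSEQ[OF has_sum_G2(1)[OF assms]])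
  moreover have "(\<Sum>m=-int N..int N. inv_sq_sum (of_int m * z)) =
     of_real pi ^ 2 / 3 + (- 8 * of_real pi ^ 2) * (\<Sum>k<N. qexp z ^ Suc k / (1 - qexp z ^ Suc k)^2)" for N
  proof -
    have "(\<Sum>k=1..N. inv_sq_sum (of_int (int k) * z) + inv_sq_sum (of_int (- int k) * z)) =
       (\<Sum>k<N. 2 * inv_sq_sum (of_int (int (Suc k)) * z))"
      unfolding neg by (rule sum.reindex_bij_witness[of _ Suc "\<lambda>k. k - 1"]) auto
    also have "\<dots> = (- 8 * of_real pi ^ 2) * (\<Sum>k<N. qexp z ^ Suc k / (1 - qexp z ^ Suc k)^2)"
      unfolding inv sum_distrib_left by (intro sum.cong refl) simp
    finally show ?thesis
      by (subst sum_int_symmetric) (simp only: has_sum_inv_sq_sum(2)[of 0, OF disjI1[OF refl]] of_int_0 mult_zero_left)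
  qed
  moreover have "(\<lambda>N. of_real pi ^ 2 / 3 + (- 8 * of_real pi ^ 2) * (\<Sum>k<N. qexp z ^ Suc k / (1 - qexp z ^ Suc k)^2))
      \<longlonglongrightarrow> of_real pi ^ 2 / 3 + (- 8 * of_real pi ^ 2) * ?s"
    using lambert_sigma(1)[OF norm_qexp_less_1[OF assms]]
    by (intro tendsto_intros) (simp add: sums_def)
  ultimately have "G2 z = of_real pi ^ 2 / 3 + (- 8 * of_real pi ^ 2) * ?s"
    using LIMSEQ_unique by auto
  then show ?thesis by (simp add: E2_def qexp_def algebra_simps)
qed

lemma E2_inversion:
  assumes "Im z > 0"
  shows "E2 (- 1 / z) = z^2 * E2 z + 12 * z / (2 * of_real pi * \<i>)"
proof -
  have z: "z \<noteq> 0" using assms by auto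
  have "of_real pi ^ 2 / 3 * E2 z = of_real pi ^ 2 / 3 * E2 (- 1 / z) / z^2 + 2 * of_real pi * \<i> / z"
    using G2_inversion[OF assms] unfolding G2_eq_E2[OF assms] G2_eq_E2[OF Im_inversion_pos[OF assms]] .
  moreover define p where "p = (of_real pi :: complex)"
  moreover have p: "p \<noteq> 0" by (simp add: p_def)
  ultimately have "p ^ 2 / 3 * E2 z = p ^ 2 / 3 * E2 (- 1 / z) / z^2 + 2 * p * \<i> / z" by simp
  then have "(p / 3) * (p * (z^2 * E2 z)) = (p / 3) * (p * E2 (- 1 / z) + 6 * \<i> * z)"
    using z by (simp add: field_simps power2_eq_square)
  then have "p * (z^2 * E2 z) = p * E2 (- 1 / z) + 6 * \<i> * z"
    using p by (subst (asm) mult_cancel_left) auto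
  then have "E2 (- 1 / z) = z^2 * E2 z + 12 * z / (2 * p * \<i>)"
    using p by (simp add: field_simps)
  then show ?thesis by (simp add: p_def)
qed

section \<open>The modular group\<close>

definition mat2 :: "int \<Rightarrow> int \<Rightarrow> int \<Rightarrow> int \<Rightarrow> int^2^2"
  where "mat2 a b c d = vector [vector [a, b], vector [c, d]]"

lemma mat2_nth [simp]:
  "mat2 a b c d $ 1 $ 1 = a" "mat2 a b c d $ 1 $ 2 = b"
  "mat2 a b c d $ 2 $ 1 = c" "mat2 a b c d $ 2 $ 2 = d"
  by (simp_all add: mat2_def)

lemma mat2_eta: "mat2 (A$1$1) (A$1$2) (A$2$1) (A$2$2) = A"
  by (simp add: vec_eq_iff forall_2)

lemma mat2_mult: "mat2 a b c d ** mat2 a' b' c' d' =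
    mat2 (a * a' + b * c') (a * b' + b * d') (c * a' + d * c') (c * b' + d * d')"
  by (simp add: vec_eq_iff forall_2 matrix_matrix_mult_def sum_2)

lemma mat2_in_modular_group: "mat2 a b c d \<in> modular_group \<longleftrightarrow> a * d - b * c = 1"
  by (simp add: modular_group_def det_2)

lemma mat_1_eq_mat2: "mat 1 = mat2 1 0 0 1"
  by (simp add: vec_eq_iff forall_2 mat_def)

lemma T_mat_eq_mat2: "T_mat = mat2 1 1 0 1"
  by (simp add: T_mat_def mat2_def)

definition S_mat :: "int^2^2"
  where "S_mat = mat2 0 (- 1) 1 0"

definition neg_mat :: "int^2^2"
  where "neg_mat = mat2 (- 1) 0 0 (- 1)"

lemma modular_group_mult: "A \<in> modular_group \<Longrightarrow> B \<in> modular_group \<Longrightarrow> A ** B \<in> modular_group"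
  by (simp add: modular_group_def det_mul)

lemma modular_group_generators [simp]:
  "mat 1 \<in> modular_group" "S_mat \<in> modular_group" "T_mat \<in> modular_group" "neg_mat \<in> modular_group"
  by (simp_all add: mat_1_eq_mat2 S_mat_def T_mat_eq_mat2 neg_mat_def mat2_in_modular_group)

lemma generator_relations:
  "S_mat ** S_mat = neg_mat" "neg_mat ** neg_mat = mat 1"
  "(S_mat ** T_mat) ** ((S_mat ** T_mat) ** (S_mat ** T_mat)) = neg_mat"
  by (simp_all add: S_mat_def T_mat_eq_mat2 neg_mat_def mat_1_eq_mat2 mat2_mult)

text \<open>Right multiplication by powers of \<open>T\<close> and by \<open>S\<close> is Euclid's
  algorithm on the bottom row. Only positive words are used, so that an induction has to treat the
  two generators and never their inverses.\<close>

lemma modular_group_induct [consumes 1, case_names one S T]: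
  assumes "A \<in> modular_group" and one: "P (mat 1)"
    and S: "\<And>A. A \<in> modular_group \<Longrightarrow> P A \<Longrightarrow> P (A ** S_mat)"
    and T: "\<And>A. A \<in> modular_group \<Longrightarrow> P A \<Longrightarrow> P (A ** T_mat)"
  shows "P A"
proof -
  define Q where "Q a b c d \<longleftrightarrow> a * d - b * c = 1 \<and> P (mat2 a b c d)" for a b c d
  have QS: "Q b (-a) d (-c)" if "Q a b c d" for a b c d
    using that S[of "mat2 a b c d"]
    by (auto simp: Q_def mat2_in_modular_group S_mat_def mat2_mult algebra_simps)
  have QT: "Q a (b + a) c (d + c)" if "Q a b c d" for a b c d
    using that T[of "mat2 a b c d"]
    by (auto simp: Q_def mat2_in_modular_group T_mat_eq_mat2 mat2_mult algebra_simps)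
  \<comment> \<open>\<open>S\<close> has order four, so its inverse is its cube.\<close>
  have QSi: "Q (-b) a (-d) c" if "Q a b c d" for a b c d
    using QS[OF QS[OF QS[OF that]]] by simp
  text \<open>The inverse of \<open>T\<close> is the positive word \<open>S T S T S\<close> up to the sign \<open>S\<^sup>2\<close>.\<close>
  have QTi: "Q a (b - a) c (d - c)" if "Q a b c d" for a b c d
    using QS[OF QT[OF QS[OF QT[OF QS[OF that]]]]] QS[OF QS] by fastforce
  have QTn: "Q a (b + n * a) c (d + n * c)" if "Q a b c d" for a b c d n
  proof (induction n rule: int_induct[where k = 0])
    case base
    then show ?case using that by simp
  next
    case (step1 i)
    then show ?case using QT[OF step1(2)] by (simp add: algebra_simps)
  next
    case (step2 i)
    then show ?case using QTi[OF step2(2)] by (simp add: algebra_simps)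
  qed
  have Q1: "Q 1 0 0 1" using one by (simp add: Q_def mat_1_eq_mat2)
  have "Q a b c d" if "a * d - b * c = 1" for a b c d
    using that
  proof (induction "nat \<bar>c\<bar>" arbitrary: a b c d rule: less_induct)
    case less
    show ?case
    proof (cases "c = 0")
      case True
      then have "a = 1 \<and> d = 1 \<or> a = -1 \<and> d = -1" using less.prems by (auto simp: zmult_eq_1_iff)
      then show ?thesis
        using QTn[OF Q1, of b] QTn[OF QS[OF QS[OF Q1]], of "-b"] True by auto
    next
      case False
      \<comment> \<open>The bottom row \<open>(c, d)\<close> is replaced by
        \<open>(d mod c, -c)\<close>, whose first entry is smaller in absolute value;
        \<open>QSi\<close> and \<open>QTn\<close> lead back.\<close>
      define n where "n = d div c"
      have d: "d - n * c = d mod c" by (simp add: n_def minus_div_mult_eq_mod)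
      have "nat \<bar>d - n * c\<bar> < nat \<bar>c\<bar>" unfolding d using False abs_mod_less[of c d] by simp
      moreover have "(b - n * a) * (- c) - (- a) * (d - n * c) = 1"
        using less.prems by (simp add: algebra_simps)
      ultimately have "Q (b - n * a) (- a) (d - n * c) (- c)" using less.hyps by blast
      from QSi[OF this] have "Q a (b - n * a) c (d - n * c)" by simp
      from QTn[OF this, of n] show ?thesis by simp
    qed
  qed
  moreover have "A$1$1 * A$2$2 - A$1$2 * A$2$1 = 1"
    using assms(1) by (simp add: modular_group_def det_2)
  ultimately have "Q (A$1$1) (A$1$2) (A$2$1) (A$2$2)" by blast
  then show ?thesis by (simp add: Q_def mat2_eta)
qed

lemma aut_factor_nonzero:
  assumes "A \<in> modular_group" "Im z > 0"
  shows "aut_factor A z \<noteq> 0"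
proof
  assume "aut_factor A z = 0"
  then have "Im (aut_factor A z) = 0" "Re (aut_factor A z) = 0" by auto
  then have "A$2$1 = 0" "A$2$2 = 0" using assms(2) by (auto simp: aut_factor_def)
  then show False using assms(1) by (simp add: modular_group_def det_2)
qed

lemma Im_moebius_act:
  assumes "A \<in> modular_group"
  shows "Im (moebius_act A z) = Im z / norm (aut_factor A z) ^ 2"
proof -
  define a b c d where "a = real_of_int (A$1$1)" "b = real_of_int (A$1$2)"
    "c = real_of_int (A$2$1)" "d = real_of_int (A$2$2)"
  have "A$1$1 * A$2$2 - A$1$2 * A$2$1 = 1" using assms by (simp add: modular_group_def det_2)
  then have "real_of_int (A$1$1 * A$2$2 - A$1$2 * A$2$1) = 1" by simp
  then have "a * d - b * c = 1" by (simp add: a_b_c_d_def)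
  then have "a * Im z * (c * Re z + d) - (a * Re z + b) * (c * Im z) = Im z"
    by (simp add: algebra_simps) (metis distrib_right mult.commute mult.left_commute mult_1 add.commute)
  then show ?thesis
    by (simp add: moebius_act_def aut_factor_def Im_divide cmod_power2 a_b_c_d_def)
qed

lemma moebius_act_upper: "A \<in> modular_group \<Longrightarrow> Im z > 0 \<Longrightarrow> Im (moebius_act A z) > 0"
  using aut_factor_nonzero[of A z] by (simp add: Im_moebius_act)

lemma aut_factor_mult:
  assumes "B \<in> modular_group" "Im z > 0"
  shows "aut_factor (A ** B) z = aut_factor A (moebius_act B z) * aut_factor B z"
  using aut_factor_nonzero[OF assms]
  by (simp add: aut_factor_def[of A] aut_factor_def[of "A ** B"] moebius_act_def
      matrix_matrix_mult_def sum_2 distrib_right)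
     (simp add: aut_factor_def algebra_simps)

lemma moebius_act_mult:
  assumes "A \<in> modular_group" "B \<in> modular_group" "Im z > 0"
  shows "moebius_act (A ** B) z = moebius_act A (moebius_act B z)"
proof -
  let ?w = "moebius_act B z"
  have nz: "aut_factor B z \<noteq> 0" "aut_factor A ?w \<noteq> 0"
    using assms aut_factor_nonzero moebius_act_upper by blast+
  have "of_int ((A ** B)$1$1) * z + of_int ((A ** B)$1$2) =
      (of_int (A$1$1) * ?w + of_int (A$1$2)) * aut_factor B z"
    using nz(1) by (simp add: moebius_act_def matrix_matrix_mult_def sum_2 distrib_right)
      (simp add: aut_factor_def algebra_simps)
  then show ?thesis
    using nz by (simp add: moebius_act_def[of "A ** B"] moebius_act_def[of A] aut_factor_mult[OF assms(2,3)])
qed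

lemma generators_act:
  "moebius_act (mat 1) z = z" "aut_factor (mat 1) z = 1"
  "moebius_act T_mat z = z + 1" "aut_factor T_mat z = 1"
  "moebius_act S_mat z = - 1 / z" "aut_factor S_mat z = z"
  "moebius_act neg_mat z = z" "aut_factor neg_mat z = - 1"
  by (simp_all add: moebius_act_def aut_factor_def mat_1_eq_mat2 T_mat_eq_mat2 S_mat_def neg_mat_def)

text \<open>If the imaginary part is less than \<open>1/2\<close>, a translation followed by the inversion doubles
  it.\<close>

lemma exists_moebius_act_Im_ge:
  assumes "Im z > 0"
  shows "\<exists>A\<in>modular_group. Im (moebius_act A z) \<ge> 1 / 2"
proof -
  have *: "\<exists>A\<in>modular_group. Im (moebius_act A z) \<ge> 1 / 2" if "Im z > 0" "Im z * 2 ^ n \<ge> 1 / 2" for n z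
    using that
  proof (induction n arbitrary: z)
    case 0
    then show ?case by (intro bexI[of _ "mat 1"]) (auto simp: generators_act)
  next
    case (Suc n)
    show ?case
    proof (cases "Im z \<ge> 1 / 2")
      case True
      then show ?thesis by (intro bexI[of _ "mat 1"]) (auto simp: generators_act)
    next
      case False
      define m where "m = round (Re z)"
      define B where "B = S_mat ** mat2 1 (-m) 0 1"
      have B: "B \<in> modular_group"
        unfolding B_def by (intro modular_group_mult) (auto simp: mat2_in_modular_group)
      have aB: "aut_factor B z = z - of_int m"
        by (simp add: B_def S_mat_def mat2_mult aut_factor_def)
      have "\<bar>Re z - of_int m\<bar> \<le> 1 / 2" using of_int_round_abs_le[of "Re z"] by (simp add: m_def abs_minus_commute)
      then have "\<bar>Re z - of_int m\<bar>^2 \<le> (1/2)^2" by (rule power_mono) auto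
      then have "(Re z - of_int m)^2 \<le> (1/2)^2" by simp
      moreover have "(Im z)^2 \<le> (1/2)^2" using False Suc.prems by (intro power_mono) auto
      ultimately have n2: "norm (aut_factor B z)^2 \<le> 1 / 2"
        by (simp add: aB cmod_power2 power_divide)
      have n0: "norm (aut_factor B z)^2 > 0" using aut_factor_nonzero[OF B Suc.prems(1)] by simp
      have "Im z * 2 \<le> Im z / norm (aut_factor B z)^2"
        using n2 n0 Suc.prems(1) by (simp add: field_simps)
      then have I: "Im z * 2 \<le> Im (moebius_act B z)" by (simp add: Im_moebius_act[OF B])
      then have "Im z * 2 * 2 ^ n \<le> Im (moebius_act B z) * 2 ^ n" by (rule mult_right_mono) auto
      moreover have "Im z * 2 * 2 ^ n = Im z * 2 ^ Suc n" by simp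
      ultimately have "1 / 2 \<le> Im (moebius_act B z) * 2 ^ n" using Suc.prems(2) by linarith
      from Suc.IH[OF moebius_act_upper[OF B Suc.prems(1)] this] obtain A where
        A: "A \<in> modular_group" "Im (moebius_act A (moebius_act B z)) \<ge> 1 / 2" by blast
      then show ?thesis
        using moebius_act_mult[OF A(1) B Suc.prems(1)] modular_group_mult[OF A(1) B]
        by (intro bexI[of _ "A ** B"]) auto
    qed
  qed
  obtain n where "1 / (2 * Im z) < 2 ^ n" using real_arch_pow[of 2 "1 / (2 * Im z)"] by auto
  then show ?thesis using assms by (intro *[of z n]) (auto simp: field_simps)
qed

section \<open>Holomorphic functions on the upper half-plane\<close>

lemma mem_upper_half_plane [simp]: "z \<in> upper_half_plane \<longleftrightarrow> Im z > 0"
  by (simp add: upper_half_plane_def)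

lemma open_upper_half_plane [simp]: "open upper_half_plane"
  unfolding upper_half_plane_def by (rule open_halfspace_Im_gt)

lemma convex_upper_half_plane [simp]: "convex upper_half_plane"
  unfolding upper_half_plane_def by (rule convex_halfspace_Im_gt)

lemma holomorphic_upper_half_planeI:
  assumes "\<And>z. Im z > 0 \<Longrightarrow> (f has_field_derivative f' z) (at z)"
  shows "f holomorphic_on upper_half_plane"
  using assms mem_upper_half_plane holomorphic_on_open[OF open_upper_half_plane] by blast

lemma holomorphic_upper_half_planeD:
  assumes "f holomorphic_on upper_half_plane" "Im z > 0"
  shows "(f has_field_derivative deriv f z) (at z)"
  using assms holomorphic_derivI[OF assms(1) open_upper_half_plane, of z UNIV] by simp

lemma holomorphic_upper_half_plane_cong:
  assumes "\<And>z. Im z > 0 \<Longrightarrow> f z = g z"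
  shows "f holomorphic_on upper_half_plane \<longleftrightarrow> g holomorphic_on upper_half_plane"
  by (rule holomorphic_cong) (use assms in auto)

lemma deriv_upper_half_plane_cong:
  assumes "\<And>z. Im z > 0 \<Longrightarrow> f z = g z" "Im z > 0"
  shows "deriv f z = deriv g z"
proof (rule deriv_cong_ev)
  have "eventually (\<lambda>w. w \<in> upper_half_plane) (nhds z)"
    using assms(2) by (intro eventually_nhds_in_open) auto
  then show "\<forall>\<^sub>F w in nhds z. f w = g w" by eventually_elim (use assms(1) in auto)
qed auto

section \<open>Power series in q\<close>

definition disc_fps :: "complex fps \<Rightarrow> bool"
  where "disc_fps A \<longleftrightarrow> fps_conv_radius A \<ge> 1"

lemma disc_fps_intros [simp, intro]:
  "disc_fps (fps_const c)" "disc_fps fps_X" "disc_fps 0" "disc_fps 1" "disc_fps (numeral n)"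
  "disc_fps A \<Longrightarrow> disc_fps B \<Longrightarrow> disc_fps (A + B)"
  "disc_fps A \<Longrightarrow> disc_fps B \<Longrightarrow> disc_fps (A - B)"
  "disc_fps A \<Longrightarrow> disc_fps B \<Longrightarrow> disc_fps (A * B)"
  "disc_fps A \<Longrightarrow> disc_fps (- A)"
  "disc_fps A \<Longrightarrow> disc_fps (A ^ k)"
  "disc_fps A \<Longrightarrow> disc_fps (fps_deriv A)"
  using fps_conv_radius_add[of A B] fps_conv_radius_diff[of A B] fps_conv_radius_mult[of A B]
    fps_conv_radius_power[of A k] fps_conv_radius_deriv[of A]
  by (auto simp: disc_fps_def min_le_iff_disj dest: order_trans)

lemma disc_fps_norm:
  assumes "disc_fps A" "norm q < 1"
  shows "ereal (norm q) < fps_conv_radius A"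
proof -
  have "ereal (norm q) < 1" using assms(2) by (simp add: one_ereal_def)
  then show ?thesis using assms(1) unfolding disc_fps_def by (rule less_le_trans)
qed

lemma disc_fpsI:
  assumes "\<And>r. 0 < r \<Longrightarrow> r < 1 \<Longrightarrow> summable (\<lambda>n. fps_nth A n * of_real r ^ n)"
  shows "disc_fps A"
  unfolding disc_fps_def fps_conv_radius_def
  by (rule conv_radius_geI_ex') (use assms in \<open>auto simp: one_ereal_def\<close>)

definition qfun :: "complex fps \<Rightarrow> complex \<Rightarrow> complex"
  where "qfun A z = eval_fps A (qexp z)"

lemma qfun_sums:
  assumes "disc_fps A" "Im z > 0"
  shows "(\<lambda>n. fps_nth A n * qexp z ^ n) sums qfun A z"
  unfolding qfun_def using assms disc_fps_norm norm_qexp_less_1 by (intro sums_eval_fps) auto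

lemma qfun_simps [simp]:
  "qfun (fps_const c) z = c" "qfun fps_X z = qexp z" "qfun 0 z = 0" "qfun 1 z = 1"
  "qfun (numeral n) z = numeral n"
  by (simp_all add: qfun_def)

lemma qfun_arith:
  assumes "Im z > 0" "disc_fps A" "disc_fps B"
  shows "qfun (A + B) z = qfun A z + qfun B z" "qfun (A - B) z = qfun A z - qfun B z"
    "qfun (A * B) z = qfun A z * qfun B z"
  using disc_fps_norm[OF assms(2) norm_qexp_less_1[OF assms(1)]]
    disc_fps_norm[OF assms(3) norm_qexp_less_1[OF assms(1)]]
  by (simp_all add: qfun_def eval_fps_add eval_fps_diff eval_fps_mult)

lemma qfun_power:
  assumes "Im z > 0" "disc_fps A"
  shows "qfun (A ^ n) z = qfun A z ^ n"
  by (induction n) (use assms in \<open>auto simp: qfun_arith\<close>)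

lemma qexp_deriv: "(qexp has_field_derivative 2 * of_real pi * \<i> * qexp z) (at z)"
  unfolding qexp_def by (auto intro!: derivative_eq_intros)

lemma qfun_deriv:
  assumes "Im z > 0" "disc_fps A"
  shows "(qfun A has_field_derivative 2 * of_real pi * \<i> * qfun (fps_X * fps_deriv A) z) (at z)"
proof -
  have "((\<lambda>z. eval_fps A (qexp z)) has_field_derivative
      eval_fps (fps_deriv A) (qexp z) * (2 * of_real pi * \<i> * qexp z)) (at z)"
    using assms disc_fps_norm norm_qexp_less_1
    by (intro DERIV_chain2[OF has_field_derivative_eval_fps qexp_deriv]) auto
  then show ?thesis
    using assms by (simp add: qfun_arith mult_ac) (simp add: qfun_def[abs_def] mult_ac)
qed

lemma qexp_plus_1: "qexp (z + 1) = qexp z"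
  using exp_plus_2pin[of "2 * of_real pi * \<i> * z" 1] by (simp add: qexp_def algebra_simps)

lemma qfun_plus_1: "qfun A (z + 1) = qfun A z"
  by (simp add: qfun_def qexp_plus_1)

text \<open>The region \<open>Im z \<ge> Y\<close> corresponds to a closed disc inside the unit
  disc, with the cusp as its centre \<open>q = 0\<close>; a holomorphic function is bounded on it by
  compactness.\<close>

lemma cusp_bounded:
  assumes g: "g holomorphic_on ball 0 1" and eq: "\<And>z. Im z > 0 \<Longrightarrow> f z = g (qexp z)" and Y: "Y > 0"
  shows "\<exists>B. \<forall>z. Im z \<ge> Y \<longrightarrow> norm (f z) \<le> B"
proof -
  let ?r = "exp (- (2 * pi * Y))"
  have "cball (0::complex) ?r \<subseteq> ball 0 1"
    using Y by (simp add: cball_subset_ball_iff)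
  then have "continuous_on (cball 0 ?r) g"
    using continuous_on_subset[OF holomorphic_on_imp_continuous_on[OF g]] by blast
  then have "bounded (g ` cball 0 ?r)"
    by (intro compact_imp_bounded compact_continuous_image) auto
  then obtain B where B: "\<forall>x\<in>cball 0 ?r. norm (g x) \<le> B"
    unfolding bounded_iff by blast
  have "norm (f z) \<le> B" if "Im z \<ge> Y" for z
    using that Y B[rule_format, of "qexp z"] eq[of z] by (simp add: norm_qexp)
  then show ?thesis by blast
qed

lemma qfun_bounded:
  assumes "disc_fps A" "Y > 0"
  shows "\<exists>B. \<forall>z. Im z \<ge> Y \<longrightarrow> norm (qfun A z) \<le> B"
proof (rule cusp_bounded)
  show "eval_fps A holomorphic_on ball 0 1"
    by (rule holomorphic_on_eval_fps) (use disc_fps_norm[OF assms(1)] in \<open>auto simp: in_eball_iff\<close>)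
qed (simp_all add: qfun_def assms(2))

lemma qfun_bounded_below:
  assumes "disc_fps A" "fps_nth A 0 \<noteq> 0"
  shows "\<exists>Y c. Y > 0 \<and> c > 0 \<and> (\<forall>z. Im z > Y \<longrightarrow> norm (qfun A z) \<ge> c)"
proof -
  have "continuous (at 0) (eval_fps A)"
    using disc_fps_norm[OF assms(1), of 0] by (intro continuous_eval_fps continuous_ident) auto
  then have lim: "(eval_fps A \<longlongrightarrow> fps_nth A 0) (at 0)"
    by (simp add: continuous_at eval_fps_at_0)
  define c where "c = norm (fps_nth A 0) / 2"
  have c: "c > 0" using assms(2) by (simp add: c_def)
  from tendstoD[OF lim c] obtain d where d: "d > 0" "\<And>x. x \<noteq> 0 \<Longrightarrow> norm x < d \<Longrightarrow> dist (eval_fps A x) (fps_nth A 0) < c"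
    by (auto simp: eventually_at dist_norm)
  define Y where "Y = max 1 (- ln d / (2 * pi))"
  have "norm (qfun A z) \<ge> c" if "Im z > Y" for z
  proof -
    have "- ln d / (2 * pi) < Im z" using that by (simp add: Y_def)
    then have "- (2 * pi * Im z) < ln d" by (simp add: field_simps)
    then have "exp (- (2 * pi * Im z)) < exp (ln d)" by (simp only: exp_less_cancel_iff)
    then have "norm (qexp z) < d" using d(1) by (simp add: norm_qexp)
    then have "dist (qfun A z) (fps_nth A 0) < c" unfolding qfun_def by (intro d(2)) auto
    then have "norm (fps_nth A 0) < norm (qfun A z) + c"
      using norm_triangle_ineq2[of "fps_nth A 0" "qfun A z"] by (simp add: dist_norm norm_minus_commute)
    then show ?thesis by (simp add: c_def)
  qed
  then show ?thesis using c by (intro exI[of _ Y] exI[of _ c]) (auto simp: Y_def)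
qed

section \<open>Modular derivative and Eisenstein series\<close>

definition E2_fps :: "complex fps"
  where "E2_fps = Abs_fps (\<lambda>n. if n = 0 then 1 else - 24 * of_nat (\<Sum>d | d dvd n. d))"

lemma E2_fps_Suc: "fps_nth E2_fps (Suc n) = - 24 * of_nat (\<Sum>d | d dvd Suc n. d)"
  by (simp only: E2_fps_def fps_nth_Abs_fps nat.simps if_False)

lemma disc_E2_fps [simp]: "disc_fps E2_fps"
proof (rule disc_fpsI)
  fix r :: real assume r: "0 < r" "r < 1"
  have "summable (\<lambda>n. of_nat (\<Sum>d | d dvd Suc n. d) * complex_of_real r ^ Suc n)"
    by (rule lambert_sigma) (use r in auto)
  then have "summable (\<lambda>n. - 24 * (of_nat (\<Sum>d | d dvd Suc n. d) * complex_of_real r ^ Suc n))"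
    by (rule summable_mult)
  then have "summable (\<lambda>n. fps_nth E2_fps (Suc n) * of_real r ^ Suc n)"
    by (simp only: E2_fps_Suc mult.assoc)
  then show "summable (\<lambda>n. fps_nth E2_fps n * of_real r ^ n)"
    by (subst (asm) summable_Suc_iff)
qed

lemma E2_eq_qfun:
  assumes "Im z > 0"
  shows "E2 z = qfun E2_fps z"
proof -
  have "(\<lambda>n. of_nat (\<Sum>d | d dvd Suc n. d) * qexp z ^ Suc n) sums
      (\<Sum>n. of_nat (\<Sum>d | d dvd Suc n. d) * qexp z ^ Suc n)"
    by (rule summable_sums, rule lambert_sigma(2), rule norm_qexp_less_1[OF assms])
  from sums_mult[OF this, of "- 24"]
  have "(\<lambda>n. fps_nth E2_fps (Suc n) * qexp z ^ Suc n) sums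
      (- 24 * (\<Sum>n. of_nat (\<Sum>d | d dvd Suc n. d) * qexp z ^ Suc n))"
    by (simp only: E2_fps_Suc mult.assoc)
  moreover have "(\<lambda>n. fps_nth E2_fps (Suc n) * qexp z ^ Suc n) sums (qfun E2_fps z - fps_nth E2_fps 0 * qexp z ^ 0)"
    using qfun_sums[OF disc_E2_fps assms] by (subst sums_Suc_iff) simp
  ultimately have "qfun E2_fps z - fps_nth E2_fps 0 * qexp z ^ 0 = - 24 * (\<Sum>n. of_nat (\<Sum>d | d dvd Suc n. d) * qexp z ^ Suc n)"
    using sums_unique2 by blast
  then show ?thesis by (simp add: E2_def E2_fps_def qexp_def algebra_simps)
qed

lemma E2_holomorphic: "E2 holomorphic_on upper_half_plane"
proof -
  have "qfun E2_fps holomorphic_on upper_half_plane"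
    by (rule holomorphic_upper_half_planeI[OF qfun_deriv]) auto
  then show ?thesis using holomorphic_upper_half_plane_cong[OF E2_eq_qfun] by simp
qed

section \<open>Series in q with a real leading exponent\<close>

definition qpow :: "real \<Rightarrow> complex \<Rightarrow> complex"
  where "qpow l z = exp (2 * of_real pi * \<i> * of_real l * z)"

lemma norm_qpow: "norm (qpow l z) = exp (- (2 * pi * l * Im z))"
  by (simp add: qpow_def)

lemma qpow_nonzero [simp]: "qpow l z \<noteq> 0"
  by (simp add: qpow_def)

lemma qpow_0 [simp]: "qpow 0 z = 1"
  by (simp add: qpow_def)

lemma qpow_add: "qpow (a + b) z = qpow a z * qpow b z"
  by (simp add: qpow_def exp_add [symmetric] algebra_simps)

lemma qpow_plus_1: "qpow l (z + 1) = exp (2 * of_real pi * \<i> * of_real l) * qpow l z"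
  by (simp add: qpow_def exp_add [symmetric] algebra_simps)

lemma qpow_deriv: "(qpow l has_field_derivative 2 * of_real pi * \<i> * of_real l * qpow l z) (at z)"
  unfolding qpow_def by (auto intro!: derivative_eq_intros)

definition qform :: "real \<Rightarrow> complex fps \<Rightarrow> complex \<Rightarrow> complex"
  where "qform l A z = (if Im z > 0 then qpow l z * qfun A z else 0)"

lemma qform_deriv:
  assumes "Im z > 0" "disc_fps A"
  shows "(qform l A has_field_derivative
    2 * of_real pi * \<i> * qform l (fps_X * fps_deriv A + fps_const (of_real l) * A) z) (at z)"
proof -
  have "((\<lambda>z. qpow l z * qfun A z) has_field_derivative
     (2 * of_real pi * \<i> * of_real l * qpow l z * qfun A z + (2 * of_real pi * \<i> * qfun (fps_X * fps_deriv A) z) * qpow l z)) (at z)"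
    by (rule DERIV_mult[OF qpow_deriv qfun_deriv[OF assms]])
  then have "((\<lambda>z. qpow l z * qfun A z) has_field_derivative
     2 * of_real pi * \<i> * qform l (fps_X * fps_deriv A + fps_const (of_real l) * A) z) (at z)"
    using assms by (simp add: qform_def qfun_arith algebra_simps)
  then show ?thesis
    by (rule has_field_derivative_transform_within_open[OF _ open_upper_half_plane])
       (use assms in \<open>auto simp: qform_def\<close>)
qed

lemma qform_holomorphic: "disc_fps A \<Longrightarrow> qform l A holomorphic_on upper_half_plane"
  by (rule holomorphic_upper_half_planeI[OF qform_deriv])

text \<open>The modular derivative transported from \<open>q^l A\<close> to the series
  \<open>A\<close>, so that differential equations become identities of formal power series.\<close>

definition fps_mod_deriv :: "real \<Rightarrow> real \<Rightarrow> complex fps \<Rightarrow> complex fps"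
  where "fps_mod_deriv l k A =
    fps_X * fps_deriv A + fps_const (of_real l) * A - fps_const (of_real (k / 12)) * E2_fps * A"

lemma disc_fps_mod_deriv [simp, intro]: "disc_fps A \<Longrightarrow> disc_fps (fps_mod_deriv l k A)"
  unfolding fps_mod_deriv_def by (intro disc_fps_intros) auto

text \<open>\<open>E2\<close> has constant term 1; the factor \<open>l - k / 12\<close> is what each
  derivative contributes to the indicial polynomial.\<close>

lemma fps_mod_deriv_nth_0: "fps_nth (fps_mod_deriv l k A) 0 = of_real (l - k / 12) * fps_nth A 0"
  by (simp add: fps_mod_deriv_def E2_fps_def algebra_simps)

lemma mod_deriv_qform:
  assumes "disc_fps A"
  shows "mod_deriv k (qform l A) = qform l (fps_mod_deriv l k A)"
proof
  fix z
  show "mod_deriv k (qform l A) z = qform l (fps_mod_deriv l k A) z"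
  proof (cases "Im z > 0")
    case True
    have "deriv (qform l A) z = 2 * of_real pi * \<i> * qform l (fps_X * fps_deriv A + fps_const (of_real l) * A) z"
      by (rule DERIV_imp_deriv[OF qform_deriv[OF True assms]])
    then show ?thesis
      using True assms by (simp add: mod_deriv_def E2_eq_qfun qform_def fps_mod_deriv_def qfun_arith)
        (simp add: algebra_simps)
  qed (simp add: mod_deriv_def qform_def)
qed

lemma mod_deriv_off [simp]: "\<not> Im z > 0 \<Longrightarrow> mod_deriv k f z = 0"
  by (simp add: mod_deriv_def)

lemma mod_deriv_cong:
  assumes "\<And>z. Im z > 0 \<Longrightarrow> f z = g z"
  shows "mod_deriv k f = mod_deriv k g"
  using deriv_upper_half_plane_cong[OF assms] assms by (auto simp: mod_deriv_def fun_eq_iff)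

lemma mod_deriv_holomorphic [intro]:
  assumes "f holomorphic_on upper_half_plane"
  shows "mod_deriv k f holomorphic_on upper_half_plane"
proof -
  have "(\<lambda>z. deriv f z / (2 * of_real pi * \<i>) - of_real (k / 12) * E2 z * f z) holomorphic_on upper_half_plane"
    by (intro holomorphic_intros holomorphic_deriv E2_holomorphic assms) auto
  then show ?thesis
    by (rule holomorphic_transform) (simp add: mod_deriv_def)
qed

lemma mod_deriv_unique:
  assumes "(f has_field_derivative f') (at z)" "Im z > 0"
  shows "mod_deriv k f z = f' / (2 * of_real pi * \<i>) - of_real (k / 12) * E2 z * f z"
  using assms by (simp add: mod_deriv_def DERIV_imp_deriv)

lemma mod_deriv_linear:
  assumes "finite I" "\<And>i. i \<in> I \<Longrightarrow> f i holomorphic_on upper_half_plane"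
  shows "mod_deriv k (\<lambda>z. \<Sum>i\<in>I. c i * f i z) = (\<lambda>z. \<Sum>i\<in>I. c i * mod_deriv k (f i) z)"
proof
  fix z
  show "mod_deriv k (\<lambda>z. \<Sum>i\<in>I. c i * f i z) z = (\<Sum>i\<in>I. c i * mod_deriv k (f i) z)"
  proof (cases "Im z > 0")
    case True
    have "((\<lambda>z. \<Sum>i\<in>I. c i * f i z) has_field_derivative (\<Sum>i\<in>I. c i * deriv (f i) z)) (at z)"
      by (intro DERIV_sum DERIV_cmult holomorphic_upper_half_planeD assms True)
    from mod_deriv_unique[OF this True]
    show ?thesis using True
      by (simp add: mod_deriv_def sum_subtractf sum_divide_distrib sum_distrib_left algebra_simps)
  qed simp
qed

lemma upper_not_nonpos_Reals: "Im z > 0 \<Longrightarrow> z \<notin> \<real>\<^sub>\<le>\<^sub>0"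
  by (auto simp: complex_nonpos_Reals_iff)

lemma inversion_deriv: "z \<noteq> 0 \<Longrightarrow> ((\<lambda>z. - 1 / z) has_field_derivative 1 / z^2) (at z)"
  by (auto intro!: derivative_eq_intros simp: power2_eq_square)

lemma powr_minus_1:
  assumes "z \<noteq> (0::complex)"
  shows "z powr (s - 1) = z powr s / z" "z powr (s - 2) = z powr s / z^2" 
  using assms by (simp_all add: powr_diff)

text \<open>The inhomogeneous term of \<open>E2\<close> under inversion cancels the derivative of the automorphy
  factor.\<close>

lemma mod_deriv_inversion:
  assumes "f holomorphic_on upper_half_plane" "Im z > 0"
  shows "mod_deriv k (\<lambda>z. z powr of_real (- k) * f (- 1 / z)) z =
    z powr of_real (- (k + 2)) * mod_deriv k f (- 1 / z)"
proof -
  have z: "z \<noteq> 0" using assms(2) by auto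
  let ?p = "z powr of_real (- k)" and ?v = "- 1 / z"
  have "((\<lambda>z. f (- 1 / z)) has_field_derivative deriv f ?v * (1 / z^2)) (at z)"
    by (intro DERIV_chain2[where f = f] holomorphic_upper_half_planeD assms inversion_deriv z
        Im_inversion_pos)
  from DERIV_mult[OF has_field_derivative_powr[OF upper_not_nonpos_Reals[OF assms(2)], of "of_real (- k)"] this]
  have d: "((\<lambda>z. z powr of_real (- k) * f (- 1 / z)) has_field_derivative
      (of_real (- k) * (?p / z) * f ?v + deriv f ?v * (1 / z^2) * ?p)) (at z)"
    using z by (simp add: powr_minus_1)
  have s: "of_real (- (k + 2)) = (of_real (- k) - 2 :: complex)" by simp
  have p: "z powr of_real (- (k + 2)) = ?p / z^2" unfolding s using z by (rule powr_minus_1(2))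
  define c where "c = 2 * of_real pi * \<i>"
  have c: "c \<noteq> 0" by (simp add: c_def)
  have m: "mod_deriv k f ?v = deriv f ?v / c - of_real (k / 12) * (z^2 * E2 z + 12 * z / c) * f ?v"
    using Im_inversion_pos[OF assms(2)] E2_inversion[OF assms(2)] by (simp add: mod_deriv_def c_def)
  have alg: "(- k * (P / z) * F + d * (1 / z^2) * P) / c - k / 12 * e * (P * F) =
      P / z^2 * (d / c - k / 12 * (z^2 * e + 12 * z / c) * F)" for k P F d e :: complex
    using z c by (simp add: field_simps power2_eq_square)
  show ?thesis
    unfolding mod_deriv_unique[OF d assms(2), folded c_def] p m
    by (simp only: of_real_minus of_real_divide of_real_numeral alg)
qed

lemma mod_deriv_inversion_invariant:
  assumes "f holomorphic_on upper_half_plane" "Im z > 0"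
    and inv: "\<And>z. Im z > 0 \<Longrightarrow> f (- 1 / z) = z ^ n * f z"
  shows "mod_deriv (real n) f (- 1 / z) = z ^ (n + 2) * mod_deriv (real n) f z"
proof -
  have pw: "z powr of_real (- real m) = inverse (z ^ m)" if "Im z > 0" for z m
  proof -
    have "z \<noteq> 0" using that by auto
    then show ?thesis by (simp add: powr_minus powr_nat')
  qed
  have "f w = w powr of_real (- real n) * f (- 1 / w)" if "Im w > 0" for w
  proof -
    have "w \<noteq> 0" using that by auto
    then show ?thesis using inv[OF that] pw[OF that, of n] by (simp add: field_simps)
  qed
  from mod_deriv_cong[of f, OF this]
  have "mod_deriv (real n) f z = z powr of_real (- (real n + 2)) * mod_deriv (real n) f (- 1 / z)"
    using mod_deriv_inversion[OF assms(1,2), of "real n"] by simp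
  also have "- (real n + 2) = - real (n + 2)" by simp
  finally show ?thesis
    unfolding pw[OF assms(2)] using assms(2) by (auto simp: field_simps)
qed

text \<open>Invariance under \<open>T\<close> is automatic for a series with exponent 0, and
  \<open>S\<close> and \<open>T\<close> generate the group, so the inversion law is all that has to
  be checked.\<close>

lemma modular_formsI:
  assumes "disc_fps A" and inv: "\<And>z. Im z > 0 \<Longrightarrow> qform 0 A (- 1 / z) = z ^ k * qform 0 A z"
  shows "qform 0 A \<in> modular_forms k"
proof -
  let ?f = "qform 0 A"
  have step: "?f (moebius_act (B ** C) z) = aut_factor (B ** C) z ^ k * ?f z"
    if B: "B \<in> modular_group" "\<And>z. Im z > 0 \<Longrightarrow> ?f (moebius_act B z) = aut_factor B z ^ k * ?f z"
      and C: "C \<in> modular_group" "?f (moebius_act C z) = aut_factor C z ^ k * ?f z" and z: "Im z > 0" for B C z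
    using B(2)[OF moebius_act_upper[OF C(1) z]] C(2)
    by (simp add: moebius_act_mult[OF B(1) C(1) z] aut_factor_mult[OF C(1) z] power_mult_distrib)
  have "?f (moebius_act B z) = aut_factor B z ^ k * ?f z" if "B \<in> modular_group" "Im z > 0" for B z
    using that
  proof (induction arbitrary: z rule: modular_group_induct)
    case one
    then show ?case by (simp add: generators_act)
  next
    case (S B)
    show ?case by (rule step) (use S inv[OF S(3)] in \<open>auto simp: generators_act\<close>)
  next
    case (T B)
    show ?case by (rule step) (use T in \<open>auto simp: generators_act qform_def qfun_plus_1\<close>)
  qed
  moreover obtain C where "\<forall>z. Im z \<ge> 1 \<longrightarrow> norm (qfun A z) \<le> C" using qfun_bounded[OF assms(1), of 1] by auto
  then have "\<exists>Y C. \<forall>z. Im z > Y \<longrightarrow> norm (?f z) \<le> C"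
    by (intro exI[of _ 1] exI[of _ C]) (auto simp: qform_def)
  ultimately show ?thesis
    using qform_holomorphic[OF assms(1)] by (auto simp: modular_forms_def qform_def)
qed

text \<open>Ramanujan's identities \<open>q dE2/dq = (E2\<^sup>2 - E4) / 12\<close> and \<open>D E4 = - E6 / 3\<close> are used as
  definitions.\<close>

definition E4_fps :: "complex fps"
  where "E4_fps = E2_fps^2 - 12 * (fps_X * fps_deriv E2_fps)"

definition E6_fps :: "complex fps"
  where "E6_fps = fps_const (- 3) * fps_mod_deriv 0 4 E4_fps"

lemma disc_E4_E6 [simp]: "disc_fps E4_fps" "disc_fps E6_fps"
  unfolding E4_fps_def E6_fps_def by (intro disc_fps_intros disc_E2_fps disc_fps_mod_deriv)+

lemma E4_E6_nth_0: "fps_nth E4_fps 0 = 1" "fps_nth E6_fps 0 = 1"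
proof -
  have "fps_nth E2_fps 0 = 1" by (simp add: E2_fps_def)
  then show "fps_nth E4_fps 0 = 1" by (simp add: E4_fps_def power2_eq_square)
  then show "fps_nth E6_fps 0 = 1" by (simp add: E6_fps_def fps_mod_deriv_nth_0)
qed

definition E4 :: "complex \<Rightarrow> complex" where "E4 = qform 0 E4_fps"
definition E6 :: "complex \<Rightarrow> complex" where "E6 = qform 0 E6_fps"

lemma E4_eq: "Im z > 0 \<Longrightarrow> E4 z = E2 z ^ 2 - 12 * (deriv E2 z / (2 * of_real pi * \<i>))"
proof -
  assume z: "Im z > 0"
  have "deriv E2 z = deriv (qfun E2_fps) z"
    by (rule deriv_upper_half_plane_cong[OF E2_eq_qfun z])
  also have "\<dots> = 2 * of_real pi * \<i> * qfun (fps_X * fps_deriv E2_fps) z"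
    by (rule DERIV_imp_deriv[OF qfun_deriv[OF z disc_E2_fps]])
  finally show ?thesis
    using z by (simp add: E4_def qform_def E4_fps_def qfun_arith qfun_power E2_eq_qfun)
qed

text \<open>Squaring the inversion law of \<open>E2\<close> and differentiating it produce the same
  inhomogeneous terms, up to the factor 12 in the definition of \<open>E4\<close>.\<close>

lemma E4_inversion:
  assumes z: "Im z > 0"
  shows "E4 (- 1 / z) = z ^ 4 * E4 z"
proof -
  define c where "c = 2 * of_real pi * \<i>"
  have c: "c \<noteq> 0" by (simp add: c_def)
  have z0: "z \<noteq> 0" using z by auto
  have "((\<lambda>z. E2 (- 1 / z)) has_field_derivative deriv E2 (- 1 / z) * (1 / z^2)) (at z)"
    by (intro DERIV_chain2[where f = E2] holomorphic_upper_half_planeD E2_holomorphic inversion_deriv z0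
        Im_inversion_pos z)
  then have 1: "((\<lambda>z. z^2 * E2 z + 12 * z / c) has_field_derivative deriv E2 (- 1 / z) * (1 / z^2)) (at z)"
    by (rule has_field_derivative_transform_within_open[OF _ open_upper_half_plane])
       (use z E2_inversion in \<open>auto simp: c_def\<close>)
  have "((\<lambda>z. z^2 * E2 z + 12 * z / c) has_field_derivative (2 * z * E2 z + z^2 * deriv E2 z + 12 / c)) (at z)"
    using c holomorphic_upper_half_planeD[OF E2_holomorphic z] by (auto intro!: derivative_eq_intros)
  from DERIV_unique[OF 1 this]
  have d: "deriv E2 (- 1 / z) = z^2 * (2 * z * E2 z + z^2 * deriv E2 z + 12 / c)"
    using z0 by (simp add: field_simps)
  show ?thesis
    unfolding E4_eq[OF z] E4_eq[OF Im_inversion_pos[OF z]] E2_inversion[OF z] d c_def[symmetric]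
    using c by (simp add: field_simps power2_eq_square power4_eq_xxxx)
qed

lemma E4_modular: "E4 \<in> modular_forms 4"
  unfolding E4_def by (rule modular_formsI) (use E4_inversion in \<open>auto simp: E4_def\<close>)

lemma E6_eq: "E6 = (\<lambda>z. - 3 * mod_deriv 4 E4 z)"
  unfolding E4_def mod_deriv_qform[OF disc_E4_E6(1)]
  by (auto simp: E6_def E6_fps_def qform_def qfun_arith)

lemma E4_holomorphic: "E4 holomorphic_on upper_half_plane"
  unfolding E4_def by (rule qform_holomorphic) simp

lemma E6_inversion:
  assumes "Im z > 0"
  shows "E6 (- 1 / z) = z ^ 6 * E6 z"
  using mod_deriv_inversion_invariant[OF E4_holomorphic assms, of 4] E4_inversion by (simp add: E6_eq)

lemma E6_modular: "E6 \<in> modular_forms 6"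
  unfolding E6_def by (rule modular_formsI) (use E6_inversion in \<open>auto simp: E6_def\<close>)

section \<open>Frobenius solutions\<close>

text \<open>\<open>I n\<close> is the indicial polynomial at the exponent plus \<open>n\<close>, and
  \<open>c n j\<close> the factor with which coefficient \<open>j\<close> enters equation
  \<open>n\<close>; the leading coefficient is normalised to 1.\<close>

fun frobenius_coeff :: "(nat \<Rightarrow> nat \<Rightarrow> complex) \<Rightarrow> (nat \<Rightarrow> complex) \<Rightarrow> nat \<Rightarrow> complex"
  where "frobenius_coeff c I n =
    (if n = 0 then 1 else - (\<Sum>j<n. c n j * frobenius_coeff c I j) / I n)"

declare frobenius_coeff.simps [simp del]

text \<open>A discrete Gronwall inequality: from \<open>N\<close> on, each partial sum exceeds the
  previous one by a factor of at most \<open>1 + \<delta>\<close>.\<close>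

lemma bound_of_partial_sums:
  fixes b :: "nat \<Rightarrow> real"
  assumes nonneg: "\<And>n. b n \<ge> 0" and "\<delta> > 0"
    and le: "\<And>n. n \<ge> N \<Longrightarrow> b n \<le> \<delta> * (\<Sum>j<n. b j)"
  shows "\<exists>K. \<forall>n. b n \<le> K * (1 + \<delta>) ^ n"
proof -
  define B where "B n = (\<Sum>j<n. b j)" for n
  have B0: "B n \<ge> 0" for n unfolding B_def using nonneg by (simp add: sum_nonneg)
  have "B n \<le> B N * (1 + \<delta>) ^ n" for n
  proof (cases "n \<le> N")
    case True
    then have "B n \<le> B N" unfolding B_def using nonneg by (intro sum_mono2) auto
    also have "\<dots> \<le> B N * (1 + \<delta>) ^ n" using B0[of N] assms(2) by (simp add: mult_le_cancel_left1)
    finally show ?thesis .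
  next
    case False
    then have "N \<le> n" by simp
    then show ?thesis
    proof (induction n rule: dec_induct)
      case base
      then show ?case using B0[of N] assms(2) by (simp add: mult_le_cancel_left1)
    next
      case (step n)
      have "B (Suc n) = B n + b n" by (simp add: B_def)
      also have "\<dots> \<le> (1 + \<delta>) * B n" using le[OF step(1)] by (simp add: B_def algebra_simps)
      also have "\<dots> \<le> (1 + \<delta>) * (B N * (1 + \<delta>) ^ n)" using step assms(2) by (intro mult_left_mono) auto
      finally show ?case by (simp add: mult_ac)
    qed
  qed
  note * = this
  have "b n \<le> (B N * (1 + \<delta>)) * (1 + \<delta>) ^ n" for n
  proof -
    have "b n \<le> B (Suc n)" using B0[of n] by (simp add: B_def)
    also have "\<dots> \<le> B N * (1 + \<delta>) ^ Suc n" by (rule *)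
    finally show ?thesis by (simp add: mult_ac)
  qed
  then show ?thesis by blast
qed

text \<open>Divided by \<open>n^3\<close> the monic cubic tends to 1.\<close>

lemma indicial_lower_bound:
  fixes l p0 p1 p2 :: complex
  shows "\<forall>\<^sub>F n in sequentially. real n ^ 3 / 2 \<le>
    norm ((l + of_nat n)^3 + p2 * (l + of_nat n)^2 + p1 * (l + of_nat n) + p0)"
proof -
  define x where "x n = 1 / (of_nat n :: complex)" for n
  have x: "x \<longlonglongrightarrow> 0" unfolding x_def by (rule lim_1_over_n)
  have "(\<lambda>n. (1 + l * x n)^3 + p2 * x n * (1 + l * x n)^2 + p1 * (x n)^2 * (1 + l * x n) + p0 * (x n)^3)
      \<longlonglongrightarrow> (1 + l * 0)^3 + p2 * 0 * (1 + l * 0)^2 + p1 * 0^2 * (1 + l * 0) + p0 * 0^3"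
    by (intro tendsto_intros x)
  then have "(\<lambda>n. (1 + l * x n)^3 + p2 * x n * (1 + l * x n)^2 + p1 * (x n)^2 * (1 + l * x n) + p0 * (x n)^3)
      \<longlonglongrightarrow> 1" by simp
  from order_tendstoD(1)[OF tendsto_norm[OF this], of "1/2"]
  have "\<forall>\<^sub>F n in sequentially. 1 / 2 < norm ((1 + l * x n)^3 + p2 * x n * (1 + l * x n)^2 + p1 * (x n)^2 * (1 + l * x n) + p0 * (x n)^3)"
    by simp
  then show ?thesis
    using eventually_gt_at_top[of 0]
  proof eventually_elim
    case (elim n)
    have xn: "x n * of_nat n = 1" using elim by (simp add: x_def)
    have s: "of_nat n * (1 + l * x n) = l + of_nat n"
      using xn by (simp add: algebra_simps)
    have "(of_nat n)^3 * ((1 + l * x n)^3 + p2 * x n * (1 + l * x n)^2 + p1 * (x n)^2 * (1 + l * x n) + p0 * (x n)^3)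
      = (of_nat n * (1 + l * x n))^3 + p2 * (x n * of_nat n) * (of_nat n * (1 + l * x n))^2
        + p1 * (x n * of_nat n)^2 * (of_nat n * (1 + l * x n)) + p0 * (x n * of_nat n)^3"
      by (simp add: power2_eq_square power3_eq_cube algebra_simps)
    then have e: "(l + of_nat n)^3 + p2 * (l + of_nat n)^2 + p1 * (l + of_nat n) + p0 =
      (of_nat n)^3 * ((1 + l * x n)^3 + p2 * x n * (1 + l * x n)^2 + p1 * (x n)^2 * (1 + l * x n) + p0 * (x n)^3)"
      unfolding s xn by simp
    have "real n ^ 3 * (1 / 2) \<le> real n ^ 3 * norm ((1 + l * x n)^3 + p2 * x n * (1 + l * x n)^2 + p1 * (x n)^2 * (1 + l * x n) + p0 * (x n)^3)"
      using elim(1) by (intro mult_left_mono) auto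
    then show ?case unfolding e norm_mult norm_power by simp
  qed
qed

lemma disc_fps_coeff_bound:
  assumes "disc_fps A" "0 < r" "r < 1"
  shows "\<exists>C. \<forall>n. norm (fps_nth A n) * r ^ n \<le> C"
proof -
  have "ereal (norm (of_real r :: complex)) < fps_conv_radius A"
    by (rule disc_fps_norm) (use assms in auto)
  from summable_fps[OF this] have "(\<lambda>n. fps_nth A n * of_real r ^ n) \<longlonglongrightarrow> 0"
    by (rule summable_LIMSEQ_zero)
  then have "Bseq (\<lambda>n. fps_nth A n * of_real r ^ n)" by (intro convergent_imp_Bseq convergentI)
  then show ?thesis using assms(2) by (auto simp: Bseq_def norm_mult norm_power)
qed

text \<open>The operator \<open>q d/dq\<close> transported from \<open>q^l A\<close> to
  \<open>A\<close>; it is diagonal on powers of \<open>q\<close>.\<close>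

definition euler_op :: "real \<Rightarrow> complex fps \<Rightarrow> complex fps"
  where "euler_op l A = fps_X * fps_deriv A + fps_const (of_real l) * A"

lemma euler_op_nth: "fps_nth (euler_op l A) n = (of_real l + of_nat n) * fps_nth A n"
  by (cases n) (auto simp: euler_op_def algebra_simps)

lemma euler_op_rules:
  "euler_op l (A + B) = euler_op l A + euler_op l B"
  "euler_op l (A - B) = euler_op l A - euler_op l B"
  "euler_op l (A * B) = fps_X * fps_deriv A * B + A * euler_op l B"
  by (simp_all add: euler_op_def algebra_simps)

text \<open>Equation \<open>n\<close> determines coefficient \<open>n\<close>, because
  \<open>l + n\<close> is no root of the indicial polynomial for \<open>n > 0\<close>. The series
  converges in the whole disc because that polynomial grows like \<open>n^3\<close> while the other
  terms carry only \<open>n^2\<close>; the quotient eventually falls below any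
  \<open>\<delta>\<close>, and \<open>bound_of_partial_sums\<close> applies.\<close>

lemma frobenius_solution:
  fixes l :: real
  assumes P: "disc_fps P0" "disc_fps P1" "disc_fps P2"
  defines "I \<equiv> \<lambda>x. x^3 + fps_nth P2 0 * x^2 + fps_nth P1 0 * x + fps_nth P0 0"
  assumes I0: "I (of_real l) = 0" and In: "\<And>n. n > 0 \<Longrightarrow> I (of_real l + of_nat n) \<noteq> 0"
  shows "\<exists>A. disc_fps A \<and> fps_nth A 0 = 1 \<and>
    euler_op l (euler_op l (euler_op l A)) + P2 * euler_op l (euler_op l A) + P1 * euler_op l A + P0 * A = 0"
proof -
  define x where "x n = (of_real l + of_nat n :: complex)" for n
  define c where "c n j = fps_nth P2 (n - j) * x j ^ 2 + fps_nth P1 (n - j) * x j + fps_nth P0 (n - j)" for n j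
  define a where "a = frobenius_coeff c (\<lambda>n. I (x n))"
  have a0: "a 0 = 1" unfolding a_def by (subst frobenius_coeff.simps) simp
  have an: "I (x n) * a n = - (\<Sum>j<n. c n j * a j)" if "n > 0" for n
    unfolding a_def using In[OF that] that
    by (subst frobenius_coeff.simps) (simp add: x_def)
  define A where "A = Abs_fps a"
  have An: "fps_nth A n = a n" for n by (simp add: A_def)
  have "fps_nth (euler_op l (euler_op l (euler_op l A)) + P2 * euler_op l (euler_op l A) + P1 * euler_op l A + P0 * A) n = 0" for n
  proof -
    have "fps_nth (P * B) n = (\<Sum>j\<le>n. fps_nth P (n - j) * fps_nth B j)" for P B :: "complex fps"
      by (subst mult.commute) (simp add: fps_mult_nth atLeast0AtMost mult.commute)
    then have "fps_nth (euler_op l (euler_op l (euler_op l A)) + P2 * euler_op l (euler_op l A) + P1 * euler_op l A + P0 * A) n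
      = x n ^ 3 * a n + (\<Sum>j\<le>n. c n j * a j)"
      by (simp only: fps_add_nth) (simp add: euler_op_nth An x_def c_def sum.distrib [symmetric] power2_eq_square power3_eq_cube distrib_right mult.assoc add.assoc)
    also have "(\<Sum>j\<le>n. c n j * a j) = c n n * a n + (\<Sum>j<n. c n j * a j)"
      by (simp add: lessThan_Suc_atMost [symmetric])
    also have "x n ^ 3 * a n + (c n n * a n + (\<Sum>j<n. c n j * a j)) = I (x n) * a n + (\<Sum>j<n. c n j * a j)"
      by (simp add: I_def c_def algebra_simps)
    also have "\<dots> = 0"
      using an[of n] I0 by (cases "n = 0") (auto simp: x_def)
    finally show ?thesis .
  qed
  then have ode: "euler_op l (euler_op l (euler_op l A)) + P2 * euler_op l (euler_op l A) + P1 * euler_op l A + P0 * A = 0"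
    by (simp add: fps_eq_iff)
  have "disc_fps A"
  proof (rule disc_fpsI)
    fix r :: real assume r: "0 < r" "r < 1"
    \<comment> \<open>With \<open>R = t^2\<close> and \<open>1 + \<delta> = 1 / t\<close> the
      estimate reads \<open>|a n| R^n \<le> K t^(-n)\<close>, and \<open>r = R^2\<close> turns it
      into \<open>|a n| r^n \<le> K t^n\<close>; hence the fourth root.\<close>
    define t where "t = root 4 r"
    have t: "0 < t" "t < 1" "t ^ 4 = r" using r by (auto simp: t_def)
    define R where "R = t ^ 2"
    have R: "0 < R" "R < 1" using t by (auto simp: R_def power_less_one_iff)
    define \<delta> where "\<delta> = 1 / t - 1"
    have \<delta>: "\<delta> > 0" "1 + \<delta> = 1 / t" using t by (auto simp: \<delta>_def)
    obtain C0 C1 C2 where C: "\<And>n. norm (fps_nth P0 n) * R ^ n \<le> C0"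
      "\<And>n. norm (fps_nth P1 n) * R ^ n \<le> C1" "\<And>n. norm (fps_nth P2 n) * R ^ n \<le> C2"
      using P[THEN disc_fps_coeff_bound, OF R] by metis
    have C_nonneg: "C0 \<ge> 0" "C1 \<ge> 0" "C2 \<ge> 0"
      using C(1)[of 0] C(2)[of 0] C(3)[of 0] by (auto intro: order_trans[OF norm_ge_zero])
    \<comment> \<open>\<open>L n\<close> bounds \<open>|l + j|\<close> for \<open>j < n\<close> and
      is at least 1, so all three powers of \<open>|l + j|\<close> fit under
      \<open>(L n)^2\<close>.\<close>
    define L where "L = \<bar>l\<bar> + 1"
    have L: "L \<ge> 1" by (simp add: L_def)
    define M where "M = 2 * (C0 + C1 + C2) * L^2"
    have M: "M \<ge> 0" using C_nonneg by (simp add: M_def)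
    define b where "b n = norm (a n) * R ^ n" for n
    have b: "b n \<ge> 0" for n using R by (simp add: b_def)
    have c_bound: "norm (c n j) * R ^ (n - j) \<le> (C0 + C1 + C2) * (L * real n)^2" if "j < n" for n j
    proof -
      have "norm (x j) \<le> \<bar>l\<bar> + real j" unfolding x_def by (metis norm_triangle_ineq norm_of_real norm_of_nat)
      also have "\<dots> \<le> \<bar>l\<bar> * real n + real n"
        using that mult_left_mono[of 1 "real n" "\<bar>l\<bar>"] by (intro add_mono) auto
      finally have xj: "norm (x j) \<le> L * real n" by (simp add: L_def algebra_simps)
      have Ln: "1 \<le> L * real n" using L that mult_mono[of 1 L 1 "real n"] by simp
      have x2: "norm (x j) ^ 2 \<le> (L * real n)^2" using xj by (intro power_mono) auto
      have x1: "norm (x j) \<le> (L * real n)^2"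
        using xj Ln self_le_power[OF Ln, of 2] by simp
      have x0: "1 \<le> (L * real n)^2" using Ln by (simp add: one_le_power)
      have "norm (c n j) \<le> norm (fps_nth P2 (n - j)) * norm (x j)^2 + norm (fps_nth P1 (n - j)) * norm (x j) + norm (fps_nth P0 (n - j)) * 1"
        unfolding c_def by (intro norm_triangle_mono) (auto simp: norm_mult norm_power)
      then have "norm (c n j) * R ^ (n - j) \<le> (norm (fps_nth P2 (n - j)) * norm (x j)^2 + norm (fps_nth P1 (n - j)) * norm (x j) + norm (fps_nth P0 (n - j)) * 1) * R ^ (n - j)"
        using R by (intro mult_right_mono) auto
      also have "\<dots> = (norm (fps_nth P2 (n - j)) * R ^ (n - j)) * norm (x j)^2 + (norm (fps_nth P1 (n - j)) * R ^ (n - j)) * norm (x j) + (norm (fps_nth P0 (n - j)) * R ^ (n - j)) * 1"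
        by (simp add: algebra_simps)
      also have "\<dots> \<le> C2 * (L * real n)^2 + C1 * (L * real n)^2 + C0 * (L * real n)^2"
        by (intro add_mono mult_mono C x0 x1 x2 C_nonneg) auto
      finally show ?thesis by (simp add: algebra_simps)
    qed
    have "\<forall>\<^sub>F n in sequentially. real n ^ 3 / 2 \<le> norm (I (x n))"
      unfolding I_def x_def by (rule indicial_lower_bound)
    moreover have "\<forall>\<^sub>F n in sequentially. M / \<delta> \<le> real n"
      by (metis eventually_sequentially nat_ceiling_le_eq)
    ultimately have "\<forall>\<^sub>F n in sequentially. real n ^ 3 / 2 \<le> norm (I (x n)) \<and> M / \<delta> \<le> real n \<and> 0 < n"
      using eventually_gt_at_top[of 0] by eventually_elim auto
    then obtain N where N: "\<And>n. n \<ge> N \<Longrightarrow> real n ^ 3 / 2 \<le> norm (I (x n)) \<and> M / \<delta> \<le> real n \<and> 0 < n"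
      by (auto simp: eventually_sequentially)
    have "b n \<le> \<delta> * (\<Sum>j<n. b j)" if "n \<ge> N" for n
    proof -
      from N[OF that] have n: "real n ^ 3 / 2 \<le> norm (I (x n))" "M / \<delta> \<le> real n" "0 < n" by auto
      have "real n ^ 3 / 2 * b n \<le> norm (I (x n)) * b n" using n b by (intro mult_right_mono) auto
      also have "\<dots> = norm (\<Sum>j<n. c n j * a j) * R ^ n"
        using arg_cong[OF an[OF n(3)], of norm] by (simp add: b_def norm_mult)
      also have "\<dots> \<le> (\<Sum>j<n. norm (c n j * a j)) * R ^ n" using R by (intro mult_right_mono norm_sum) auto
      also have "\<dots> = (\<Sum>j<n. (norm (c n j) * R ^ (n - j)) * b j)"
        unfolding sum_distrib_right
      proof (intro sum.cong refl)
        fix j assume "j \<in> {..<n}"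
        then have "R ^ n = R ^ (n - j) * R ^ j" by (simp add: power_add [symmetric])
        then show "norm (c n j * a j) * R ^ n = norm (c n j) * R ^ (n - j) * b j"
          by (simp add: b_def norm_mult mult_ac)
      qed
      also have "\<dots> \<le> (\<Sum>j<n. ((C0 + C1 + C2) * (L * real n)^2) * b j)"
        using c_bound b by (intro sum_mono mult_right_mono) auto
      also have "\<dots> = M / 2 * (real n)^2 * (\<Sum>j<n. b j)"
        by (simp add: M_def power_mult_distrib flip: sum_distrib_left)
      also have "\<dots> \<le> (\<delta> * real n) / 2 * (real n)^2 * (\<Sum>j<n. b j)"
        using n(2) \<delta>(1) b by (intro mult_right_mono divide_right_mono sum_nonneg) (auto simp: field_simps)
      finally have "real n ^ 3 / 2 * b n \<le> real n ^ 3 / 2 * (\<delta> * (\<Sum>j<n. b j))"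
        by (simp add: power2_eq_square power3_eq_cube mult_ac)
      then show ?thesis using n(3) by (subst (asm) mult_le_cancel_left_pos) auto
    qed
    from bound_of_partial_sums[OF b \<delta>(1) this] obtain K where K: "\<And>n. b n \<le> K * (1 + \<delta>) ^ n" by blast
    show "summable (\<lambda>n. fps_nth A n * of_real r ^ n)"
    proof (rule summable_comparison_test)
      show "summable (\<lambda>n. K * t ^ n)" using t by (intro summable_mult summable_geometric) auto
      have "norm (fps_nth A n * of_real r ^ n) \<le> K * t ^ n" for n
      proof -
        have rR: "r = R * R" using t(3) by (simp add: R_def power_add [symmetric])
        have tR: "(1 + \<delta>) * R = t" unfolding \<delta>(2) using t by (simp add: R_def power2_eq_square)
        have "norm (fps_nth A n * of_real r ^ n) = b n * R ^ n"
          using R by (simp add: An b_def norm_mult norm_power rR power_mult_distrib)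
        also have "\<dots> \<le> K * (1 + \<delta>) ^ n * R ^ n" using K R by (intro mult_right_mono) auto
        also have "\<dots> = K * t ^ n" by (simp add: tR [symmetric] power_mult_distrib)
        finally show ?thesis .
      qed
      then show "\<exists>N. \<forall>n\<ge>N. norm (fps_nth A n * of_real r ^ n) \<le> K * t ^ n" by blast
    qed
  qed
  then show ?thesis using ode a0 An by metis
qed

definition fps_mmde :: "real \<Rightarrow> real \<Rightarrow> complex \<Rightarrow> complex \<Rightarrow> complex fps \<Rightarrow> complex fps"
  where "fps_mmde l k a b A =
    fps_mod_deriv l (k + 4) (fps_mod_deriv l (k + 2) (fps_mod_deriv l k A)) +
    fps_const a * E4_fps * fps_mod_deriv l k A + fps_const b * E6_fps * A"

lemma fps_mod_deriv_eq: "fps_mod_deriv l k A = euler_op l A - fps_const (of_real (k / 12)) * E2_fps * A"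
  by (simp add: fps_mod_deriv_def euler_op_def)

text \<open>As \<open>E2\<close>, \<open>E4\<close>, \<open>E6\<close> have constant term 1, the
  indicial polynomial is \<open>(x - k/12) (x - (k+2)/12) (x - (k+4)/12) + a (x - k/12) + b\<close>.
  Its roots have the sum \<open>(3 k + 6) / 12\<close>, which accounts for \<open>k\<close>;
  \<open>a\<close> is read off from the second symmetric function and \<open>b\<close> from the
  value at \<open>k/12\<close>. Roots in [0, 1) never exceed one another by a positive
  integer.\<close>

lemma fps_mmde_solution:
  fixes l m n k :: real
  assumes range: "0 \<le> l" "l < 1" "0 \<le> m" "m < 1" "0 \<le> n" "n < 1"
    and k: "k = 4 * (l + m + n) - 2"
    and a: "a = of_real (l * m + l * n + m * n - (3 * k^2 + 12 * k + 8) / 144)"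
    and b: "b = of_real ((k / 12 - l) * (k / 12 - m) * (k / 12 - n))"
  shows "\<exists>A. disc_fps A \<and> fps_nth A 0 = 1 \<and> fps_mmde l k a b A = 0"
proof -
  define \<kappa>1 \<kappa>2 \<kappa>3 :: complex where
    "\<kappa>1 = of_real (k / 12)" "\<kappa>2 = of_real ((k + 2) / 12)" "\<kappa>3 = of_real ((k + 4) / 12)"
  define E where "E = E2_fps"
  define t where "t B = fps_X * fps_deriv B" for B :: "complex fps"
  define u v w where "u = fps_const \<kappa>1" "v = fps_const \<kappa>2" "w = fps_const \<kappa>3"
  \<comment> \<open>Expansion of \<open>(\<theta> - w E) (\<theta> - v E) (\<theta> - u E)\<close>
    by the Leibniz rule, together with the \<open>E4\<close> and \<open>E6\<close> terms;
    \<open>t\<close> is \<open>q d/dq\<close> on the coefficients.\<close>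
  define P2 where "P2 = - (u + v + w) * E"
  define P1 where "P1 = (u * v + w * (u + v)) * E^2 - (2 * u + v) * t E + fps_const a * E4_fps"
  define P0 where "P0 = (2 * u * v + u * w) * E * t E - u * t (t E) - u * v * w * E^3
      + fps_const b * E6_fps - fps_const a * u * E4_fps * E"
  have disc: "disc_fps P0" "disc_fps P1" "disc_fps P2"
    unfolding P0_def P1_def P2_def t_def E_def u_v_w_def by (intro disc_fps_intros disc_E2_fps disc_E4_E6)+
  have t_const: "t (fps_const c) = 0" for c by (simp add: t_def)
  have t_mult: "t (B * C) = t B * C + B * t C" for B C by (simp add: t_def algebra_simps)
  have t_add: "t (B + C) = t B + t C" "t (B - C) = t B - t C" for B C by (simp_all add: t_def algebra_simps)
  have e_mult: "euler_op l (B * C) = t B * C + B * euler_op l C" for B C by (simp only: euler_op_rules t_def)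
  have eq: "fps_mmde l k a b A =
      euler_op l (euler_op l (euler_op l A)) + P2 * euler_op l (euler_op l A) + P1 * euler_op l A + P0 * A" for A
  proof -
    define \<theta> where "\<theta> = euler_op l"
    have th: "\<theta> (B * C) = t B * C + B * \<theta> C" "\<theta> (B + C) = \<theta> B + \<theta> C" "\<theta> (B - C) = \<theta> B - \<theta> C" for B C
      by (simp_all only: \<theta>_def e_mult euler_op_rules(1,2))
    have tu: "t u = 0" "t v = 0" "t w = 0" "t 0 = 0"
      by (simp_all add: u_v_w_def t_const) (simp add: t_def)
    have D: "fps_mod_deriv l k A = \<theta> A - u * E * A"
      "fps_mod_deriv l (k + 2) B = \<theta> B - v * E * B" "fps_mod_deriv l (k + 4) B = \<theta> B - w * E * B" for B
      by (simp_all only: fps_mod_deriv_eq \<theta>_def E_def u_v_w_def \<kappa>1_\<kappa>2_\<kappa>3_def)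
    show ?thesis
      unfolding fps_mmde_def D \<theta>_def[symmetric] th t_mult t_add tu P0_def P1_def P2_def
      by (simp add: tu algebra_simps power2_eq_square power3_eq_cube)
  qed
  have z: "fps_nth (t B) 0 = 0" for B by (simp add: t_def)
  have E0: "fps_nth E 0 = 1" by (simp add: E_def E2_fps_def)
  define I where "I x = x^3 + fps_nth P2 0 * x^2 + fps_nth P1 0 * x + fps_nth P0 0" for x
  have I: "I x = (x - of_real l) * (x - of_real m) * (x - of_real n)" for x
  proof -
    have "I x = (x - \<kappa>1) * (x - \<kappa>2) * (x - \<kappa>3) + a * (x - \<kappa>1) + b"
      by (simp add: I_def P0_def P1_def P2_def z E0 E4_E6_nth_0 u_v_w_def power2_eq_square power3_eq_cube algebra_simps)
    also have "\<dots> = (x - of_real l) * (x - of_real m) * (x - of_real n)"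
      unfolding a b \<kappa>1_\<kappa>2_\<kappa>3_def k
      by (simp add: power2_eq_square power3_eq_cube field_simps)
    finally show ?thesis .
  qed
  have "\<exists>A. disc_fps A \<and> fps_nth A 0 = 1 \<and>
    euler_op l (euler_op l (euler_op l A)) + P2 * euler_op l (euler_op l A) + P1 * euler_op l A + P0 * A = 0"
  proof (rule frobenius_solution[OF disc])
    show "of_real l ^ 3 + fps_nth P2 0 * (of_real l)^2 + fps_nth P1 0 * of_real l + fps_nth P0 0 = 0"
      using I[of "of_real l"] by (simp add: I_def)
    fix i :: nat assume i: "i > 0"
    have "of_real l + of_nat i - of_real y \<noteq> (0::complex)" if "0 \<le> y" "y < 1" for y :: real
    proof
      assume "of_real l + of_nat i - of_real y = (0::complex)"
      then have "of_real (l + real i - y) = (of_real 0 :: complex)" by simp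
      then have "l + real i - y = 0" by (simp only: of_real_eq_iff)
      then show False using that range i by auto
    qed
    then have "I (of_real l + of_nat i) \<noteq> 0" using range i unfolding I by simp
    then show "(of_real l + of_nat i) ^ 3 + fps_nth P2 0 * (of_real l + of_nat i)^2 + fps_nth P1 0 * (of_real l + of_nat i) + fps_nth P0 0 \<noteq> 0"
      by (simp add: I_def)
  qed
  then show ?thesis using eq by auto
qed

section \<open>Three-dimensional irreducible representations\<close>

definition outer :: "complex^3 \<Rightarrow> complex^3 \<Rightarrow> complex^3^3"
  where "outer u v = (\<chi> i j. u$i * v$j)"

text \<open>Bilinear, without conjugation, so that \<open>bdot v\<close> is a complex linear
  form.\<close>

definition bdot :: "complex^3 \<Rightarrow> complex^3 \<Rightarrow> complex"
  where "bdot u v = u$1 * v$1 + u$2 * v$2 + u$3 * v$3"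

definition ccross :: "complex^3 \<Rightarrow> complex^3 \<Rightarrow> complex^3"
  where "ccross a b = vector [a$2 * b$3 - a$3 * b$2, a$3 * b$1 - a$1 * b$3, a$1 * b$2 - a$2 * b$1]"

lemma ccross_nth [simp]:
  "ccross a b $ 1 = a$2 * b$3 - a$3 * b$2" "ccross a b $ 2 = a$3 * b$1 - a$1 * b$3"
  "ccross a b $ 3 = a$1 * b$2 - a$2 * b$1"
  by (simp_all add: ccross_def)

lemma vec3_eq_iff: "x = y \<longleftrightarrow> x$1 = y$1 \<and> x$2 = y$2 \<and> x$3 = (y::'a^3)$3"
  by (simp add: vec_eq_iff forall_3)

lemma ccross_eq_0: "ccross a b = 0 \<Longrightarrow> a$i * b$j = a$j * b$i"
  using exhaust_3[of i] exhaust_3[of j] by (auto simp: vec3_eq_iff)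

lemma ccross_orthogonal [simp]: "bdot a (ccross a b) = 0" "bdot b (ccross a b) = 0"
  by (simp_all add: bdot_def algebra_simps)

text \<open>The double cross product \<open>x \<times> (a \<times> b) = a (b \<cdot> x) - b (a
  \<cdot> x)\<close> vanishes.\<close>

lemma parallel_ccross:
  assumes "bdot a x = 0" "bdot b x = 0" "ccross a b \<noteq> 0"
  shows "\<exists>c. x = c *s ccross a b"
proof -
  let ?w = "ccross a b"
  have "x$2 * ?w$3 - x$3 * ?w$2 = a$1 * bdot b x - b$1 * bdot a x"
    "x$3 * ?w$1 - x$1 * ?w$3 = a$2 * bdot b x - b$2 * bdot a x"
    "x$1 * ?w$2 - x$2 * ?w$1 = a$3 * bdot b x - b$3 * bdot a x"
    by (simp_all add: bdot_def algebra_simps)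
  then have "x$2 * ?w$3 = x$3 * ?w$2" "x$3 * ?w$1 = x$1 * ?w$3" "x$1 * ?w$2 = x$2 * ?w$1"
    unfolding assms(1,2) by simp_all
  then have "x$i * ?w$j = x$j * ?w$i" for i j
    using exhaust_3[of i] exhaust_3[of j] by (auto simp del: ccross_nth)
  moreover obtain k where k: "?w$k \<noteq> 0" using assms(3) by (auto simp: vec_eq_iff)
  ultimately have "x = (x$k / ?w$k) *s ?w" by (simp add: vec_eq_iff field_simps)
  then show ?thesis by blast
qed

lemma matrix3_mult_nth: "(A ** B) $ i $ j = A$i$1 * B$1$j + A$i$2 * B$2$j + A$i$3 * B$3$j"
  for A B :: "'a::semiring_1^3^3"
  by (simp add: matrix_matrix_mult_def sum_3)

lemma matrix3_vector_nth: "(A *v x) $ i = A$i$1 * x$1 + A$i$2 * x$2 + A$i$3 * x$3"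
  for A :: "'a::semiring_1^3^3"
  by (simp add: matrix_vector_mult_def sum_3)

text \<open>The ranks of \<open>P\<close> and \<open>Q\<close> add up to at most three, so one of
  them is at most one. Concretely, if two rows of \<open>P\<close> are independent, every column of
  \<open>Q\<close> lies on the line orthogonal to both.\<close>

lemma mult_eq_0_imp_outer:
  assumes "P ** Q = (0 :: complex^3^3)"
  shows "(\<exists>u v. P = outer u v) \<or> (\<exists>u v. Q = outer u v)"
proof (cases "\<exists>i j. ccross (P$i) (P$j) \<noteq> 0")
  case True
  then obtain i j where ij: "ccross (P$i) (P$j) \<noteq> 0" by blast
  have "\<exists>c. column k Q = c *s ccross (P$i) (P$j)" for k
  proof (rule parallel_ccross[OF _ _ ij])
    have "(P ** Q) $ i $ k = 0" "(P ** Q) $ j $ k = 0" using assms by auto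
    then show "bdot (P$i) (column k Q) = 0" "bdot (P$j) (column k Q) = 0"
      by (simp_all add: matrix3_mult_nth bdot_def column_def)
  qed
  then obtain c where c: "\<And>k. column k Q = c k *s ccross (P$i) (P$j)" by metis
  have "Q$m$k = ccross (P$i) (P$j) $ m * c k" for m k
    using arg_cong[OF c[of k], of "\<lambda>x. x$m"] by (simp add: column_def mult.commute)
  then have "Q = outer (ccross (P$i) (P$j)) (\<chi> k. c k)" by (simp add: outer_def vec_eq_iff)
  then show ?thesis by blast
next
  case False
  show ?thesis
  proof (cases "P = 0")
    case True
    then have "P = outer 0 0" by (simp add: outer_def vec_eq_iff)
    then show ?thesis by blast
  next
    case False
    then obtain i k where ik: "P$i$k \<noteq> 0" by (auto simp: vec_eq_iff)
    have "P$m$n * P$i$k = P$m$k * P$i$n" for m n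
      using \<open>\<not> (\<exists>i j. ccross (P$i) (P$j) \<noteq> 0)\<close> ccross_eq_0[of "P$m" "P$i" n k] by blast
    then have "P = outer (\<chi> m. P$m$k / P$i$k) (P$i)"
      using ik by (simp add: outer_def vec_eq_iff field_simps)
    then show ?thesis by blast
  qed
qed

lemma common_orthogonal: "\<exists>w. w \<noteq> 0 \<and> bdot a w = 0 \<and> bdot b w = 0"
proof (cases "ccross a b = 0")
  case False
  then show ?thesis by (intro exI[of _ "ccross a b"]) auto
next
  case True
  have single: "\<exists>w. w \<noteq> 0 \<and> bdot x w = 0" for x
  proof (cases "x$1 = 0 \<and> x$2 = 0")
    case True
    then show ?thesis by (intro exI[of _ "vector [1, 0, 0]"]) (auto simp: vec3_eq_iff bdot_def)
  next
    case False
    then show ?thesis by (intro exI[of _ "vector [x$2, - x$1, 0]"]) (auto simp: vec3_eq_iff bdot_def)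
  qed
  show ?thesis
  proof (cases "a = 0")
    case True
    then show ?thesis using single[of b] by (auto simp: bdot_def)
  next
    case False
    then obtain k where k: "a$k \<noteq> 0" by (auto simp: vec_eq_iff)
    obtain w where w: "w \<noteq> 0" "bdot a w = 0" using single by blast
    have b: "b$i = b$k / a$k * a$i" for i
      using ccross_eq_0[OF True, of k i] k by (simp add: field_simps)
    have "bdot b w = b$k / a$k * bdot a w"
      unfolding bdot_def b[of 1] b[of 2] b[of 3] by (simp add: algebra_simps)
    then show ?thesis using w by auto
  qed
qed

lemma det_eq_traces:
  fixes A :: "complex^3^3"
  shows "6 * det A = trace A ^ 3 - 3 * trace A * trace (A ** A) + 2 * trace (A ** (A ** A))"
  by (simp add: det_3 trace_def sum_3 matrix3_mult_nth power3_eq_cube algebra_simps)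

lemma mat3_nth:
  "mat c $ (1::3) $ (1::3) = c" "mat c $ (2::3) $ (2::3) = c" "mat c $ (3::3) $ (3::3) = c"
  "mat c $ (1::3) $ (2::3) = 0" "mat c $ (1::3) $ (3::3) = 0" "mat c $ (2::3) $ (1::3) = 0"
  "mat c $ (2::3) $ (3::3) = 0" "mat c $ (3::3) $ (1::3) = 0" "mat c $ (3::3) $ (2::3) = 0"
  by (simp_all add: mat_def)

text \<open>The polynomial \<open>X\<^sup>2 + x X + x\<^sup>2\<close> is the cofactor of \<open>X - x\<close> in \<open>X\<^sup>3 - x\<^sup>3\<close>; at \<open>R\<close>
  it has rank at most one, so its trace is \<open>0\<close> or \<open>3 x\<^sup>2\<close>.\<close>

lemma cube_scalar_traces:
  fixes R :: "complex^3^3"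
  assumes R3: "R ** (R ** R) = mat e" and e: "e \<noteq> 0"
    and not_outer: "\<And>x u v. R \<noteq> mat x + outer u v"
  shows "trace R = 0" "trace (R ** R) = 0" "det R = e"
proof -
  define T1 T2 where "T1 = trace R" "T2 = trace (R ** R)"
  have tr: "T2 / x^2 + T1 / x + 3 = 0 \<or> T2 / x^2 + T1 / x + 3 = 3" if x: "x^3 = e" for x
  proof -
    have x0: "x \<noteq> 0" using x e by auto
    define N where "N = R ** R + mat x ** R + mat (x^2)"
    have RN: "R ** N = mat x ** N"
    proof -
      have "R ** (R ** R) + R ** (mat x ** R) + R ** mat (x^2) = mat x ** (R ** R) + mat x ** (mat x ** R) + mat (x^3)"
        unfolding R3 x by (simp add: vec_eq_iff matrix3_mult_nth forall_3 mat3_nth algebra_simps power2_eq_square)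
      moreover have "R ** N = R ** (R ** R) + R ** (mat x ** R) + R ** mat (x^2)"
        unfolding N_def matrix_add_ldistrib ..
      moreover have "mat x ** N = mat x ** (R ** R) + mat x ** (mat x ** R) + mat (x^3)"
        unfolding N_def matrix_add_ldistrib
        by (simp add: vec_eq_iff matrix3_mult_nth forall_3 mat3_nth power3_eq_cube power2_eq_square)
      ultimately show ?thesis by simp
    qed
    have "(R - mat x) ** N = R ** N - mat x ** N"
      by (simp add: vec_eq_iff matrix3_mult_nth algebra_simps)
    then have "(R - mat x) ** N = 0" using RN by simp
    from mult_eq_0_imp_outer[OF this] have "\<exists>u v. N = outer u v"
      using not_outer[of x] by (metis add_diff_cancel_left' diff_add_cancel add.commute)
    then obtain u v where uv: "N = outer u v" by blast
    have trN: "trace N = T2 + x * T1 + 3 * x^2"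
      by (simp add: N_def trace_def sum_3 T1_T2_def matrix3_mult_nth mat3_nth algebra_simps)
    \<comment> \<open>\<open>R N = x N\<close> gives \<open>N^2 = 3 x^2 N\<close>, while rank at
      most one gives \<open>N^2 = (trace N) N\<close>.\<close>
    have "N ** N = mat (3 * x^2) ** N"
    proof -
      have "N ** N = R ** (R ** N) + mat x ** (R ** N) + mat (x^2) ** N"
        by (subst (1) N_def) (simp add: vec_eq_iff matrix3_mult_nth algebra_simps)
      also have "R ** (R ** N) = mat x ** (mat x ** N)"
      proof -
        have "R ** (mat x ** N) = mat x ** (R ** N)"
          by (simp add: vec_eq_iff matrix3_mult_nth forall_3 mat3_nth algebra_simps)
        then show ?thesis unfolding RN by (simp add: RN)
      qed
      also have "mat x ** (mat x ** N) + mat x ** (R ** N) + mat (x^2) ** N = mat (3 * x^2) ** N"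
        unfolding RN by (simp add: vec_eq_iff matrix3_mult_nth forall_3 mat3_nth power2_eq_square algebra_simps)
      finally show ?thesis .
    qed
    moreover have "N ** N = mat (trace N) ** N"
      unfolding uv by (simp add: vec_eq_iff matrix3_mult_nth forall_3 mat3_nth outer_def trace_def sum_3 algebra_simps)
    ultimately have eq: "mat (3 * x^2) ** N = mat (trace N) ** N" by simp
    have "trace N = 0 \<or> trace N = 3 * x^2"
    proof (cases "N = 0")
      case True
      then show ?thesis by (simp add: trace_def sum_3)
    next
      case False
      then obtain i j where ij: "N$i$j \<noteq> 0" by (auto simp: vec_eq_iff)
      have m: "(mat c ** N)$i$j = c * N$i$j" for c
        using exhaust_3[of i] by (auto simp: matrix3_mult_nth mat3_nth)
      show ?thesis using arg_cong[OF eq, of "\<lambda>M. M$i$j"] ij unfolding m by auto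
    qed
    then show ?thesis unfolding trN using x0
      by (auto simp: field_simps power2_eq_square)
  qed
  obtain x where x: "x^3 = e" "x \<noteq> 0"
    using e by (metis exists_complex_root[of 3 e] power_zero_numeral zero_neq_numeral)
  define w where "w = cis (2 * pi / 3)"
  have w3: "w^3 = 1" unfolding w_def Complex.DeMoivre by simp
  have w0: "w \<noteq> 0" by (simp add: w_def)
  have "Im w > 0" unfolding w_def using sin_gt_zero[of "2 * pi / 3"] by simp
  then have "w \<noteq> 1" by auto
  moreover have "(w - 1) * (w^2 + w + 1) = 0" using w3 by (simp add: power2_eq_square power3_eq_cube algebra_simps)
  ultimately have w: "w^2 + w + 1 = 0" by simp
  define p q where "p = T2 / x^2" "q = T1 / x"
  have c: "p * y^2 + q * y = -3 \<or> p * y^2 + q * y = 0" if y: "y^3 = 1" for y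
  proof -
    have "T2 / (x / y)^2 = p * y^2" "T1 / (x / y) = q * y"
      by (simp_all add: p_q_def power_divide)
    moreover have "(x / y)^3 = e" using x(1) y by (simp add: power_divide)
    ultimately have "p * y^2 + q * y + 3 = 0 \<or> p * y^2 + q * y + 3 = 3" using tr by metis
    then show ?thesis by (auto simp: eq_neg_iff_add_eq_0)
  qed
  have w4: "(w^2)^2 = w" using w3 by (simp add: power2_eq_square power3_eq_cube mult.assoc)
  have "(w^2)^3 = (w^3)^2" by (simp flip: power_mult)
  then have w6: "(w^2)^3 = 1" using w3 by simp
  have c1: "p + q = -3 \<or> p + q = 0" using c[of 1] by simp
  have c2: "p * w + q * w^2 = -3 \<or> p * w + q * w^2 = 0" using c[OF w6] w4 by simp
  have c3: "p * w^2 + q * w = -3 \<or> p * w^2 + q * w = 0" using c[OF w3] by simp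
  \<comment> \<open>Three numbers from {-3, 0} with sum 0 are all 0.\<close>
  have sum: "(p + q) + (p * w + q * w^2) + (p * w^2 + q * w) = 0"
  proof -
    have "(p + q) + (p * w + q * w^2) + (p * w^2 + q * w) = (p + q) * (w^2 + w + 1)"
      by (simp add: algebra_simps)
    then show ?thesis by (simp only: w mult_zero_right)
  qed
  have "p + q = 0" "p * w + q * w^2 = 0"
    using c1 c2 c3 sum by auto
  moreover from this have "q = - p" by (simp add: add_eq_0_iff)
  ultimately have "p * w * (1 - w) = 0" by (simp add: algebra_simps power2_eq_square)
  then have "p = 0" using w0 \<open>w \<noteq> 1\<close> by simp
  then have "q = 0" using \<open>p + q = 0\<close> by simp
  show t1: "trace R = 0" using \<open>q = 0\<close> x(2) by (simp add: p_q_def T1_T2_def)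
  show t2: "trace (R ** R) = 0" using \<open>p = 0\<close> x(2) by (simp add: p_q_def T1_T2_def)
  have "6 * det R = 2 * (3 * e)"
    unfolding det_eq_traces t1 t2 R3 by (simp add: trace_def sum_3 mat3_nth)
  then show "det R = e" by simp
qed

section \<open>Reflections and their invariants\<close>

definition diag3 :: "complex^3 \<Rightarrow> complex^3^3"
  where "diag3 t = (\<chi> i j. if i = j then t$i else 0)"

lemma diag3_nth:
  "diag3 t $ 1 $ 1 = t$1" "diag3 t $ 2 $ 2 = t$2" "diag3 t $ 3 $ 3 = t$3"
  "diag3 t $ 1 $ 2 = 0" "diag3 t $ 1 $ 3 = 0" "diag3 t $ 2 $ 1 = 0"
  "diag3 t $ 2 $ 3 = 0" "diag3 t $ 3 $ 1 = 0" "diag3 t $ 3 $ 2 = 0"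
  by (simp_all add: diag3_def)

text \<open>A reflection \<open>s (1 - 2 u v\<^sup>T)\<close> whose product with the diagonal matrix \<open>t\<close> has the
  characteristic polynomial \<open>X\<^sup>3 - s\<^sup>2\<close>.\<close>

definition reflection_pair :: "complex^3 \<Rightarrow> complex^3^3 \<Rightarrow> complex \<Rightarrow> complex^3 \<Rightarrow> complex^3 \<Rightarrow> bool"
  where "reflection_pair t S s u v \<longleftrightarrow> s \<noteq> 0 \<and> bdot v u = 1 \<and> S = mat s - outer ((2 * s) *s u) v \<and>
    trace (S ** diag3 t) = 0 \<and> trace ((S ** diag3 t) ** (S ** diag3 t)) = 0 \<and>
    det (S ** diag3 t) = s^2"

text \<open>The normalisation, the two traces and the determinant amount to a formula for
  \<open>s\<close> and to the moments of order 0, 1, 2 of the weights \<open>u_i v_i\<close> at the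
  nodes \<open>t_i\<close>.\<close>

lemma reflection_pair_facts:
  assumes P: "reflection_pair t S s u v"
  defines "e1 \<equiv> t$1 + t$2 + t$3" and "p2 \<equiv> t$1^2 + t$2^2 + t$3^2"
  shows "s * (t$1 * t$2 * t$3) = -1"
    "u$1 * v$1 + u$2 * v$2 + u$3 * v$3 = 1"
    "u$1 * v$1 * t$1 + u$2 * v$2 * t$2 + u$3 * v$3 * t$3 = e1 / 2"
    "u$1 * v$1 * t$1^2 + u$2 * v$2 * t$2^2 + u$3 * v$3 * t$3^2 = (p2 + e1^2) / 4"
proof -
  have s: "s \<noteq> 0" and vu: "bdot v u = 1" and S: "S = mat s - outer ((2 * s) *s u) v"
    and tr: "trace (S ** diag3 t) = 0" "trace ((S ** diag3 t) ** (S ** diag3 t)) = 0"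
    and d: "det (S ** diag3 t) = s^2" using P by (auto simp: reflection_pair_def)
  show 1: "u$1 * v$1 + u$2 * v$2 + u$3 * v$3 = 1" using vu by (simp add: bdot_def mult.commute)
  define a where "a = u$1 * v$1 * t$1 + u$2 * v$2 * t$2 + u$3 * v$3 * t$3"
  have "trace (S ** diag3 t) = s * (e1 - 2 * a)"
    by (simp add: S trace_def sum_3 matrix3_mult_nth diag3_nth mat3_nth outer_def e1_def p2_def a_def algebra_simps)
  then have a: "a = e1 / 2" using tr s by (simp add: field_simps)
  then show "u$1 * v$1 * t$1 + u$2 * v$2 * t$2 + u$3 * v$3 * t$3 = e1 / 2" by (simp add: a_def)
  define b where "b = u$1 * v$1 * t$1^2 + u$2 * v$2 * t$2^2 + u$3 * v$3 * t$3^2"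
  have "trace ((S ** diag3 t) ** (S ** diag3 t)) = s^2 * (p2 - 4 * b + 4 * a^2)"
    by (simp add: S trace_def sum_3 matrix3_mult_nth diag3_nth mat3_nth outer_def e1_def p2_def a_def b_def algebra_simps power2_eq_square)
  then have "p2 - 4 * b + 4 * a^2 = 0" using tr s by simp
  then show "u$1 * v$1 * t$1^2 + u$2 * v$2 * t$2^2 + u$3 * v$3 * t$3^2 = (p2 + e1^2) / 4"
    unfolding b_def[symmetric] a by (simp add: field_simps power2_eq_square)
  have "det (S ** diag3 t) = s^3 * (1 - 2 * (u$1 * v$1 + u$2 * v$2 + u$3 * v$3)) * (t$1 * t$2 * t$3)"
    by (simp add: det_mul, simp add: S det_3 diag3_nth mat3_nth outer_def algebra_simps power3_eq_cube)
  then have "s^2 = s^3 * (1 - 2 * 1) * (t$1 * t$2 * t$3)" unfolding 1 d .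
  moreover have "s^2 * (s * (t$1 * t$2 * t$3) + 1) = s^2 - s^3 * (1 - 2 * 1) * (t$1 * t$2 * t$3)"
    by (simp add: algebra_simps power2_eq_square power3_eq_cube)
  ultimately have "s^2 * (s * (t$1 * t$2 * t$3) + 1) = 0" by simp
  then show "s * (t$1 * t$2 * t$3) = -1" using s by (simp add: add_eq_0_iff2)
qed

lemma reflection_pair_unique:
  assumes A: "reflection_pair t S s u v" and B: "reflection_pair t S' s' u' v'"
    and t: "t$1 \<noteq> t$2" "t$1 \<noteq> t$3" "t$2 \<noteq> t$3"
  shows "s = s'" "u$i * v$i = u'$i * v'$i"
proof -
  note facts = reflection_pair_facts
  have "(s - s') * (t$1 * t$2 * t$3) = 0" "t$1 * t$2 * t$3 \<noteq> 0"
    using facts(1)[OF A] facts(1)[OF B] by (auto simp: algebra_simps)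
  then show "s = s'" by simp
  define x where "x i = u$i * v$i - u'$i * v'$i" for i
  have "x 1 + x 2 + x 3 = (u$1 * v$1 + u$2 * v$2 + u$3 * v$3) - (u'$1 * v'$1 + u'$2 * v'$2 + u'$3 * v'$3)"
    "x 1 * t$1 + x 2 * t$2 + x 3 * t$3 = (u$1 * v$1 * t$1 + u$2 * v$2 * t$2 + u$3 * v$3 * t$3)
      - (u'$1 * v'$1 * t$1 + u'$2 * v'$2 * t$2 + u'$3 * v'$3 * t$3)"
    "x 1 * t$1^2 + x 2 * t$2^2 + x 3 * t$3^2 = (u$1 * v$1 * t$1^2 + u$2 * v$2 * t$2^2 + u$3 * v$3 * t$3^2)
      - (u'$1 * v'$1 * t$1^2 + u'$2 * v'$2 * t$2^2 + u'$3 * v'$3 * t$3^2)"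
    by (simp_all add: x_def algebra_simps)
  then have e: "x 1 + x 2 + x 3 = 0" "x 1 * t$1 + x 2 * t$2 + x 3 * t$3 = 0" "x 1 * t$1^2 + x 2 * t$2^2 + x 3 * t$3^2 = 0"
    by (simp_all only: facts(2-4)[OF A] facts(2-4)[OF B] diff_self)
  \<comment> \<open>Lagrange interpolation: the polynomial \<open>(X - q) (X - r)\<close>, paired
    with the three moments, isolates the weight at \<open>p\<close>.\<close>
  have vandermonde: "a * ((p - q) * (p - r)) = (a * p^2 + b * q^2 + c * r^2) - (q + r) * (a * p + b * q + c * r)
      + q * r * (a + b + c)" for a b c p q r :: complex
    by (simp add: algebra_simps power2_eq_square)
  have "x 1 * ((t$1 - t$2) * (t$1 - t$3)) = 0"
    using vandermonde[of "x 1" "t$1" "t$2" "t$3" "x 2" "x 3"] unfolding e by simp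
  moreover have "x 2 * ((t$2 - t$1) * (t$2 - t$3)) = 0"
    using vandermonde[of "x 2" "t$2" "t$1" "t$3" "x 1" "x 3"] e by (simp add: add_ac)
  moreover have "x 3 * ((t$3 - t$1) * (t$3 - t$2)) = 0"
    using vandermonde[of "x 3" "t$3" "t$1" "t$2" "x 1" "x 2"] e by (simp add: add_ac)
  ultimately have "x 1 = 0" "x 2 = 0" "x 3 = 0" using t by auto
  then have "x i = 0" using exhaust_3[of i] by auto
  then show "u$i * v$i = u'$i * v'$i" by (simp add: x_def)
qed

text \<open>Equal products \<open>u_i v_i\<close> leave only the freedom \<open>u = c u'\<close>,
  \<open>v' = c v\<close> of a diagonal matrix, which commutes with \<open>diag3 t\<close> and
  therefore keeps the matrix of \<open>T\<close>.\<close>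

lemma reflection_pair_conjugate:
  assumes A: "reflection_pair t S s u v" and B: "reflection_pair t S' s' u' v'"
    and t: "t$1 \<noteq> t$2" "t$1 \<noteq> t$3" "t$2 \<noteq> t$3" and nz: "\<And>i. u$i \<noteq> 0" "\<And>i. v$i \<noteq> 0"
  shows "\<exists>c. (\<forall>i. c$i \<noteq> 0) \<and> S ** diag3 c = diag3 c ** S'"
proof -
  have s: "s = s'" and uv: "\<And>i. u$i * v$i = u'$i * v'$i"
    using reflection_pair_unique[OF A B t] by auto
  have nz': "u'$i \<noteq> 0" for i using uv[of i] nz[of i] by auto
  define c :: "complex^3" where "c = (\<chi> i. u$i / u'$i)"
  have v': "v'$j = v$j * c$j" for j using uv[of j] nz' by (simp add: c_def field_simps)
  have u: "u$i = c$i * u'$i" for i using nz' by (simp add: c_def)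
  have S: "S = mat s - outer ((2 * s) *s u) v" "S' = mat s - outer ((2 * s) *s u') v'"
    using A B s by (auto simp: reflection_pair_def)
  have "S ** diag3 c = diag3 c ** S'"
    unfolding S vec_eq_iff forall_3 matrix3_mult_nth
    by (simp add: diag3_nth mat3_nth outer_def u v' algebra_simps)
  moreover have "c$i \<noteq> 0" for i using nz nz' by (simp add: c_def)
  ultimately show ?thesis by blast
qed

lemma representation_one:
  assumes "representation \<rho>"
  shows "\<rho> (mat 1) = mat 1"
proof -
  have "\<rho> (mat 1) ** \<rho> (mat 1) = \<rho> (mat 1)" "invertible (\<rho> (mat 1))"
    using assms modular_group_generators(1) unfolding representation_def
    by (metis matrix_mul_lid)+
  then show ?thesis
    by (metis invertible_def matrix_mul_assoc matrix_mul_lid)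
qed

lemma irreducible_invariant_subspace:
  assumes irr: "irreducible_representation \<rho>" and W: "vec.subspace W"
    and S: "\<And>w. w \<in> W \<Longrightarrow> \<rho> S_mat *v w \<in> W" and T: "\<And>w. w \<in> W \<Longrightarrow> \<rho> T_mat *v w \<in> W"
  shows "W = {0} \<or> W = UNIV"
proof -
  have rep: "representation \<rho>" using irr by (simp add: irreducible_representation_def)
  then have mul: "\<rho> (A ** B) = \<rho> A ** \<rho> B" if "A \<in> modular_group" "B \<in> modular_group" for A B
    using that by (simp add: representation_def)
  have "\<forall>w\<in>W. \<rho> A *v w \<in> W" if "A \<in> modular_group" for A
    using that
    by (induction rule: modular_group_induct)
       (auto simp: representation_one[OF rep] mul matrix_vector_mul_assoc [symmetric] S T)
  then show ?thesis using irr W unfolding irreducible_representation_def by blast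
qed

lemma no_common_eigenvector:
  fixes \<rho> :: "int^2^2 \<Rightarrow> complex^3^3"
  assumes irr: "irreducible_representation \<rho>" and w: "w \<noteq> 0"
    and S: "\<rho> S_mat *v w = a *s w" and T: "\<rho> T_mat *v w = b *s w"
  shows False
proof -
  let ?W = "vec.span {w}"
  have mem: "x \<in> ?W \<longleftrightarrow> (\<exists>c. x = c *s w)" for x by (auto simp: vec.span_singleton)
  have "vec.subspace ?W" by simp
  then have "?W = {0} \<or> ?W = UNIV"
  proof (rule irreducible_invariant_subspace[OF irr])
    show "\<rho> S_mat *v x \<in> ?W" if "x \<in> ?W" for x
      using that S by (auto simp: mem vector_scalar_commute vector_smult_assoc)
    show "\<rho> T_mat *v x \<in> ?W" if "x \<in> ?W" for x
      using that T by (auto simp: mem vector_scalar_commute vector_smult_assoc)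
  qed
  moreover have "w \<in> ?W" by (simp add: vec.span_base)
  ultimately have "?W = UNIV" using w by auto
  then have all: "\<exists>c. x = c *s w" for x using mem[of x] by simp
  obtain k where k: "w$k \<noteq> 0" using w by (auto simp: vec_eq_iff)
  obtain i :: 3 where i: "i \<noteq> k" by (cases "k = 1") (auto intro: that[of 2] that[of 1])
  obtain c where "axis i 1 = c *s w" using all by blast
  then have "axis i (1::complex) $ k = c * w$k" "axis i (1::complex) $ i = c * w$i" by (simp_all only: vector_smult_component)
  then show False using i k by (auto simp: axis_def)
qed


lemma minus_mat: "mat (- c) = - (mat c :: complex^3^3)"
  by (simp add: vec_eq_iff mat_def)

lemma mat_vector_mult [simp]: "mat c *v x = c *s (x :: complex^3)"
  by (simp add: vec3_eq_iff matrix3_vector_nth mat3_nth)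

text \<open>Schur's lemma by hand: the image \<open>N\<close> of the central involution has an
  invariant fixed space, which is everything or zero; in the second case \<open>x + N x\<close> is
  fixed and hence 0.\<close>

lemma irreducible_neg_scalar:
  fixes \<rho> :: "int^2^2 \<Rightarrow> complex^3^3"
  assumes irr: "irreducible_representation \<rho>"
  shows "\<exists>e. e^2 = 1 \<and> \<rho> neg_mat = mat e"
proof -
  let ?N = "\<rho> neg_mat"
  have rep: "representation \<rho>" using irr by (simp add: irreducible_representation_def)
  then have mul: "\<rho> (A ** B) = \<rho> A ** \<rho> B" if "A \<in> modular_group" "B \<in> modular_group" for A B
    using that by (simp add: representation_def)
  have comm: "?N ** \<rho> S_mat = \<rho> S_mat ** ?N" "?N ** \<rho> T_mat = \<rho> T_mat ** ?N"
    by (simp_all add: mul [symmetric]) (simp_all add: S_mat_def T_mat_eq_mat2 neg_mat_def mat2_mult)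
  have NN: "?N *v (?N *v x) = x" for x
    using mul[of neg_mat neg_mat, symmetric]
    by (simp add: generator_relations representation_one[OF rep] matrix_vector_mul_assoc)
  have comm': "?N *v (\<rho> S_mat *v x) = \<rho> S_mat *v (?N *v x)" "?N *v (\<rho> T_mat *v x) = \<rho> T_mat *v (?N *v x)" for x
    using comm by (simp_all add: matrix_vector_mul_assoc)
  define W where "W = {x. ?N *v x = x}"
  have "W = {0} \<or> W = UNIV"
  proof (rule irreducible_invariant_subspace[OF irr])
    show "vec.subspace W"
      by (auto simp: W_def vec.subspace_def matrix_vector_right_distrib vector_scalar_commute)
  qed (auto simp: W_def comm')
  then show ?thesis
  proof
    assume "W = UNIV"
    then have "?N *v x = mat 1 *v x" for x by (auto simp: W_def)
    then have "?N = mat 1" by (simp add: matrix_eq)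
    then show ?thesis by (intro exI[of _ 1]) auto
  next
    assume W: "W = {0}"
    have "x + ?N *v x \<in> W" for x
      by (simp add: W_def matrix_vector_right_distrib NN add.commute)
    then have "?N *v x = mat (-1) *v x" for x
      using W by (simp add: vec_eq_iff add_eq_0_iff)
    then have "?N = mat (-1)" by (simp add: matrix_eq)
    then show ?thesis by (intro exI[of _ "-1"]) auto
  qed
qed

lemma outer_vector_mult: "outer u v *v x = bdot v x *s u"
  by (simp add: vec3_eq_iff matrix3_vector_nth outer_def bdot_def algebra_simps)

text \<open>Comparing squares gives \<open>2 s + bdot v u = 0\<close>; rescaling \<open>u\<close> by
  \<open>-1 / (2 s)\<close> normalises the pairing to 1.\<close>

lemma scalar_square_reflection:
  fixes S :: "complex^3^3"
  assumes S: "S = mat s + outer u v" and sq: "S ** S = mat (s^2)" and s: "s \<noteq> 0" and ne: "S \<noteq> mat s"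
  shows "\<exists>w. bdot v w = 1 \<and> S = mat s - outer ((2 * s) *s w) v"
proof -
  have "S ** S = mat (s^2) + mat (2 * s + bdot v u) ** outer u v"
    unfolding S by (simp add: vec_eq_iff forall_3 matrix3_mult_nth mat3_nth outer_def bdot_def algebra_simps power2_eq_square)
  then have z: "mat (2 * s + bdot v u) ** outer u v = 0" using sq by simp
  have "outer u v \<noteq> 0" using S ne by auto
  then obtain i j where ij: "outer u v $ i $ j \<noteq> 0" by (auto simp: vec_eq_iff)
  have m: "(mat c ** N)$i$j = c * N$i$j" for c and N :: "complex^3^3"
    using exhaust_3[of i] by (auto simp: matrix3_mult_nth mat3_nth)
  have "2 * s + bdot v u = 0"
    using arg_cong[OF z, of "\<lambda>M. M$i$j"] ij unfolding m by simp
  then have vu: "bdot v u = - (2 * s)" by (simp add: add_eq_0_iff)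
  let ?w = "(- 1 / (2 * s)) *s u"
  have "bdot v ?w = - 1 / (2 * s) * bdot v u" by (simp add: bdot_def add_divide_distrib algebra_simps)
  then have "bdot v ?w = 1" using s by (simp add: vu)
  moreover have "S = mat s - outer ((2 * s) *s ?w) v"
    unfolding S using s by (simp add: vec_eq_iff outer_def)
  ultimately show ?thesis by blast
qed

text \<open>A scalar square splits \<open>S\<close> as a scalar plus a matrix of rank one, so
  \<open>S\<close> is scalar on the plane \<open>bdot v x = 0\<close>. Irreducibility excludes every
  degeneration: equal \<open>t_i\<close> or a zero entry of \<open>v\<close> would put an
  eigenvector of \<open>T\<close> into that plane, and a zero entry of \<open>u\<close> would make a
  coordinate plane invariant.\<close>

lemma irreducible_reflection_pair:
  fixes \<rho> :: "int^2^2 \<Rightarrow> complex^3^3"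
  assumes irr: "irreducible_representation \<rho>" and T: "\<rho> T_mat = diag3 t"
  shows "t$1 \<noteq> t$2 \<and> t$1 \<noteq> t$3 \<and> t$2 \<noteq> t$3 \<and>
    (\<exists>s u v. reflection_pair t (\<rho> S_mat) s u v \<and> s^4 = 1 \<and> (\<forall>i. u$i \<noteq> 0) \<and> (\<forall>i. v$i \<noteq> 0))"
proof -
  let ?S = "\<rho> S_mat"
  have rep: "representation \<rho>" using irr by (simp add: irreducible_representation_def)
  then have mul: "\<rho> (A ** B) = \<rho> A ** \<rho> B" if "A \<in> modular_group" "B \<in> modular_group" for A B
    using that by (simp add: representation_def)
  obtain e where e: "e^2 = 1" "\<rho> neg_mat = mat e" using irreducible_neg_scalar[OF irr] by blast
  have e0: "e \<noteq> 0" using e by auto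
  define s0 where "s0 = csqrt e"
  have s0: "s0^2 = e" "s0 \<noteq> 0" using e0 by (auto simp: s0_def)
  have SS: "?S ** ?S = mat e" using mul[of S_mat S_mat] e by (simp add: generator_relations)
  have no_ev: False if "w \<noteq> 0" "?S *v w = a *s w" "diag3 t *v w = b *s w" for w a b
    by (rule no_common_eigenvector[OF irr that(1,2), of b]) (simp add: T that(3))
  have diag_axis: "diag3 t *v axis i 1 = t$i *s axis i 1" for i
    using exhaust_3[of i] by (auto simp: vec3_eq_iff matrix3_vector_nth diag3_nth axis_def)
  have not_scalar: "?S \<noteq> mat a" for a
  proof
    assume "?S = mat a"
    then have "?S *v axis 1 1 = a *s axis 1 1" by simp
    then show False using no_ev[OF _ _ diag_axis] by (auto simp: axis_eq_0_iff)
  qed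
  have "(?S - mat s0) ** (?S + mat s0) = ?S ** ?S - mat (s0^2)"
    by (simp add: vec_eq_iff forall_3 matrix3_mult_nth mat3_nth algebra_simps power2_eq_square)
  then have "(?S - mat s0) ** (?S + mat s0) = 0" by (simp add: SS s0)
  from mult_eq_0_imp_outer[OF this]
  have "\<exists>s u v. s^2 = e \<and> s \<noteq> 0 \<and> ?S = mat s + outer u v"
  proof (elim disjE exE)
    fix u v assume "?S - mat s0 = outer u v"
    then have "?S = mat s0 + outer u v" by (simp add: algebra_simps)
    then show ?thesis using s0 by blast
  next
    fix u v assume "?S + mat s0 = outer u v"
    then have "?S = mat (- s0) + outer u v"
      by (metis add_diff_cancel_right' minus_mat diff_conv_add_uminus add.commute)
    moreover have "(- s0)^2 = e" "- s0 \<noteq> 0" using s0 by auto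
    ultimately show ?thesis by blast
  qed
  then obtain s u0 v where s: "s^2 = e" "s \<noteq> 0" and S0: "?S = mat s + outer u0 v" by blast
  obtain u where u: "bdot v u = 1" and S: "?S = mat s - outer ((2 * s) *s u) v"
    using scalar_square_reflection[OF S0 _ s(2) not_scalar] SS s(1) by auto
  have Sx: "?S *v x = s *s x - (2 * s * bdot v x) *s u" for x
    unfolding S by (simp add: vec3_eq_iff matrix3_vector_nth mat3_nth outer_def bdot_def algebra_simps)
  have Sfix: "?S *v w = s *s w" if "bdot v w = 0" for w using that by (simp add: Sx)
  have dist: "t$i \<noteq> t$j" if "i \<noteq> j" for i j
  proof
    assume eq: "t$i = t$j"
    \<comment> \<open>On the span of the axes \<open>i\<close> and \<open>j\<close> the matrix of
      \<open>T\<close> is scalar; the span meets the kernel of \<open>bdot v\<close> in this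
      vector.\<close>
    define w where "w = (if v$i = 0 \<and> v$j = 0 then axis i 1 else v$j *s axis i 1 - v$i *s axis j 1)"
    have bd: "bdot v (axis m 1) = v$m" for m
      using exhaust_3[of m] by (auto simp: bdot_def axis_def)
    have lin: "bdot v (a *s x - b *s y) = a * bdot v x - b * bdot v y" for a b x y
      by (simp add: bdot_def algebra_simps)
    have "bdot v w = 0" by (simp add: w_def lin bd)
    moreover have "diag3 t *v w = t$i *s w"
      unfolding w_def using eq
      by (simp add: diag_axis matrix_vector_mult_diff_distrib vector_scalar_commute vec_eq_iff algebra_simps)
    moreover have "w \<noteq> 0"
    proof (cases "v$i = 0 \<and> v$j = 0")
      case True
      then show ?thesis by (simp add: w_def axis_eq_0_iff)
    next
      case False
      then have "w$i = v$j" "w$j = - v$i" using that by (auto simp: w_def axis_def)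
      then have "w$i \<noteq> 0 \<or> w$j \<noteq> 0" using False by auto
      then show ?thesis by auto
    qed
    ultimately show False using no_ev Sfix by blast
  qed
  have dv: "diag3 t *v x = (\<chi> i. t$i * x$i)" for x
    by (simp add: vec3_eq_iff matrix3_vector_nth diag3_nth)
  have unz: "u$i \<noteq> 0" for i
  proof
    assume ui: "u$i = 0"
    define W where "W = {x::complex^3. x$i = 0}"
    have "W = {0} \<or> W = UNIV"
    proof (rule irreducible_invariant_subspace[OF irr])
      show "vec.subspace W" by (auto simp: W_def vec.subspace_def)
      show "?S *v w \<in> W" if "w \<in> W" for w using that by (simp add: W_def Sx ui)
      show "\<rho> T_mat *v w \<in> W" if "w \<in> W" for w using that by (simp add: W_def T dv)
    qed
    moreover have "axis i 1 \<notin> W" by (simp add: W_def axis_def)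
    moreover obtain j :: 3 where j: "j \<noteq> i" by (cases "i = 1") (auto intro: that[of 2] that[of 1])
    then have "axis j 1 \<in> W" by (simp add: W_def axis_def)
    moreover have "axis j (1::complex) \<noteq> 0" by (simp add: axis_eq_0_iff)
    ultimately show False by auto
  qed
  have vnz: "v$i \<noteq> 0" for i
  proof
    assume "v$i = 0"
    then have "bdot v (axis i 1) = 0" using exhaust_3[of i] by (auto simp: bdot_def axis_def)
    from no_ev[OF _ Sfix[OF this] diag_axis] show False by (simp add: axis_eq_0_iff)
  qed
  let ?R = "?S ** diag3 t"
  have R3: "?R ** (?R ** ?R) = mat e"
    using mul[of S_mat T_mat] mul[of "S_mat ** T_mat" "S_mat ** T_mat"]
      mul[of "S_mat ** T_mat" "(S_mat ** T_mat) ** (S_mat ** T_mat)"] e T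
    by (simp add: generator_relations modular_group_mult)
  \<comment> \<open>On the common kernel of \<open>v\<close> and \<open>b\<close> both
    \<open>S T\<close> and \<open>S\<close> would be scalar, so \<open>T\<close> would share an
    eigenvector with \<open>S\<close>.\<close>
  have R_not: "?R \<noteq> mat x + outer a b" for x a b
  proof
    assume R: "?R = mat x + outer a b"
    obtain w where w: "w \<noteq> 0" "bdot v w = 0" "bdot b w = 0" using common_orthogonal by blast
    have "?S *v (diag3 t *v w) = x *s w"
      using w by (simp add: matrix_vector_mul_assoc R matrix_vector_mult_add_rdistrib outer_vector_mult)
    then have "?S *v (?S *v (diag3 t *v w)) = ?S *v (x *s w)" by simp
    moreover have "?S *v (?S *v (diag3 t *v w)) = e *s (diag3 t *v w)"
      using SS by (metis matrix_vector_mul_assoc mat_vector_mult)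
    moreover have "?S *v (x *s w) = (x * s) *s w"
      using Sfix[OF w(2)] by (simp add: vector_scalar_commute)
    ultimately have "e *s (diag3 t *v w) = (x * s) *s w" by simp
    then have "diag3 t *v w = (x * s / e) *s w" using e0 by (simp add: vec_eq_iff field_simps)
    then show False using no_ev[OF w(1) Sfix[OF w(2)]] by blast
  qed
  have "reflection_pair t ?S s u v"
    unfolding reflection_pair_def using s u S cube_scalar_traces[OF R3 e0 R_not] by simp
  moreover have "s^4 = (s^2)^2" by (simp flip: power_mult)
  then have "s^4 = 1" by (simp add: s e)
  ultimately show ?thesis using dist[of 1 2] dist[of 1 3] dist[of 2 3] unz vnz by auto
qed

text \<open>A matrix similar to \<open>diag(s, -s, s)\<close> is determined by its eigenvector for
  \<open>-s\<close> and the dual row of the inverse; the eigenvalues \<open>x, x w, x w^2\<close>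
  with a primitive cube root of unity \<open>w\<close> have the characteristic polynomial
  \<open>X^3 - x^3\<close>.\<close>

lemma diagonalizable_reflection_pair:
  fixes S :: "complex^3^3"
  assumes \<Phi>: "det \<Phi> \<noteq> 0" and S: "S ** \<Phi> = \<Phi> ** diag3 (vector [s, - s, s])" and s: "s \<noteq> 0"
    and \<Psi>: "det \<Psi> \<noteq> 0" and R: "(S ** diag3 t) ** \<Psi> = \<Psi> ** diag3 (vector [x, x * w, x * w^2])"
    and w: "w^2 + w + 1 = 0" and x: "x^3 = s^2"
  shows "\<exists>u v. reflection_pair t S s u v"
proof -
  obtain P where P: "\<Phi> ** P = mat 1" "P ** \<Phi> = mat 1"
    using \<Phi> by (auto simp: invertible_det_nz [symmetric] invertible_def)
  obtain Q where Q: "\<Psi> ** Q = mat 1" "Q ** \<Psi> = mat 1"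
    using \<Psi> by (auto simp: invertible_det_nz [symmetric] invertible_def)
  have w3: "w^3 = 1"
  proof -
    have "w^3 - 1 = (w - 1) * (w^2 + w + 1)" by (simp add: algebra_simps power2_eq_square power3_eq_cube)
    then show ?thesis using w by simp
  qed
  define u v :: "complex^3" where "u = (\<chi> i. \<Phi>$i$2)" "v = (\<chi> j. P$2$j)"
  have "(P ** \<Phi>)$2$2 = 1" unfolding P by (simp add: mat3_nth)
  then have vu: "bdot v u = 1" by (simp add: matrix3_mult_nth bdot_def u_v_def)
  have "S = (S ** \<Phi>) ** P" using P by (simp add: matrix_mul_assoc [symmetric])
  also have "\<dots> = mat s ** (\<Phi> ** P) - outer ((2 * s) *s u) v"
    unfolding S by (simp add: vec_eq_iff forall_3 matrix3_mult_nth diag3_nth mat3_nth outer_def u_v_def algebra_simps)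
  also have "\<dots> = mat s - outer ((2 * s) *s u) v" by (simp add: P)
  finally have S': "S = mat s - outer ((2 * s) *s u) v" .
  let ?R = "S ** diag3 t" and ?D = "diag3 (vector [x, x * w, x * w^2])"
  have RQ: "?R = (\<Psi> ** ?D) ** Q"
    using Q R by (metis matrix_mul_assoc matrix_mul_rid)
  have tr: "trace ((\<Psi> ** M) ** Q) = trace M" for M
    by (metis Q(2) trace_mul_sym matrix_mul_assoc matrix_mul_lid)
  have D2: "?D ** ?D = diag3 (vector [x^2, x^2 * w^2, x^2 * w^4])"
    by (simp add: vec_eq_iff forall_3 matrix3_mult_nth diag3_nth power2_eq_square power4_eq_xxxx mult_ac)
  have RR: "?R ** ?R = (\<Psi> ** (?D ** ?D)) ** Q"
  proof -
    have "?R ** ?R = (\<Psi> ** ?D) ** (Q ** \<Psi>) ** (?D ** Q)" unfolding RQ by (simp add: matrix_mul_assoc)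
    then show ?thesis by (simp add: Q matrix_mul_assoc)
  qed
  have "trace ?R = x * (w^2 + w + 1)"
    unfolding RQ tr by (simp add: trace_def sum_3 diag3_nth algebra_simps)
  then have t1: "trace ?R = 0" using w by simp
  have "trace (?R ** ?R) = x^2 * (w^2 + w * w^3 + 1)"
    unfolding RR tr D2 by (simp add: trace_def sum_3 diag3_nth algebra_simps power4_eq_xxxx power3_eq_cube)
  then have t2: "trace (?R ** ?R) = 0" using w w3 by simp
  have "det ?R = det \<Psi> * det ?D * det Q" unfolding RQ by (simp add: det_mul)
  also have "\<dots> = det ?D * det (\<Psi> ** Q)" by (simp add: det_mul)
  also have "\<dots> = x^3 * w^3" unfolding Q det_I by (simp add: det_3 diag3_nth power3_eq_cube power2_eq_square)
  finally have "det ?R = s^2" using x w3 by simp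
  then show ?thesis using s vu S' t1 t2 unfolding reflection_pair_def by blast
qed

section \<open>Multiplier systems\<close>

definition mult_factor :: "real \<Rightarrow> (int^2^2 \<Rightarrow> complex) \<Rightarrow> int^2^2 \<Rightarrow> complex \<Rightarrow> complex"
  where "mult_factor k \<upsilon> A z = inverse (\<upsilon> A) * aut_factor A z powr of_real (- k)"

lemma slash_eq: "slash k \<upsilon> A f z = mult_factor k \<upsilon> A z * f (moebius_act A z)"
  by (simp add: slash_def mult_factor_def)

text \<open>The rules for \<open>mat 1\<close> and for products are the slash action tested on the
  constant function 1.\<close>

lemma mult_factor_rules:
  assumes "multiplier_system k \<upsilon>"
  shows "A \<in> modular_group \<Longrightarrow> \<upsilon> A \<noteq> 0" "Im z > 0 \<Longrightarrow> mult_factor k \<upsilon> (mat 1) z = 1"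
    "A \<in> modular_group \<Longrightarrow> B \<in> modular_group \<Longrightarrow> Im z > 0 \<Longrightarrow>
      mult_factor k \<upsilon> (A ** B) z = mult_factor k \<upsilon> B z * mult_factor k \<upsilon> A (moebius_act B z)"
    "A \<in> modular_group \<Longrightarrow> Im z > 0 \<Longrightarrow> mult_factor k \<upsilon> A z \<noteq> 0"
proof -
  show 1: "\<upsilon> A \<noteq> 0" if "A \<in> modular_group" for A
    using assms that by (force simp: multiplier_system_def)
  have c: "(\<lambda>_. 1) holomorphic_on upper_half_plane" by simp
  then have s: "slash k \<upsilon> (mat 1) (\<lambda>_. 1) z = 1"
    "A \<in> modular_group \<Longrightarrow> B \<in> modular_group \<Longrightarrow>
      slash k \<upsilon> (A ** B) (\<lambda>_. 1) z = slash k \<upsilon> B (slash k \<upsilon> A (\<lambda>_. 1)) z" if "Im z > 0" for A B z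
    using assms that unfolding multiplier_system_def by auto
  show "mult_factor k \<upsilon> (mat 1) z = 1" if "Im z > 0" using s(1)[OF that] by (simp add: slash_eq)
  show "mult_factor k \<upsilon> (A ** B) z = mult_factor k \<upsilon> B z * mult_factor k \<upsilon> A (moebius_act B z)"
    if "A \<in> modular_group" "B \<in> modular_group" "Im z > 0"
    using s(2)[OF that(3,1,2)] by (simp add: slash_eq)
  show "mult_factor k \<upsilon> A z \<noteq> 0" if "A \<in> modular_group" "Im z > 0"
    using 1[OF that(1)] aut_factor_nonzero[OF that] by (simp add: mult_factor_def powr_def)
qed

lemma mult_factor_generators:
  "mult_factor k \<upsilon> T_mat z = inverse (\<upsilon> T_mat)"
  "mult_factor k \<upsilon> S_mat z = inverse (\<upsilon> S_mat) * z powr of_real (- k)"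
  by (simp_all add: mult_factor_def generators_act)

definition omega :: complex
  where "omega = cis (2 * pi / 3)"

lemma omega_rules: "Im omega > 0" "omega^2 + omega + 1 = 0" "omega + 1 = cis (pi / 3)"
  "moebius_act (S_mat ** T_mat) omega = omega"
proof -
  show im: "Im omega > 0" unfolding omega_def using sin_gt_zero[of "2 * pi / 3"] by simp
  then have "omega \<noteq> 1" by auto
  have w3: "omega^3 = 1" unfolding omega_def Complex.DeMoivre by simp
  then have "(omega - 1) * (omega^2 + omega + 1) = 0"
    by (simp add: power2_eq_square power3_eq_cube algebra_simps)
  then show w: "omega^2 + omega + 1 = 0" using \<open>omega \<noteq> 1\<close> by simp
  show "omega + 1 = cis (pi / 3)"
    by (simp add: omega_def complex_eq_iff cos_120 cos_60 sin_120 sin_60)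
  have "moebius_act (S_mat ** T_mat) omega = - 1 / (omega + 1)"
    using moebius_act_mult[of S_mat T_mat omega] im by (simp add: generators_act)
  moreover have "omega * (omega + 1) = (omega^2 + omega + 1) - 1"
    by (simp add: algebra_simps power2_eq_square)
  then have "omega * (omega + 1) = - 1" unfolding w by simp
  moreover from this have "omega + 1 \<noteq> 0" by auto
  ultimately show "moebius_act (S_mat ** T_mat) omega = omega" by (metis nonzero_mult_div_cancel_right)
qed

lemma cis_powr_real:
  assumes "- pi < t" "t \<le> pi"
  shows "cis t powr of_real x = cis (t * x)"
proof -
  have "Ln (cis t) = \<i> * of_real t"
    using assms by (intro Ln_unique) (auto simp: cis_conv_exp)
  then show ?thesis by (simp add: powr_def cis_conv_exp mult_ac)
qed

text \<open>The elliptic fixed points \<open>i\<close> of \<open>S\<close> and \<open>omega\<close> of \<open>S T\<close> evaluate the relation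
  \<open>S\<^sup>2 = (S T)\<^sup>3\<close>.\<close>

lemma multiplier_relations:
  assumes k: "multiplier_system k \<upsilon>"
  defines "s \<equiv> mult_factor k \<upsilon> S_mat \<i>" and "x \<equiv> mult_factor k \<upsilon> (S_mat ** T_mat) omega"
  shows "x^3 = s^2" "\<upsilon> T_mat ^ 12 = exp (2 * of_real pi * \<i> * of_real k)"
    "x = inverse (\<upsilon> T_mat) * mult_factor k \<upsilon> S_mat (omega + 1)"
proof -
  note J = mult_factor_rules[OF k]
  let ?R = "S_mat ** T_mat"
  have R: "?R \<in> modular_group" by (simp add: modular_group_mult)
  have "mult_factor k \<upsilon> neg_mat z = inverse (\<upsilon> neg_mat) * (- 1) powr of_real (- k)" for z
    by (simp add: mult_factor_def generators_act)
  then have const: "mult_factor k \<upsilon> neg_mat z = mult_factor k \<upsilon> neg_mat w" for z w by simp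
  have "mult_factor k \<upsilon> (S_mat ** S_mat) \<i> = s * s"
    by (subst J(3)) (auto simp: s_def generators_act)
  then have s2: "mult_factor k \<upsilon> neg_mat \<i> = s^2" by (simp add: generator_relations power2_eq_square)
  have "mult_factor k \<upsilon> (?R ** (?R ** ?R)) omega = x * x * x"
    using omega_rules(1,4) R
    by (simp add: J(3) modular_group_mult moebius_act_mult[OF R R] x_def)
  then have "mult_factor k \<upsilon> neg_mat omega = x^3" by (simp add: generator_relations power3_eq_cube)
  then show x3: "x^3 = s^2" using s2 const by metis
  show x: "x = inverse (\<upsilon> T_mat) * mult_factor k \<upsilon> S_mat (omega + 1)"
    unfolding x_def using omega_rules(1) by (subst J(3)) (auto simp: generators_act mult_factor_generators)
  have "mult_factor k \<upsilon> (neg_mat ** neg_mat) \<i> = mult_factor k \<upsilon> neg_mat \<i> * mult_factor k \<upsilon> neg_mat \<i>"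
    by (subst J(3)) (auto simp: generators_act)
  then have "s^2 * s^2 = 1" by (simp add: generator_relations J(2) s2)
  then have s4: "s^4 = 1" by (simp flip: power_add)
  have i: "\<i> powr of_real (- k) = cis (- (pi / 2 * k))"
    using cis_powr_real[of "pi / 2" "- k"] by (simp add: cis_pi_half)
  have w: "(omega + 1) powr of_real (- k) = cis (- (pi / 3 * k))"
    unfolding omega_rules(3) using cis_powr_real[of "pi / 3" "- k"] by simp
  let ?S = "\<upsilon> S_mat" and ?T = "\<upsilon> T_mat"
  have nz: "?S \<noteq> 0" "?T \<noteq> 0" by (simp_all add: J(1))
  \<comment> \<open>Three times the argument \<open>pi / 3\<close> of \<open>omega + 1\<close> and
    twice the argument \<open>pi / 2\<close> of \<open>\<i>\<close> are both \<open>pi\<close>, so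
    the real powers cancel between \<open>x^3\<close> and \<open>s^2\<close>.\<close>
  have "x^3 = inverse (?T ^ 3) * inverse (?S ^ 3) * cis (- (pi * k))"
    unfolding x mult_factor_generators w by (simp add: power_mult_distrib power_inverse Complex.DeMoivre)
  moreover have "s^2 = inverse (?S ^ 2) * cis (- (pi * k))"
    unfolding s_def mult_factor_generators i by (simp add: power_mult_distrib power_inverse Complex.DeMoivre)
  ultimately have "inverse (?T ^ 3) * inverse (?S ^ 3) = inverse (?S ^ 2)" using x3 by simp
  then have ST: "?S * ?T ^ 3 = 1" using nz by (simp add: field_simps power2_eq_square power3_eq_cube)
  have "s^4 = inverse (?S ^ 4) * cis (- (2 * pi * k))"
    unfolding s_def mult_factor_generators i by (simp add: power_mult_distrib power_inverse Complex.DeMoivre mult.assoc)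
  then have "cis (- (2 * pi * k)) = ?S ^ 4" using s4 nz by (simp add: field_simps)
  moreover have "(?S * ?T ^ 3) ^ 4 = ?S ^ 4 * ?T ^ 12" by (simp add: power_mult_distrib flip: power_mult)
  ultimately have "cis (- (2 * pi * k)) * ?T ^ 12 = 1" using ST by simp
  then have "cis (2 * pi * k) * (cis (- (2 * pi * k)) * ?T ^ 12) = cis (2 * pi * k)" by simp
  then have "?T ^ 12 = cis (2 * pi * k)" by (simp only: mult.assoc [symmetric] cis_mult) simp
  then show "?T ^ 12 = exp (2 * of_real pi * \<i> * of_real k)" by (simp add: cis_conv_exp mult_ac)
qed

lemma exp_2pi_i_eq:
  "exp (2 * of_real pi * \<i> * of_real x) = exp (2 * of_real pi * \<i> * of_real y) \<longleftrightarrow> x - y \<in> \<int>"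
proof -
  have "exp (2 * of_real pi * \<i> * of_real x) = exp (2 * of_real pi * \<i> * of_real y) \<longleftrightarrow>
    (\<exists>n::int. 2 * pi * x = 2 * pi * y + of_int (2 * n) * pi)"
    by (subst exp_eq) (simp add: complex_eq_iff)
  also have "\<dots> \<longleftrightarrow> (\<exists>n::int. x - y = of_int n)"
  proof (rule arg_cong[of _ _ Ex], rule ext)
    fix n :: int
    have "2 * pi * x = 2 * pi * y + of_int (2 * n) * pi \<longleftrightarrow> 2 * pi * (x - y - of_int n) = 0"
      by (simp add: algebra_simps)
    then show "(2 * pi * x = 2 * pi * y + of_int (2 * n) * pi) = (x - y = of_int n)" by simp
  qed
  finally show ?thesis by (auto simp: Ints_def)
qed

text \<open>The twelfth power of \<open>\<upsilon> T_mat\<close> is \<open>exp (2 pi i k)\<close>,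
  which fixes \<open>k\<close> modulo 1.\<close>

lemma multiplier_weights_diff:
  assumes "multiplier_system k \<upsilon>" "multiplier_system k' \<upsilon>"
  shows "k - k' \<in> \<int>"
  using trans[OF multiplier_relations(2)[OF assms(1), symmetric] multiplier_relations(2)[OF assms(2)]]
  by (simp only: exp_2pi_i_eq)

lemma mult_factor_shift:
  assumes "A \<in> modular_group" "Im z > 0"
  shows "mult_factor (k + of_int n) \<upsilon> A z = mult_factor k \<upsilon> A z * aut_factor A z powi (- n)"
proof -
  have nz: "aut_factor A z \<noteq> 0" by (rule aut_factor_nonzero[OF assms])
  have "of_real (- (k + of_int n)) = (of_real (- k) + of_int (- n) :: complex)" by simp
  then have "aut_factor A z powr of_real (- (k + of_int n)) =
      aut_factor A z powr of_real (- k) * aut_factor A z powr of_int (- n)"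
    by (simp only: powr_add)
  also have "aut_factor A z powr of_int (- n) = aut_factor A z powi (- n)"
    unfolding powr_of_int[OF nz] by (simp add: power_int_def power_inverse)
  finally show ?thesis by (simp add: mult_factor_def)
qed

text \<open>An integral power of \<open>aut_factor\<close> is a cocycle by itself and involves no
  branch of the argument.\<close>

lemma multiplier_system_shift:
  assumes k: "multiplier_system k \<upsilon>"
  shows "multiplier_system (k + of_int n) \<upsilon>"
proof -
  note J = mult_factor_rules[OF k]
  have s: "slash (k + of_int n) \<upsilon> A f z = aut_factor A z powi (- n) * slash k \<upsilon> A f z"
    if "A \<in> modular_group" "Im z > 0" for A f z
    using that by (simp add: slash_eq mult_factor_shift)
  have aut_holo: "aut_factor A holomorphic_on upper_half_plane" for A
    unfolding aut_factor_def[abs_def] by (intro holomorphic_intros)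
  show ?thesis
    unfolding multiplier_system_def
  proof (intro conjI ballI allI impI)
    show "norm (\<upsilon> A) = 1" if "A \<in> modular_group" for A using k that by (simp add: multiplier_system_def)
    fix f assume f: "f holomorphic_on upper_half_plane"
    show "slash (k + of_int n) \<upsilon> A f holomorphic_on upper_half_plane" if A: "A \<in> modular_group" for A
    proof -
      have "slash k \<upsilon> A f holomorphic_on upper_half_plane"
        using k f A by (simp add: multiplier_system_def)
      then have "(\<lambda>z. aut_factor A z powi (- n) * slash k \<upsilon> A f z) holomorphic_on upper_half_plane"
        using aut_factor_nonzero[OF A] by (intro holomorphic_intros aut_holo) auto
      then show ?thesis by (rule holomorphic_transform) (use s[OF A] in auto)
    qed
    fix z assume "z \<in> upper_half_plane"
    then have z: "Im z > 0" by simp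
    show "slash (k + of_int n) \<upsilon> (mat 1) f z = f z"
      using z by (simp add: slash_eq mult_factor_shift J(2) generators_act)
    fix A B assume AB: "A \<in> modular_group" "B \<in> modular_group"
    show "slash (k + of_int n) \<upsilon> (A ** B) f z = slash (k + of_int n) \<upsilon> B (slash (k + of_int n) \<upsilon> A f) z"
      using AB z
      by (simp add: slash_eq mult_factor_shift modular_group_mult moebius_act_upper J(3)
          moebius_act_mult aut_factor_mult power_int_mult_distrib)
  qed
qed

text \<open>\<open>Arg2pi\<close> provides the value, and two candidates in [0, 12) differ by a
  multiple of 12; this resolves the definite description.\<close>

lemma cusp_parameter_rule:
  assumes "norm (\<upsilon> T_mat) = 1"
  shows "\<upsilon> T_mat = exp (2 * of_real pi * \<i> * of_real (cusp_parameter \<upsilon> / 12))"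
proof -
  have "\<exists>!m. 0 \<le> m \<and> m < 12 \<and> \<upsilon> T_mat = exp (2 * of_real pi * \<i> * of_real m / 12)"
  proof (rule ex_ex1I)
    define m where "m = 6 * Arg2pi (\<upsilon> T_mat) / pi"
    have "\<upsilon> T_mat = exp (\<i> * of_real (Arg2pi (\<upsilon> T_mat)))"
      using Arg2pi_eq[of "\<upsilon> T_mat"] assms by simp
    also have "\<i> * of_real (Arg2pi (\<upsilon> T_mat)) = 2 * of_real pi * \<i> * of_real m / 12"
      by (simp add: m_def)
    finally have e: "\<upsilon> T_mat = exp (2 * of_real pi * \<i> * of_real m / 12)" .
    have "0 \<le> m" "m < 12"
      using Arg2pi_ge_0[of "\<upsilon> T_mat"] Arg2pi_lt_2pi[of "\<upsilon> T_mat"] by (auto simp: m_def field_simps)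
    then show "\<exists>m. 0 \<le> m \<and> m < 12 \<and> \<upsilon> T_mat = exp (2 * of_real pi * \<i> * of_real m / 12)" using e by blast
    fix m n :: real
    assume m: "0 \<le> m \<and> m < 12 \<and> \<upsilon> T_mat = exp (2 * of_real pi * \<i> * of_real m / 12)"
      and n: "0 \<le> n \<and> n < 12 \<and> \<upsilon> T_mat = exp (2 * of_real pi * \<i> * of_real n / 12)"
    then have "exp (2 * of_real pi * \<i> * of_real (m / 12)) = exp (2 * of_real pi * \<i> * of_real (n / 12))" by simp
    then have "m / 12 - n / 12 \<in> \<int>" by (simp only: exp_2pi_i_eq)
    then obtain i :: int where i: "m / 12 - n / 12 = of_int i" by (auto elim: Ints_cases)
    have "\<bar>m / 12 - n / 12\<bar> < 1" using m n by auto
    then have "i = 0" unfolding i by simp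
    then show "m = n" using i by simp
  qed
  from theI'[OF this] show ?thesis by (simp add: cusp_parameter_def)
qed

section \<open>Expansion at the cusp and forms of negative weight\<close>

lemma periodic_int:
  assumes per: "\<And>z. Im z > 0 \<Longrightarrow> f (z + 1) = f z" and "Im z > 0"
  shows "f (z + of_int n) = f z"
proof (induction n rule: int_induct[where k = 0])
  case base
  then show ?case by simp
next
  case (step1 i)
  then show ?case using per[of "z + of_int i"] assms(2) by (simp add: add.assoc)
next
  case (step2 i)
  then show ?case using per[of "z + of_int (i - 1)"] assms(2) by (simp add: algebra_simps)
qed

text \<open>The periodic function descends to the punctured disc, and growth slower than that of
  \<open>1 / q\<close> makes the singularity at 0 removable.\<close>

lemma cusp_extension:
  assumes f: "f holomorphic_on upper_half_plane" and per: "\<And>z. Im z > 0 \<Longrightarrow> f (z + 1) = f z"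
    and growth: "\<And>e. e > 0 \<Longrightarrow> \<exists>Y. \<forall>z. Im z > Y \<longrightarrow> norm (qexp z * f z) < e"
  shows "\<exists>g. g holomorphic_on ball 0 1 \<and> (\<forall>z. Im z > 0 \<longrightarrow> f z = g (qexp z))"
proof -
  define c where "c = 2 * of_real pi * \<i>"
  have c: "c \<noteq> 0" by (simp add: c_def)
  have qc: "qexp z = exp (c * z)" for z by (simp add: qexp_def c_def)
  have im: "Im (u / c) > 0" if "norm (exp u) < 1" for u
  proof -
    have "Re u < 0" using that by simp
    moreover have "Im (u / c) = - Re u / (2 * pi)"
      by (simp add: c_def Im_divide power2_eq_square field_simps)
    ultimately show ?thesis by (simp add: divide_neg_pos)
  qed
  define h where "h w = f (Ln w / c)" for w
  have eq: "h w = f (u / c)" if "exp u = w" "norm w < 1" for u w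
  proof -
    have w0: "w \<noteq> 0" using that by auto
    have "exp (Ln w) = exp u" using w0 that by simp
    then obtain n :: int where n: "Ln w = u + of_int (2 * n) * of_real pi * \<i>" by (auto simp: exp_eq)
    have "Ln w / c = u / c + of_int n" unfolding n using c by (simp add: c_def field_simps)
    moreover have "Im (u / c) > 0" by (rule im) (use that in simp)
    ultimately show ?thesis using periodic_int[of f "u / c" n, OF per] by (simp add: h_def)
  qed
  have h: "h (qexp z) = f z" if "Im z > 0" for z
    using eq[of "c * z" "qexp z"] norm_qexp_less_1[OF that] c by (simp add: qc)
  have holo: "h holomorphic_on ball 0 1 - {0}"
  proof -
    have "h field_differentiable (at w)" if w: "w \<in> ball 0 1 - {0}" for w
    proof -
      \<comment> \<open>The principal logarithm jumps on the negative axis. On a small disc without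
        0 some branch is holomorphic, and \<open>eq\<close> shows that \<open>h\<close> is
        independent of the branch.\<close>
      define U where "U = ball w (min (norm w) (1 - norm w))"
      have U: "w \<in> U" "open U" "convex U" using w by (auto simp: U_def)
      have U0: "v \<noteq> 0" "norm v < 1" if "v \<in> U" for v
      proof -
        have d: "dist w v < norm w" "dist w v < 1 - norm w" using that by (auto simp: U_def)
        show "v \<noteq> 0" using d(1) by auto
        have "norm v \<le> norm w + dist w v" using norm_triangle_ineq2[of v w] by (simp add: dist_norm norm_minus_commute)
        then show "norm v < 1" using d(2) by simp
      qed
      obtain L where L: "L holomorphic_on U" "\<And>v. v \<in> U \<Longrightarrow> v = exp (L v)"
        using contractible_imp_holomorphic_log[of "\<lambda>v. v" U] U U0(1) convex_imp_contractible by auto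
      have "(f \<circ> (\<lambda>v. L v / c)) holomorphic_on U"
      proof (rule holomorphic_on_compose_gen[OF _ f])
        show "(\<lambda>v. L v / c) holomorphic_on U" using c by (intro holomorphic_intros L) auto
        show "(\<lambda>v. L v / c) ` U \<subseteq> upper_half_plane"
        proof safe
          fix v assume v: "v \<in> U"
          have "norm (exp (L v)) < 1" using U0(2)[OF v] L(2)[OF v] by simp
          from im[OF this] show "L v / c \<in> upper_half_plane" by simp
        qed
      qed
      then have "h holomorphic_on U"
      proof (rule holomorphic_transform)
        fix v assume v: "v \<in> U"
        show "(f \<circ> (\<lambda>v. L v / c)) v = h v"
          using eq[OF L(2)[OF v, symmetric] U0(2)[OF v]] by simp
      qed
      then show ?thesis using U holomorphic_on_imp_differentiable_at by blast
    qed
    then show ?thesis by (simp add: holomorphic_on_def field_differentiable_at_within)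
  qed
  have lim: "((\<lambda>z. (z - 0) * h z) \<longlongrightarrow> 0) (at 0)"
  proof (rule tendstoI)
    fix e :: real assume "e > 0"
    from growth[OF this] obtain Y where Y: "\<And>z. Im z > Y \<Longrightarrow> norm (qexp z * f z) < e" by blast
    define d where "d = exp (- (2 * pi * max Y 1))"
    have d: "d > 0" "d < 1" by (auto simp: d_def)
    have "dist ((w - 0) * h w) 0 < e" if "w \<noteq> 0" "norm w < d" for w
    proof -
      define z where "z = Ln w / c"
      have wz: "w = qexp z" using that c by (simp add: z_def qc)
      have "exp (- (2 * pi * Im z)) < exp (- (2 * pi * max Y 1))"
        using that(2) unfolding wz norm_qexp d_def .
      then have "Im z > max Y 1" by simp
      then show ?thesis using Y[of z] h[of z] by (simp add: wz)
    qed
    then show "\<forall>\<^sub>F w in at 0. dist ((w - 0) * h w) 0 < e"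
      unfolding eventually_at using d(1) by (intro exI[of _ d]) (auto simp: dist_norm)
  qed
  obtain g where g: "g holomorphic_on ball 0 1" "\<And>z. z \<in> ball 0 1 - {0} \<Longrightarrow> g z = h z"
    using holomorphic_on_extend_lim[OF holo, of] lim by auto
  have "f z = g (qexp z)" if "Im z > 0" for z
    using g(2)[of "qexp z"] h[OF that] norm_qexp_less_1[OF that] by simp
  then show ?thesis using g(1) by blast
qed

text \<open>For negative weight the invariant function \<open>\<bar>f z\<bar> (Im z) powr (- m / 2)\<close> is bounded, so \<open>f\<close> tends to
  \<open>0\<close> as \<open>\<bar>q\<bar>\<close> tends to \<open>1\<close>.\<close>

lemma negative_weight_zero:
  fixes m :: nat
  assumes m: "m > 0" and f: "f holomorphic_on upper_half_plane"
    and bounded: "\<exists>Y B. \<forall>z. Im z > Y \<longrightarrow> norm (f z) \<le> B"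
    and inv: "\<And>A z. A \<in> modular_group \<Longrightarrow> Im z > 0 \<Longrightarrow> f z = aut_factor A z ^ m * f (moebius_act A z)"
    and z: "Im z > 0"
  shows "f z = 0"
proof -
  have per: "f (z + 1) = f z" if "Im z > 0" for z
    using inv[OF modular_group_generators(3) that] by (simp add: generators_act)
  have growth: "\<exists>Y. \<forall>z. Im z > Y \<longrightarrow> norm (qexp z * f z) < e" if e: "e > 0" for e
  proof -
    obtain Y B where B: "\<And>z. Im z > Y \<Longrightarrow> norm (f z) \<le> B" using bounded by blast
    define C where "C = max B 1"
    define X where "X = max Y (- ln (e / C) / (2 * pi))"
    have "norm (qexp z * f z) < e" if "Im z > X" for z
    proof -
      have C: "C > 0" "norm (f z) \<le> C" using B[of z] that by (auto simp: C_def X_def)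
      have "- ln (e / C) / (2 * pi) < Im z" using that by (simp add: X_def)
      then have "- (2 * pi * Im z) < ln (e / C)" by (simp add: field_simps)
      then have "exp (- (2 * pi * Im z)) < exp (ln (e / C))" by (simp only: exp_less_cancel_iff)
      then have q: "norm (qexp z) < e / C" using C(1) e by (simp add: norm_qexp)
      have "norm (qexp z * f z) \<le> norm (qexp z) * C" using C(2) by (simp add: norm_mult mult_left_mono)
      also have "\<dots> < e" using q C(1) by (simp add: field_simps)
      finally show ?thesis .
    qed
    then show ?thesis by blast
  qed
  obtain g where g: "g holomorphic_on ball 0 1" "\<And>z. Im z > 0 \<Longrightarrow> f z = g (qexp z)"
    using cusp_extension[OF f per growth] by blast
  obtain B where B: "\<And>z. Im z \<ge> 1 / 2 \<Longrightarrow> norm (f z) \<le> B"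
    using cusp_bounded[OF g, of "1/2"] by auto
  have B0: "B \<ge> 0" using order_trans[OF norm_ge_zero B[of \<i>]] by simp
  \<comment> \<open>Moving \<open>z\<close> up to height at least 1/2 costs a factor
    \<open>|c z + d|^m\<close>, and \<open>|c z + d|^2 \<le> 2 Im z\<close>.\<close>
  have bound: "norm (f z) ^ 2 \<le> (2 * Im z) ^ m * B ^ 2" if z: "Im z > 0" for z
  proof -
    obtain A where A: "A \<in> modular_group" "Im (moebius_act A z) \<ge> 1 / 2"
      using exists_moebius_act_Im_ge[OF z] by blast
    have n0: "norm (aut_factor A z)^2 > 0" using aut_factor_nonzero[OF A(1) z] by simp
    have "1 / 2 \<le> Im z / norm (aut_factor A z)^2" using A(2) unfolding Im_moebius_act[OF A(1)] .
    then have a: "norm (aut_factor A z)^2 \<le> 2 * Im z" using n0 by (simp add: field_simps)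
    have "norm (f z)^2 = (norm (aut_factor A z)^2) ^ m * norm (f (moebius_act A z))^2"
      unfolding inv[OF A(1) z] norm_mult norm_power power_mult_distrib
      by (simp add: mult.commute flip: power_mult)
    also have "\<dots> \<le> (2 * Im z) ^ m * B ^ 2"
      using a B[OF A(2)] B0 z by (intro mult_mono power_mono) auto
    finally show ?thesis .
  qed
  \<comment> \<open>The circle of radius \<open>exp (- 1 / n)\<close> is the horizontal line at
    height \<open>1 / (2 pi n)\<close>.\<close>
  have bound_g: "norm (g w) \<le> sqrt ((1 / (pi * real n)) ^ m * B^2)"
    if n: "n > 0" and w: "norm w = exp (- (1 / real n))" for w n
  proof -
    have w0: "w \<noteq> 0" using w by auto
    define z where "z = Ln w / (2 * of_real pi * \<i>)"
    have wz: "w = qexp z" using w0 by (simp add: z_def qexp_def)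
    have "- (2 * pi * Im z) = - (1 / real n)" using w unfolding wz norm_qexp by simp
    then have iz: "2 * Im z = 1 / (pi * real n)" using n by (simp add: field_simps)
    then have "2 * Im z > 0" using n by simp
    then have "Im z > 0" by simp
    from bound[OF this] have "norm (g w)^2 \<le> (1 / (pi * real n)) ^ m * B^2"
      unfolding iz g(2)[OF \<open>Im z > 0\<close>] wz .
    then show ?thesis by (rule real_le_rsqrt)
  qed
  have "g w = 0" if w: "norm w < 1" for w
  proof -
    have "(\<lambda>n. sqrt ((1 / (pi * real n)) ^ m * B^2)) \<longlonglongrightarrow> sqrt (0 ^ m * B^2)"
    proof (intro tendsto_intros)
      have "(\<lambda>n. 1 / pi * (1 / real n)) \<longlonglongrightarrow> 1 / pi * 0" by (intro tendsto_intros lim_1_over_n)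
      then show "(\<lambda>n. 1 / (pi * real n)) \<longlonglongrightarrow> 0" by simp
    qed
    then have lim: "(\<lambda>n. sqrt ((1 / (pi * real n)) ^ m * B^2)) \<longlonglongrightarrow> 0" using m by (simp add: power_0_left)
    have "(\<lambda>n. exp (- (1 / real n))) \<longlonglongrightarrow> exp (- 0)" by (intro tendsto_intros lim_1_over_n)
    then have "\<forall>\<^sub>F n in sequentially. norm w < exp (- (1 / real n))"
      by (intro order_tendstoD) (use w in auto)
    then have ev: "\<forall>\<^sub>F n in sequentially. norm (g w) \<le> sqrt ((1 / (pi * real n)) ^ m * B^2)"
      using eventually_gt_at_top[of 0]
    proof eventually_elim
      case (elim n)
      let ?r = "exp (- (1 / real n))"
      have r: "?r < 1" using elim(2) by simp
      have sub: "cball (0::complex) ?r \<subseteq> ball 0 1" using r by (simp add: cball_subset_ball_iff)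
      \<comment> \<open>By the maximum principle the bound on the circle holds inside it, and it
        tends to 0 as \<open>n\<close> grows because \<open>m > 0\<close>.\<close>
      show ?case
      proof (rule maximum_modulus_frontier[of g "ball 0 ?r"])
        show "g holomorphic_on interior (ball 0 ?r)"
          using holomorphic_on_subset[OF g(1)] sub ball_subset_cball by (metis interior_ball subset_trans)
        show "continuous_on (closure (ball 0 ?r)) g"
          using continuous_on_subset[OF holomorphic_on_imp_continuous_on[OF g(1)] sub] by simp
        show "norm (g v) \<le> sqrt ((1 / (pi * real n)) ^ m * B^2)" if "v \<in> frontier (ball 0 ?r)" for v
          using that by (intro bound_g elim) auto
      qed (use elim in auto)
    qed
    have "norm (g w) \<le> 0" by (rule tendsto_lowerbound[OF lim ev]) simp
    then show ?thesis by simp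
  qed
  then show ?thesis using g(2)[OF z] norm_qexp_less_1[OF z] by simp
qed

section \<open>The modular differential equation\<close>

lemma mod_deriv_iter_holomorphic:
  "f holomorphic_on upper_half_plane \<Longrightarrow> mod_deriv_iter k n f holomorphic_on upper_half_plane"
  by (induction n) auto

lemma mod_deriv_iter_cong:
  assumes "\<And>z. Im z > 0 \<Longrightarrow> f z = g z"
  shows "Im z > 0 \<Longrightarrow> mod_deriv_iter k n f z = mod_deriv_iter k n g z"
proof (induction n arbitrary: z)
  case (Suc n)
  from mod_deriv_cong[of "mod_deriv_iter k n f" "mod_deriv_iter k n g", OF Suc.IH]
  show ?case by simp
qed (use assms in auto)

lemma mod_deriv_iter_linear:
  assumes "finite I" "\<And>i. i \<in> I \<Longrightarrow> f i holomorphic_on upper_half_plane"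
  shows "mod_deriv_iter k n (\<lambda>z. \<Sum>i\<in>I. c i * f i z) = (\<lambda>z. \<Sum>i\<in>I. c i * mod_deriv_iter k n (f i) z)"
proof (induction n)
  case (Suc n)
  then show ?case
    using mod_deriv_linear[OF assms(1), of "\<lambda>i. mod_deriv_iter k n (f i)"]
      mod_deriv_iter_holomorphic assms(2) by simp
qed simp

lemma mod_deriv_iter_inversion:
  assumes f: "f holomorphic_on upper_half_plane"
  shows "Im z > 0 \<Longrightarrow> mod_deriv_iter k n (\<lambda>z. z powr of_real (- k) * f (- 1 / z)) z =
    z powr of_real (- (k + 2 * real n)) * mod_deriv_iter k n f (- 1 / z)"
proof (induction n arbitrary: z)
  case (Suc n)
  from mod_deriv_cong[of "mod_deriv_iter k n (\<lambda>z. z powr of_real (- k) * f (- 1 / z))", OF Suc.IH]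
  show ?case
    using mod_deriv_inversion[OF mod_deriv_iter_holomorphic[OF f] Suc.prems, of "k + 2 * real n"]
    by (simp add: algebra_simps)
qed simp

primrec fps_mod_deriv_iter :: "real \<Rightarrow> real \<Rightarrow> nat \<Rightarrow> complex fps \<Rightarrow> complex fps"
  where
    "fps_mod_deriv_iter l k 0 A = A"
  | "fps_mod_deriv_iter l k (Suc n) A = fps_mod_deriv l (k + 2 * real n) (fps_mod_deriv_iter l k n A)"

lemma disc_fps_mod_deriv_iter: "disc_fps A \<Longrightarrow> disc_fps (fps_mod_deriv_iter l k n A)"
  by (induction n) auto

lemma mod_deriv_iter_qform:
  "disc_fps A \<Longrightarrow> mod_deriv_iter k n (qform l A) = qform l (fps_mod_deriv_iter l k n A)"
  by (induction n) (auto simp: mod_deriv_qform disc_fps_mod_deriv_iter)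

definition mmde_solution :: "real \<Rightarrow> complex \<Rightarrow> complex \<Rightarrow> (complex \<Rightarrow> complex) \<Rightarrow> bool"
  where "mmde_solution k a b f \<longleftrightarrow> f holomorphic_on upper_half_plane \<and>
    (\<forall>z. Im z > 0 \<longrightarrow> mod_deriv_iter k 3 f z + a * E4 z * mod_deriv_iter k 1 f z + b * E6 z * f z = 0)"

lemma mod_deriv_DERIV:
  assumes "f holomorphic_on upper_half_plane" "Im z > 0"
  shows "(f has_field_derivative 2 * of_real pi * \<i> * (mod_deriv k f z + of_real (k / 12) * E2 z * f z)) (at z)"
  using holomorphic_upper_half_planeD[OF assms] assms(2) by (simp add: mod_deriv_def)

text \<open>The equation as a first order linear system for \<open>f, D f, D^2 f\<close>; its
  diagonal consists of multiples of \<open>E2\<close>.\<close>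

lemma mmde_solution_companion:
  assumes "mmde_solution k a b f" "Im z > 0"
  defines "c \<equiv> 2 * of_real pi * \<i>" and "y \<equiv> \<lambda>n. mod_deriv_iter k n f"
  shows "(y 0 has_field_derivative c * (y 1 z + of_real (k / 12) * E2 z * y 0 z)) (at z)"
    "(y 1 has_field_derivative c * (y 2 z + of_real ((k + 2) / 12) * E2 z * y 1 z)) (at z)"
    "(y 2 has_field_derivative c * (- (a * E4 z * y 1 z) - b * E6 z * y 0 z + of_real ((k + 4) / 12) * E2 z * y 2 z)) (at z)"
proof -
  have f: "f holomorphic_on upper_half_plane" using assms(1) by (simp add: mmde_solution_def)
  have d: "(y n has_field_derivative c * (y (Suc n) z + of_real ((k + 2 * real n) / 12) * E2 z * y n z)) (at z)" for n
    unfolding y_def c_def mod_deriv_iter.simps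
    by (rule mod_deriv_DERIV[OF mod_deriv_iter_holomorphic[OF f] assms(2)])
  show "(y 0 has_field_derivative c * (y 1 z + of_real (k / 12) * E2 z * y 0 z)) (at z)"
    "(y 1 has_field_derivative c * (y 2 z + of_real ((k + 2) / 12) * E2 z * y 1 z)) (at z)"
    using d[of 0] d[of 1] by (simp_all add: numeral_2_eq_2 del: mod_deriv_iter.simps)
  have "y 3 z = - (a * E4 z * y 1 z) - b * E6 z * y 0 z"
    using assms(1,2) unfolding mmde_solution_def y_def
    by (simp add: eq_neg_iff_add_eq_0 algebra_simps del: mod_deriv_iter.simps(2))
  then show "(y 2 has_field_derivative c * (- (a * E4 z * y 1 z) - b * E6 z * y 0 z + of_real ((k + 4) / 12) * E2 z * y 2 z)) (at z)"
    using d[of 2] by (simp add: numeral_3_eq_3 numeral_2_eq_2 del: mod_deriv_iter.simps)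
qed

lemma det_holomorphic:
  fixes M :: "complex \<Rightarrow> complex^3^3"
  assumes "\<And>i j. (\<lambda>z. M z $ i $ j) holomorphic_on S"
  shows "(\<lambda>z. det (M z)) holomorphic_on S"
  unfolding det_3 by (intro holomorphic_intros assms)

text \<open>Every term of the determinant takes one entry from each row, so the row bounds multiply;
  six is the number of terms.\<close>

lemma norm_det_le:
  fixes M :: "complex^3^3"
  assumes "\<And>i j. norm (M $ i $ j) \<le> C * r i" and "C \<ge> 0" and "\<And>i. r i \<ge> 0"
  shows "norm (det M) \<le> 6 * C^3 * (r 1 * r 2 * r 3)"
proof -
  have t: "norm (M $ 1 $ i * M $ 2 $ j * M $ 3 $ m) \<le> C^3 * (r 1 * r 2 * r 3)" for i j m
  proof -
    have "norm (M $ 1 $ i) * norm (M $ 2 $ j) * norm (M $ 3 $ m) \<le> (C * r 1) * (C * r 2) * (C * r 3)"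
      using assms(2,3) by (intro mult_mono assms(1)) auto
    then show ?thesis by (simp add: norm_mult power3_eq_cube mult_ac)
  qed
  define x1 x2 x3 x4 x5 x6 where x: "x1 = M$1$1 * M$2$2 * M$3$3" "x2 = M$1$2 * M$2$3 * M$3$1"
    "x3 = M$1$3 * M$2$1 * M$3$2" "x4 = M$1$1 * M$2$3 * M$3$2" "x5 = M$1$2 * M$2$1 * M$3$3" "x6 = M$1$3 * M$2$2 * M$3$1"
  have "norm (det M) = norm (x1 + x2 + x3 - x4 - x5 - x6)" by (simp add: det_3 x)
  also have "\<dots> \<le> norm x1 + norm x2 + norm x3 + norm x4 + norm x5 + norm x6"
    by (intro order_trans[OF norm_triangle_ineq4] add_right_mono order_trans[OF norm_triangle_ineq]) auto
  also have "\<dots> \<le> C^3 * (r 1 * r 2 * r 3) + C^3 * (r 1 * r 2 * r 3) + C^3 * (r 1 * r 2 * r 3)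
     + C^3 * (r 1 * r 2 * r 3) + C^3 * (r 1 * r 2 * r 3) + C^3 * (r 1 * r 2 * r 3)"
    unfolding x by (intro add_mono t)
  finally show ?thesis by (simp add: mult_ac)
qed

text \<open>Leading coefficients are arbitrary nonzero numbers, because the solutions are later
  rescaled to match the representation; the locale serves the bases before and after.\<close>

locale mmde_system =
  fixes l :: "real^3" and k :: real and a b :: complex and A :: "3 \<Rightarrow> complex fps"
  assumes l_range: "0 \<le> l$j" "l$j < 1" and l_distinct: "i \<noteq> j \<Longrightarrow> l$i \<noteq> l$j"
    and k_eq: "k = 4 * (l$1 + l$2 + l$3) - 2"
    and disc_A: "disc_fps (A j)" and A_0: "fps_nth (A j) 0 \<noteq> 0"
    and A_mmde: "fps_mmde (l$j) k a b (A j) = 0"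
begin

definition sol :: "3 \<Rightarrow> complex \<Rightarrow> complex"
  where "sol j = qform (l$j) (A j)"

definition dsol :: "nat \<Rightarrow> 3 \<Rightarrow> complex \<Rightarrow> complex"
  where "dsol n j = mod_deriv_iter k n (sol j)"

definition dA :: "nat \<Rightarrow> 3 \<Rightarrow> complex fps"
  where "dA n j = fps_mod_deriv_iter (l$j) k n (A j)"

lemma disc_dA: "disc_fps (dA n j)"
  unfolding dA_def by (rule disc_fps_mod_deriv_iter[OF disc_A])

lemma dsol_eq: "dsol n j = qform (l$j) (dA n j)"
  by (simp add: dsol_def sol_def dA_def mod_deriv_iter_qform[OF disc_A])

lemma dsol_holomorphic: "dsol n j holomorphic_on upper_half_plane"
  unfolding dsol_eq by (rule qform_holomorphic[OF disc_dA])

lemma dsol_0: "dsol 0 = sol"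
  by (simp add: dsol_def fun_eq_iff)

lemma sol_holomorphic: "sol j holomorphic_on upper_half_plane"
  using dsol_holomorphic[of 0 j] by (simp add: dsol_0)

lemma sol_solution: "mmde_solution k a b (sol j)"
  unfolding mmde_solution_def
proof (intro conjI allI impI sol_holomorphic)
  fix z assume z: "Im z > 0"
  have d: "disc_fps (A j)" "disc_fps (dA 1 j)" "disc_fps (dA 3 j)" by (simp_all add: disc_A disc_dA)
  have "mod_deriv_iter k 3 (sol j) z + a * E4 z * mod_deriv_iter k 1 (sol j) z + b * E6 z * sol j z =
     qpow (l$j) z * qfun (dA 3 j + fps_const a * E4_fps * dA 1 j + fps_const b * E6_fps * A j) z"
    using z d unfolding dsol_def[symmetric] dsol_eq
    by (simp add: qform_def sol_def E4_def E6_def qfun_arith algebra_simps)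
  also have "dA 3 j + fps_const a * E4_fps * dA 1 j + fps_const b * E6_fps * A j = fps_mmde (l$j) k a b (A j)"
    by (simp add: dA_def fps_mmde_def numeral_3_eq_3)
  finally show "mod_deriv_iter k 3 (sol j) z + a * E4 z * mod_deriv_iter k 1 (sol j) z + b * E6 z * sol j z = 0"
    by (simp add: A_mmde)
qed

text \<open>Solutions index the rows, so that the matrices of the group act from the left and the
  columns become eigenvectors at the elliptic points.\<close>

definition sol_matrix :: "complex \<Rightarrow> complex^3^3"
  where "sol_matrix z = (\<chi> j. vector [dsol 0 j z, dsol 1 j z, dsol 2 j z])"

lemma sol_matrix_nth [simp]:
  "sol_matrix z $ j $ 1 = dsol 0 j z" "sol_matrix z $ j $ 2 = dsol 1 j z" "sol_matrix z $ j $ 3 = dsol 2 j z"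
  by (simp_all add: sol_matrix_def)

lemma sol_matrix_holomorphic: "(\<lambda>z. sol_matrix z $ i $ j) holomorphic_on upper_half_plane"
  using exhaust_3[of j] dsol_holomorphic by auto

definition wronskian :: "complex \<Rightarrow> complex"
  where "wronskian z = det (sol_matrix z)"

lemma wronskian_holomorphic: "wronskian holomorphic_on upper_half_plane"
  unfolding wronskian_def[abs_def] by (intro det_holomorphic sol_matrix_holomorphic)

lemma dsol_companion:
  assumes "Im z > 0"
  defines "c \<equiv> 2 * of_real pi * \<i>"
  shows "(dsol 0 j has_field_derivative c * (dsol 1 j z + of_real (k / 12) * E2 z * dsol 0 j z)) (at z)"
    "(dsol 1 j has_field_derivative c * (dsol 2 j z + of_real ((k + 2) / 12) * E2 z * dsol 1 j z)) (at z)"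
    "(dsol 2 j has_field_derivative c * (- (a * E4 z * dsol 1 j z) - b * E6 z * dsol 0 j z + of_real ((k + 4) / 12) * E2 z * dsol 2 j z)) (at z)"
  unfolding dsol_def c_def by (rule mmde_solution_companion[OF sol_solution assms(1)])+

text \<open>The equation has no term of second order, so the logarithmic derivative of the Wronskian is
  a multiple of \<open>E2\<close>.\<close>

lemma wronskian_deriv:
  assumes z: "Im z > 0"
  shows "(wronskian has_field_derivative 2 * of_real pi * \<i> * of_real (l$1 + l$2 + l$3) * E2 z * wronskian z) (at z)"
proof -
  define c where "c = 2 * of_real pi * \<i>"
  note d = dsol_companion[OF z, folded c_def]
  have w: "wronskian = (\<lambda>z. dsol 0 1 z * dsol 1 2 z * dsol 2 3 z + dsol 1 1 z * dsol 2 2 z * dsol 0 3 z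
     + dsol 2 1 z * dsol 0 2 z * dsol 1 3 z - dsol 0 1 z * dsol 2 2 z * dsol 1 3 z
     - dsol 1 1 z * dsol 0 2 z * dsol 2 3 z - dsol 2 1 z * dsol 1 2 z * dsol 0 3 z)"
    by (simp add: fun_eq_iff wronskian_def det_3)
  \<comment> \<open>The diagonal entries of the system belong to the weights \<open>k\<close>,
    \<open>k + 2\<close>, \<open>k + 4\<close>; the value of \<open>k\<close> makes their twelfths
    add up to the sum of the exponents.\<close>
  have "l$1 + l$2 + l$3 = k / 12 + (k + 2) / 12 + (k + 4) / 12"
    by (simp add: k_eq field_simps)
  then have "of_real (l$1 + l$2 + l$3) = (of_real (k / 12) + of_real ((k + 2) / 12) + of_real ((k + 4) / 12) :: complex)"
    by (simp only: of_real_add)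
  then have e: "2 * of_real pi * \<i> * of_real (l$1 + l$2 + l$3) * E2 z * wronskian z =
      c * (of_real (k / 12) + of_real ((k + 2) / 12) + of_real ((k + 4) / 12)) * E2 z * wronskian z"
    by (simp add: c_def)
  have t: "((\<lambda>z. f z * g z * h z) has_field_derivative (f' * g z + g' * f z) * h z + h' * (f z * g z)) (at z)"
    if "(f has_field_derivative f') (at z)" "(g has_field_derivative g') (at z)" "(h has_field_derivative h') (at z)"
    for f g h :: "complex \<Rightarrow> complex" and f' g' h'
    by (intro DERIV_mult that)
  note D = DERIV_diff[OF DERIV_diff[OF DERIV_diff[OF DERIV_add[OF DERIV_add[OF
    t[OF d(1)[of 1] d(2)[of 2] d(3)[of 3]] t[OF d(2)[of 1] d(3)[of 2] d(1)[of 3]]]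
    t[OF d(3)[of 1] d(1)[of 2] d(2)[of 3]]] t[OF d(1)[of 1] d(3)[of 2] d(2)[of 3]]]
    t[OF d(2)[of 1] d(1)[of 2] d(3)[of 3]]] t[OF d(3)[of 1] d(2)[of 2] d(1)[of 3]]]
  define \<mu>1 \<mu>2 \<mu>3 :: complex where "\<mu>1 = of_real (k / 12)" "\<mu>2 = of_real ((k + 2) / 12)" "\<mu>3 = of_real ((k + 4) / 12)"
  note \<mu> = \<mu>1_\<mu>2_\<mu>3_def[symmetric]
  show ?thesis
    unfolding e unfolding w \<mu> by (rule DERIV_cong[OF D[unfolded \<mu>]]) (simp add: algebra_simps)
qed

lemma wronskian_eq:
  assumes z: "Im z > 0"
  shows "wronskian z = qpow (l$1 + l$2 + l$3) z *
    qfun (det (\<chi> j. vector [dA 0 j, dA 1 j, dA 2 j])) z"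
  using z disc_dA
  by (simp add: wronskian_def det_3 dsol_eq qform_def qfun_arith qpow_add algebra_simps)

text \<open>The leading coefficients form a Vandermonde determinant in \<open>l_j - k / 12\<close>,
  and the exponents are distinct.\<close>

lemma wronskian_series:
  defines "w \<equiv> det (\<chi> j. vector [dA 0 j, dA 1 j, dA 2 j] :: complex fps^3^3)"
  shows "disc_fps w" "fps_nth w 0 \<noteq> 0"
proof -
  show "disc_fps w" unfolding w_def det_3 by (simp add: disc_dA)
  define m p where "m j = (of_real (l$j - k / 12) :: complex)" "p j = fps_nth (A j) 0" for j
  have d0: "fps_nth (dA 0 j) 0 = p j" "fps_nth (dA 1 j) 0 = m j * p j"
    "fps_nth (dA 2 j) 0 = (m j - 1 / 6) * (m j * p j)" for j
    by (simp_all add: dA_def numeral_2_eq_2 fps_mod_deriv_nth_0 m_p_def add_divide_distrib)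
  have "fps_nth w 0 = p 1 * p 2 * p 3 * ((m 2 - m 1) * (m 3 - m 1) * (m 3 - m 2))"
    unfolding w_def det_3 by (simp add: d0[unfolded One_nat_def]) (simp add: algebra_simps)
  moreover have "m i \<noteq> m j" if "i \<noteq> j" for i j using l_distinct[OF that] by (simp add: m_p_def)
  moreover have "p j \<noteq> 0" for j using A_0 by (simp add: m_p_def)
  ultimately show "fps_nth w 0 \<noteq> 0" by simp
qed

lemma wronskian_lower_bound:
  "\<exists>Y c. Y > 0 \<and> c > 0 \<and> (\<forall>z. Im z > Y \<longrightarrow> norm (wronskian z) \<ge> c * norm (qpow (l$1 + l$2 + l$3) z))"
proof -
  obtain Y c where Y: "Y > 0" "c > 0"
    "\<And>z. Im z > Y \<Longrightarrow> norm (qfun (det (\<chi> j. vector [dA 0 j, dA 1 j, dA 2 j] :: complex fps^3^3)) z) \<ge> c"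
    using qfun_bounded_below[OF wronskian_series] by blast
  have "norm (wronskian z) \<ge> c * norm (qpow (l$1 + l$2 + l$3) z)" if "Im z > Y" for z
  proof -
    have "Im z > 0" using that Y(1) by simp
    then show ?thesis
      using Y(3)[OF that] by (simp add: wronskian_eq norm_mult mult.commute[of c] mult_left_mono)
  qed
  then show ?thesis using Y(1,2) by blast
qed

text \<open>The Wronskian is a constant times the exponential of a primitive of a multiple of
  \<open>E2\<close>; a single zero would make it vanish identically, against its leading term at the
  cusp.\<close>

lemma wronskian_nonzero:
  assumes z: "Im z > 0"
  shows "wronskian z \<noteq> 0"
proof
  assume zero: "wronskian z = 0"
  define \<kappa> where "\<kappa> = 2 * of_real pi * \<i> * of_real (l$1 + l$2 + l$3)"
  have "(\<lambda>z. \<kappa> * E2 z) holomorphic_on upper_half_plane"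
    by (intro holomorphic_intros E2_holomorphic)
  then obtain L where L0: "\<And>x. x \<in> upper_half_plane \<Longrightarrow> (L has_field_derivative \<kappa> * E2 x) (at x within upper_half_plane)"
    using holomorphic_convex_primitive'[OF convex_upper_half_plane open_upper_half_plane] by blast
  have L: "(L has_field_derivative \<kappa> * E2 x) (at x)" if "x \<in> upper_half_plane" for x
    using L0[OF that] at_within_open[OF that open_upper_half_plane] by simp
  have "((\<lambda>x. wronskian x * exp (- L x)) has_field_derivative 0) (at x)" if "x \<in> upper_half_plane" for x
  proof -
    have "Im x > 0" using that by simp
    note W = wronskian_deriv[OF this, folded \<kappa>_def]
    show ?thesis
      by (rule DERIV_cong[OF DERIV_mult[OF W DERIV_fun_exp[OF DERIV_minus[OF L[OF that]]]]])
         (simp add: algebra_simps)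
  qed
  then have "((\<lambda>x. wronskian x * exp (- L x)) has_field_derivative 0) (at x within upper_half_plane)"
    if "x \<in> upper_half_plane" for x
    using that has_field_derivative_at_within by blast
  from has_field_derivative_zero_constant[OF convex_upper_half_plane this]
  obtain C where C: "\<And>x. x \<in> upper_half_plane \<Longrightarrow> wronskian x * exp (- L x) = C" by blast
  have "C = 0" using C[of z] z zero by simp
  then have all: "wronskian x = 0" if "Im x > 0" for x using C[of x] that by simp
  obtain Y c where Y: "Y > 0" "c > 0" "\<And>z. Im z > Y \<Longrightarrow> norm (wronskian z) \<ge> c * norm (qpow (l$1 + l$2 + l$3) z)"
    using wronskian_lower_bound by blast
  define x where "x = Complex 0 (Y + 1)"
  have "c * norm (qpow (l$1 + l$2 + l$3) x) \<le> 0" using Y(3)[of x] all[of x] Y(1) by (simp add: x_def)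
  then show False using Y(2) by (simp add: mult_le_0_iff)
qed

lemma sol_matrix_det_nonzero: "Im z > 0 \<Longrightarrow> det (sol_matrix z) \<noteq> 0"
  using wronskian_nonzero by (simp add: wronskian_def)

lemma sol_matrix_injective:
  assumes "Im z > 0" "\<And>j. x1 * dsol 0 j z + x2 * dsol 1 j z + x3 * dsol 2 j z = 0"
  shows "x1 = 0" "x2 = 0" "x3 = 0"
proof -
  have "sol_matrix z *v vector [x1, x2, x3] = 0"
    using assms(2) by (simp add: vec_eq_iff matrix3_vector_nth algebra_simps)
  moreover have "invertible (sol_matrix z)"
    using sol_matrix_det_nonzero[OF assms(1)] by (simp add: invertible_det_nz)
  ultimately have "vector [x1, x2, x3] = (0 :: complex^3)"
    by (metis invertible_def matrix_vector_mul_assoc matrix_vector_mul_lid matrix_vector_mult_0_right)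
  then show "x1 = 0" "x2 = 0" "x3 = 0" by (simp_all add: vec3_eq_iff)
qed

lemma sol_transpose_injective:
  assumes "Im z > 0" "\<And>n. n < 3 \<Longrightarrow> x1 * dsol n 1 z + x2 * dsol n 2 z + x3 * dsol n 3 z = 0"
  shows "x1 = 0" "x2 = 0" "x3 = 0"
proof -
  have "transpose (sol_matrix z) *v vector [x1, x2, x3] = 0"
    using assms(2)[of 0] assms(2)[of 1] assms(2)[of 2]
    by (simp add: vec3_eq_iff matrix3_vector_nth transpose_def algebra_simps)
  moreover have "invertible (transpose (sol_matrix z))"
    using sol_matrix_det_nonzero[OF assms(1)] by (simp add: invertible_det_nz det_transpose)
  ultimately have "vector [x1, x2, x3] = (0 :: complex^3)"
    by (metis invertible_def matrix_vector_mul_assoc matrix_vector_mul_lid matrix_vector_mult_0_right)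
  then show "x1 = 0" "x2 = 0" "x3 = 0" by (simp_all add: vec3_eq_iff)
qed

text \<open>Variation of constants: writing a solution and its derivatives in terms of the three given
  ones, the coefficients are constant.\<close>

lemma solution_is_combination:
  assumes g: "mmde_solution k a b g"
  shows "\<exists>x::complex^3. \<forall>z. Im z > 0 \<longrightarrow> g z = x$1 * sol 1 z + x$2 * sol 2 z + x$3 * sol 3 z"
proof -
  define y where "y n = mod_deriv_iter k n g" for n
  define c where "c = 2 * of_real pi * \<i>"
  have g0: "g holomorphic_on upper_half_plane" using g by (simp add: mmde_solution_def)
  have y_holo: "y n holomorphic_on upper_half_plane" for n
    unfolding y_def by (rule mod_deriv_iter_holomorphic[OF g0])
  define rhs where "rhs z = (vector [y 0 z, y 1 z, y 2 z] :: complex^3)" for z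
  define M where "M m z = (\<chi> i j. if j = m then rhs z $ i else transpose (sol_matrix z) $ i $ j)" for m :: 3 and z
  define X where "X m z = det (M m z) / wronskian z" for m :: 3 and z
  have rhs_holo: "(\<lambda>z. rhs z $ i) holomorphic_on upper_half_plane" for i
    using exhaust_3[of i] y_holo by (auto simp: rhs_def)
  have M_holo: "(\<lambda>z. M m z $ i $ j) holomorphic_on upper_half_plane" for m i j
    using rhs_holo sol_matrix_holomorphic by (cases "j = m") (simp_all add: M_def transpose_def)
  have X_holo: "X m holomorphic_on upper_half_plane" for m
    unfolding X_def[abs_def] using wronskian_nonzero by (intro holomorphic_on_divide det_holomorphic M_holo wronskian_holomorphic) auto
  have X: "transpose (sol_matrix z) *v (\<chi> m. X m z) = rhs z" if "Im z > 0" for z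
    using sol_matrix_det_nonzero[OF that] cramer[of "transpose (sol_matrix z)" "\<chi> m. X m z" "rhs z"]
    by (simp add: det_transpose X_def M_def wronskian_def)
  have Xn: "y n z = X 1 z * dsol n 1 z + X 2 z * dsol n 2 z + X 3 z * dsol n 3 z" if "Im z > 0" "n < 3" for n z
  proof -
    have "n = 0 \<or> n = 1 \<or> n = 2" using that(2) by auto
    then show ?thesis
      using X[OF that(1)] by (auto simp: vec3_eq_iff matrix3_vector_nth transpose_def rhs_def algebra_simps)
  qed
  have "deriv (X m) z = 0" if z: "Im z > 0" for z m
  proof -
    have dX: "(X m has_field_derivative deriv (X m) z) (at z)" for m
      by (rule holomorphic_upper_half_planeD[OF X_holo z])
    have key: "Y = deriv (X 1) z * dsol n 1 z + d1 * X 1 z + (deriv (X 2) z * dsol n 2 z + d2 * X 2 z)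
        + (deriv (X 3) z * dsol n 3 z + d3 * X 3 z)"
      if n: "n < 3" and Y: "(y n has_field_derivative Y) (at z)"
        and d: "(dsol n 1 has_field_derivative d1) (at z)" "(dsol n 2 has_field_derivative d2) (at z)"
          "(dsol n 3 has_field_derivative d3) (at z)" for n Y d1 d2 d3
    proof (rule DERIV_unique)
      show "((\<lambda>z. X 1 z * dsol n 1 z + X 2 z * dsol n 2 z + X 3 z * dsol n 3 z) has_field_derivative Y) (at z)"
        by (rule has_field_derivative_transform_within_open[OF Y open_upper_half_plane])
           (use z Xn n in auto)
    qed (intro DERIV_add DERIV_mult dX d)
    note ds = dsol_companion[OF z, folded c_def]
    note ys = mmde_solution_companion[OF g z, folded c_def y_def]
    define \<mu>1 \<mu>2 \<mu>3 :: complex where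
      "\<mu>1 = of_real (k / 12)" "\<mu>2 = of_real ((k + 2) / 12)" "\<mu>3 = of_real ((k + 4) / 12)"
    note \<mu> = \<mu>1_\<mu>2_\<mu>3_def[symmetric]
    note X0 = Xn[OF z, of 0] and X1 = Xn[OF z, of 1] and X2 = Xn[OF z, of 2]
    \<comment> \<open>Subtracting the system for \<open>g\<close> from the same combination of the
      systems for the solutions leaves only the terms with derivatives of \<open>X\<close>.\<close>
    have "deriv (X 1) z * dsol 0 1 z + deriv (X 2) z * dsol 0 2 z + deriv (X 3) z * dsol 0 3 z = 0"
      using key[OF _ ys(1) ds(1) ds(1) ds(1)] X0 X1 unfolding \<mu> by (simp add: algebra_simps)
    moreover have "deriv (X 1) z * dsol 1 1 z + deriv (X 2) z * dsol 1 2 z + deriv (X 3) z * dsol 1 3 z = 0"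
      using key[OF _ ys(2) ds(2) ds(2) ds(2)] X1 X2 unfolding \<mu> by (simp add: algebra_simps)
    moreover have "deriv (X 1) z * dsol 2 1 z + deriv (X 2) z * dsol 2 2 z + deriv (X 3) z * dsol 2 3 z = 0"
      using key[OF _ ys(3) ds(3) ds(3) ds(3)] X0 X1 X2 unfolding \<mu> by (simp add: algebra_simps)
    moreover have "n = 0 \<or> n = 1 \<or> n = 2" if "n < 3" for n :: nat using that by auto
    ultimately have comb: "deriv (X 1) z * dsol n 1 z + deriv (X 2) z * dsol n 2 z + deriv (X 3) z * dsol n 3 z = 0"
      if "n < 3" for n using that by metis
    from sol_transpose_injective[OF z comb] show ?thesis using exhaust_3[of m] by auto
  qed
  then have "(X m has_field_derivative 0) (at z within upper_half_plane)" if "z \<in> upper_half_plane" for m z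
    using holomorphic_upper_half_planeD[OF X_holo, of z m] that
    by (metis has_field_derivative_at_within mem_upper_half_plane)
  then have "\<exists>C. \<forall>z\<in>upper_half_plane. X m z = C" for m
    using has_field_derivative_zero_constant[OF convex_upper_half_plane] by metis
  then obtain C where C: "\<And>m z. z \<in> upper_half_plane \<Longrightarrow> X m z = C m" by metis
  show ?thesis
    by (rule exI[of _ "\<chi> m. C m"]) (use Xn[of _ 0] C in \<open>auto simp: y_def dsol_0\<close>)
qed

end

section \<open>Decomposition of vector-valued modular forms\<close>

lemma power_exp_decay:
  assumes "c > 0"
  shows "((\<lambda>y::real. y ^ N * exp (- (c * y))) \<longlongrightarrow> 0) at_top"
proof -
  have "((\<lambda>y. (c * y) ^ N / exp (c * y)) \<longlongrightarrow> 0) at_top"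
    by (rule filterlim_compose[OF tendsto_power_div_exp_0])
       (use assms in \<open>intro filterlim_tendsto_pos_mult_at_top[OF tendsto_const] filterlim_ident\<close>)
  then have "((\<lambda>y. (c * y) ^ N / exp (c * y) * (1 / c ^ N)) \<longlongrightarrow> 0 * (1 / c ^ N)) at_top"
    by (intro tendsto_mult tendsto_const)
  then show ?thesis
    using assms by (simp add: power_mult_distrib exp_minus field_simps)
qed

text \<open>After division by \<open>q^l\<close> the function is periodic, and moderate growth with
  \<open>l < 1\<close> keeps it smaller than \<open>1 / q\<close>; so the quotient extends
  holomorphically to the cusp.\<close>

lemma moderate_growth_cusp_bounded:
  assumes f: "f holomorphic_on upper_half_plane" and growth: "moderate_growth f"
    and l: "l < 1" and per: "\<And>z. Im z > 0 \<Longrightarrow> f (z + 1) = exp (2 * of_real pi * \<i> * of_real l) * f z"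
  shows "\<exists>B. \<forall>z. Im z \<ge> 1 \<longrightarrow> norm (f z) \<le> B * norm (qpow l z)"
proof -
  define g where "g z = f z / qpow l z" for z
  have qpow_holo: "qpow l holomorphic_on upper_half_plane"
    by (rule holomorphic_upper_half_planeI[OF qpow_deriv])
  have g_holo: "g holomorphic_on upper_half_plane"
    unfolding g_def[abs_def] by (intro holomorphic_on_divide f qpow_holo) auto
  have g_per: "g (z + 1) = g z" if "Im z > 0" for z
    using per[OF that] by (simp add: g_def qpow_plus_1)
  obtain N where N: "\<forall>\<^sub>F y in at_top. \<forall>x::real. norm (f (Complex x y)) < y ^ N"
    using growth by (auto simp: moderate_growth_def)
  have g_growth: "\<exists>Y. \<forall>z. Im z > Y \<longrightarrow> norm (qexp z * g z) < e" if e: "e > 0" for e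
  proof -
    have "((\<lambda>y::real. y ^ N * exp (- ((2 * pi * (1 - l)) * y))) \<longlongrightarrow> 0) at_top"
      using l by (intro power_exp_decay) auto
    from order_tendstoD(2)[OF this e] N
    have "\<forall>\<^sub>F y in at_top. y ^ N * exp (- ((2 * pi * (1 - l)) * y)) < e \<and> (\<forall>x::real. norm (f (Complex x y)) < y ^ N)"
      by eventually_elim auto
    then obtain Y where Y: "\<And>y. y \<ge> Y \<Longrightarrow> y ^ N * exp (- ((2 * pi * (1 - l)) * y)) < e \<and> (\<forall>x::real. norm (f (Complex x y)) < y ^ N)"
      by (auto simp: eventually_at_top_linorder)
    have "norm (qexp z * g z) < e" if "Im z > Y" for z
    proof -
      have "norm (qexp z * g z) = norm (f z) * exp (- ((2 * pi * (1 - l)) * Im z))"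
      proof -
        have "exp (- (2 * pi * Im z)) / exp (- (2 * pi * l * Im z)) = exp (- ((2 * pi * (1 - l)) * Im z))"
          by (simp add: algebra_simps flip: exp_diff)
        moreover have "norm (qexp z * g z) = norm (f z) * (exp (- (2 * pi * Im z)) / exp (- (2 * pi * l * Im z)))"
          unfolding g_def norm_mult norm_divide norm_qexp norm_qpow by simp
        ultimately show ?thesis by simp
      qed
      also have "\<dots> \<le> Im z ^ N * exp (- ((2 * pi * (1 - l)) * Im z))"
        using Y[of "Im z"] that by (intro mult_right_mono) (auto intro: less_imp_le simp: complex_eq_iff dest!: spec[of _ "Re z"])
      also have "\<dots> < e" using Y[of "Im z"] that by auto
      finally show ?thesis .
    qed
    then show ?thesis by blast
  qed
  obtain h where h: "h holomorphic_on ball 0 1" "\<And>z. Im z > 0 \<Longrightarrow> g z = h (qexp z)"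
    using cusp_extension[OF g_holo g_per g_growth] by blast
  obtain B where B: "\<And>z. Im z \<ge> 1 \<Longrightarrow> norm (g z) \<le> B"
    using cusp_bounded[OF h, of 1] by auto
  have "norm (f z) \<le> B * norm (qpow l z)" if "Im z \<ge> 1" for z
    using B[OF that] by (simp add: g_def norm_divide field_simps)
  then show ?thesis by blast
qed

text \<open>The weight ranges over all integers, because Cramer's rule produces weight
  \<open>p - 2 n\<close> from a form of any weight \<open>k + p\<close>.\<close>

definition scalar_form :: "int \<Rightarrow> (complex \<Rightarrow> complex) \<Rightarrow> bool"
  where "scalar_form p f \<longleftrightarrow> (\<forall>z. \<not> Im z > 0 \<longrightarrow> f z = 0) \<and> f holomorphic_on upper_half_plane \<and>
    (\<exists>Y B. \<forall>z. Im z > Y \<longrightarrow> norm (f z) \<le> B) \<and>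
    (\<forall>A\<in>modular_group. \<forall>z. Im z > 0 \<longrightarrow> f (moebius_act A z) = aut_factor A z powi p * f z)"

text \<open>In odd weight the matrix -1 changes the sign of the values but fixes the half-plane;
  negative weight is \<open>negative_weight_zero\<close>.\<close>

lemma scalar_form_zero:
  assumes f: "scalar_form p f" and p: "p < 0 \<or> odd p"
  shows "f = 0"
proof
  fix z
  show "f z = (0 :: complex \<Rightarrow> complex) z"
  proof (cases "Im z > 0")
    case True
    show ?thesis
    proof (cases "odd p")
      case True
      have "f (moebius_act neg_mat z) = aut_factor neg_mat z powi p * f z"
        using f \<open>Im z > 0\<close> modular_group_generators(4) unfolding scalar_form_def by blast
      then have "f z = - f z" using True by (simp add: generators_act)
      then show ?thesis by simp
    next
      case False
      then have p: "p < 0" using p by simp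
      define m where "m = nat (- p)"
      have m: "m > 0" "p = - int m" using p by (auto simp: m_def)
      have "f z = 0"
      proof (rule negative_weight_zero[of m f, OF m(1)])
        show "f holomorphic_on upper_half_plane" "\<exists>Y B. \<forall>z. Im z > Y \<longrightarrow> norm (f z) \<le> B"
          using f by (auto simp: scalar_form_def)
        fix A w assume A: "A \<in> modular_group" "Im w > 0"
        then have "f (moebius_act A w) = aut_factor A w powi (- int m) * f w"
          using f m(2) by (simp add: scalar_form_def)
        then show "f w = aut_factor A w ^ m * f (moebius_act A w)"
          using aut_factor_nonzero[OF A] by (simp add: power_int_minus)
      qed (use \<open>Im z > 0\<close> in auto)
      then show ?thesis by simp
    qed
  next
    case False
    then show ?thesis using f by (simp add: scalar_form_def)
  qed
qed

lemma scalar_form_modular: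
  assumes "scalar_form (int n) f"
  shows "f \<in> modular_forms n"
  using assms by (auto simp: scalar_form_def modular_forms_def)

text \<open>The derivatives inherit the constants of the solutions, because the modular derivative
  commutes with inversion up to the shift of weight.\<close>

lemma (in mmde_system) dsol_inversion:
  assumes inv: "\<And>w. Im w > 0 \<Longrightarrow> w powr of_real (- k) * sol j (- 1 / w) = (\<Sum>m\<in>UNIV. c m * sol m w)"
    and z: "Im z > 0"
  shows "z powr of_real (- (k + 2 * real n)) * dsol n j (- 1 / z) = (\<Sum>m\<in>UNIV. c m * dsol n m z)"
proof -
  have "mod_deriv_iter k n (\<lambda>w. w powr of_real (- k) * sol j (- 1 / w)) z =
      mod_deriv_iter k n (\<lambda>w. \<Sum>m\<in>UNIV. c m * sol m w) z"
    using inv z by (rule mod_deriv_iter_cong)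
  also have "\<dots> = (\<Sum>m\<in>UNIV. c m * dsol n m z)"
    unfolding dsol_def by (subst mod_deriv_iter_linear) (auto simp: sol_holomorphic)
  finally show ?thesis
    unfolding mod_deriv_iter_inversion[OF sol_holomorphic z] dsol_def[symmetric] .
qed

lemma (in mmde_system) dsol_plus_1:
  "Im z > 0 \<Longrightarrow> dsol n j (z + 1) = exp (2 * of_real pi * \<i> * of_real (l$j)) * dsol n j z"
  by (simp add: dsol_eq qform_def qfun_plus_1 qpow_plus_1)

text \<open>\<open>T_exponents\<close> and \<open>S_law\<close> describe the two generators on the
  solutions themselves; the laws for derivatives and for the whole group follow.\<close>

locale equivariant_system = mmde_system +
  fixes \<rho> :: "int^2^2 \<Rightarrow> complex^3^3" and \<upsilon> :: "int^2^2 \<Rightarrow> complex" and t :: "complex^3"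
  assumes rep: "representation \<rho>" and mult: "multiplier_system k \<upsilon>"
    and rho_T: "\<rho> T_mat = diag3 t"
    and T_exponents: "exp (2 * of_real pi * \<i> * of_real (l$j)) = \<upsilon> T_mat * t$j"
    and S_law: "Im z > 0 \<Longrightarrow> slash k \<upsilon> S_mat (sol j) z = (\<rho> S_mat *v (\<chi> m. sol m z)) $ j"
begin

definition dvec :: "nat \<Rightarrow> complex \<Rightarrow> complex^3"
  where "dvec n z = (\<chi> j. dsol n j z)"

lemma dvec_nth [simp]: "dvec n z $ j = dsol n j z"
  by (simp add: dvec_def)

lemma rho_mult: "C \<in> modular_group \<Longrightarrow> B \<in> modular_group \<Longrightarrow> \<rho> (C ** B) = \<rho> C ** \<rho> B"
  using rep by (simp add: representation_def)

lemma mult_shift: "multiplier_system (k + 2 * real n) \<upsilon>"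
  using multiplier_system_shift[OF mult, of "2 * int n"] by simp

lemma diag3_mult_vec: "diag3 t *v x = (\<chi> j. t$j * x$j)"
  by (simp add: vec3_eq_iff matrix3_vector_nth diag3_nth)

lemma dvec_T_law:
  assumes "Im z > 0"
  shows "mult_factor (k + 2 * real n) \<upsilon> T_mat z *s dvec n (moebius_act T_mat z) = \<rho> T_mat *v dvec n z"
proof -
  have "\<upsilon> T_mat \<noteq> 0" using mult_factor_rules(1)[OF mult] by simp
  moreover have "dsol n j (z + 1) = \<upsilon> T_mat * t$j * dsol n j z" for j
    using assms T_exponents[of j] by (simp add: dsol_plus_1)
  ultimately show ?thesis
    by (simp add: rho_T diag3_mult_vec vec_eq_iff mult_factor_generators generators_act)
qed

lemma dvec_S_law:
  assumes z: "Im z > 0"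
  shows "mult_factor (k + 2 * real n) \<upsilon> S_mat z *s dvec n (moebius_act S_mat z) = \<rho> S_mat *v dvec n z"
proof -
  have nz: "\<upsilon> S_mat \<noteq> 0" using mult_factor_rules(1)[OF mult] by simp
  have e: "z powr of_real (- (k + 2 * real n)) * dsol n j (- 1 / z) = (\<Sum>m\<in>UNIV. (\<upsilon> S_mat * \<rho> S_mat $ j $ m) * dsol n m z)" for j
  proof -
    have "w powr of_real (- k) * sol j (- 1 / w) = (\<Sum>m\<in>UNIV. (\<upsilon> S_mat * \<rho> S_mat $ j $ m) * sol m w)" if "Im w > 0" for w
    proof -
      have "w powr of_real (- k) * sol j (- 1 / w) = \<upsilon> S_mat * slash k \<upsilon> S_mat (sol j) w"
        using nz by (simp add: slash_eq mult_factor_generators generators_act)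
      then show ?thesis
        unfolding S_law[OF that] by (simp add: matrix_vector_mult_def sum_distrib_left mult.assoc)
    qed
    from dsol_inversion[OF this z] show ?thesis .
  qed
  show ?thesis
    unfolding vec_eq_iff
  proof
    fix j
    have "(mult_factor (k + 2 * real n) \<upsilon> S_mat z *s dvec n (moebius_act S_mat z)) $ j =
        inverse (\<upsilon> S_mat) * (z powr of_real (- (k + 2 * real n)) * dsol n j (- 1 / z))"
      by (simp add: mult_factor_generators generators_act)
    also have "\<dots> = (\<Sum>m\<in>UNIV. inverse (\<upsilon> S_mat) * (\<upsilon> S_mat * \<rho> S_mat $ j $ m * dsol n m z))"
      unfolding e sum_distrib_left ..
    also have "\<dots> = (\<rho> S_mat *v dvec n z) $ j"
      using nz by (simp add: matrix_vector_mult_def flip: mult.assoc)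
    finally show "(mult_factor (k + 2 * real n) \<upsilon> S_mat z *s dvec n (moebius_act S_mat z)) $ j =
        (\<rho> S_mat *v dvec n z) $ j" .
  qed
qed

lemma dvec_law_mult:
  assumes B: "B \<in> modular_group"
      "\<And>z. Im z > 0 \<Longrightarrow> mult_factor (k + 2 * real n) \<upsilon> B z *s dvec n (moebius_act B z) = \<rho> B *v dvec n z"
    and C: "C \<in> modular_group"
      "mult_factor (k + 2 * real n) \<upsilon> C z *s dvec n (moebius_act C z) = \<rho> C *v dvec n z"
    and z: "Im z > 0"
  shows "mult_factor (k + 2 * real n) \<upsilon> (B ** C) z *s dvec n (moebius_act (B ** C) z) = \<rho> (B ** C) *v dvec n z"
proof -
  let ?w = "moebius_act C z"
  have "mult_factor (k + 2 * real n) \<upsilon> (B ** C) z *s dvec n (moebius_act (B ** C) z) =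
    mult_factor (k + 2 * real n) \<upsilon> C z *s (mult_factor (k + 2 * real n) \<upsilon> B ?w *s dvec n (moebius_act B ?w))"
    using mult_factor_rules(3)[OF mult_shift B(1) C(1) z]
    by (simp add: moebius_act_mult[OF B(1) C(1) z] vector_smult_assoc)
  also have "\<dots> = \<rho> B *v (mult_factor (k + 2 * real n) \<upsilon> C z *s dvec n ?w)"
    unfolding B(2)[OF moebius_act_upper[OF C(1) z]] by (simp add: vector_scalar_commute)
  also have "\<dots> = \<rho> (B ** C) *v dvec n z"
    unfolding C(2) by (simp add: rho_mult[OF B(1) C(1)] matrix_vector_mul_assoc)
  finally show ?thesis .
qed

lemma dvec_law:
  assumes "B \<in> modular_group" "Im z > 0"
  shows "mult_factor (k + 2 * real n) \<upsilon> B z *s dvec n (moebius_act B z) = \<rho> B *v dvec n z"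
  using assms
proof (induction arbitrary: z rule: modular_group_induct)
  case one
  then show ?case
    using mult_factor_rules(2)[OF mult_shift] by (simp add: generators_act representation_one[OF rep])
next
  case (S B)
  then show ?case by (intro dvec_law_mult dvec_S_law) auto
next
  case (T B)
  then show ?case by (intro dvec_law_mult dvec_T_law) auto
qed

lemma dsol_bounded: "\<exists>B. \<forall>z. Im z \<ge> 1 \<longrightarrow> norm (dsol n j z) \<le> B * norm (qpow (l$j) z)"
proof -
  obtain B where B: "\<And>z. Im z \<ge> 1 \<Longrightarrow> norm (qfun (dA n j) z) \<le> B"
    using qfun_bounded[OF disc_dA, of 1 n j] by auto
  have "norm (dsol n j z) \<le> B * norm (qpow (l$j) z)" if "Im z \<ge> 1" for z
    using B[OF that] that by (simp add: dsol_eq qform_def norm_mult mult.commute mult_left_mono)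
  then show ?thesis by blast
qed

lemma dvec_in_vv_forms: "dvec n \<in> vv_forms (k + 2 * real n) \<rho> \<upsilon>"
proof -
  have off: "dvec n z = 0" if "\<not> Im z > 0" for z
    using that by (simp add: vec_eq_iff dsol_eq qform_def)
  have growth: "moderate_growth (\<lambda>z. dvec n z $ j)" for j
    unfolding moderate_growth_def
  proof (rule exI[of _ 1])
    obtain B where B: "\<And>z. Im z \<ge> 1 \<Longrightarrow> norm (dsol n j z) \<le> B * norm (qpow (l$j) z)"
      using dsol_bounded by blast
    \<comment> \<open>The exponents are nonnegative, so the components are bounded near the cusp and
      the first power of \<open>y\<close> suffices.\<close>
    have "\<forall>\<^sub>F y in at_top. y > max 1 B" by (rule eventually_gt_at_top)
    then show "\<forall>\<^sub>F y in at_top. \<forall>x. norm (dvec n (Complex x y) $ j) < y ^ 1"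
    proof eventually_elim
      case (elim y)
      show ?case
      proof
        fix x
        have q: "norm (qpow (l$j) (Complex x y)) \<le> 1"
          using l_range(1)[of j] elim by (simp add: norm_qpow)
        have b: "norm (dsol n j (Complex x y)) \<le> B * norm (qpow (l$j) (Complex x y))"
          using elim by (intro B) simp
        have "B * norm (qpow (l$j) (Complex x y)) \<ge> 0" using b norm_ge_zero order_trans by blast
        then have "B \<ge> 0" by (simp add: zero_le_mult_iff)
        then have "B * norm (qpow (l$j) (Complex x y)) \<le> B * 1" using q by (intro mult_left_mono) auto
        then show "norm (dvec n (Complex x y) $ j) < y ^ 1" using b elim by simp
      qed
    qed
  qed
  have "slash (k + 2 * real n) \<upsilon> B (\<lambda>w. dvec n w $ j) z = (\<rho> B *v dvec n z) $ j"
    if "B \<in> modular_group" "Im z > 0" for B z j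
    using dvec_law[OF that, of n] by (simp add: slash_eq vec_eq_iff)
  then show ?thesis
    using off growth dsol_holomorphic by (auto simp: vv_forms_def)
qed

text \<open>Columns are numbered 1, 2, 3, while orders of derivatives start at 0.\<close>

definition coeff_index :: "nat \<Rightarrow> 3"
  where "coeff_index n = (if n = 0 then 1 else if n = 1 then 2 else 3)"

text \<open>Cramer's rule expresses a form through \<open>F, D F, D\<^sup>2 F\<close>; the coefficients are scalar forms
  because numerator and denominator vanish at the cusp to the same order.\<close>

lemma vv_form_decomposition:
  assumes G: "G \<in> vv_forms (k + of_int p) \<rho> \<upsilon>"
  shows "\<exists>h. (\<forall>n<3. scalar_form (p - 2 * int n) (h n)) \<and>
    (\<forall>z. G z = (\<Sum>n<3. h n z *s dvec n z))"
proof -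
  have G_holo: "(\<lambda>z. G z $ j) holomorphic_on upper_half_plane" for j using G by (simp add: vv_forms_def)
  have G_growth: "moderate_growth (\<lambda>z. G z $ j)" for j using G by (simp add: vv_forms_def)
  have G_off: "G z = 0" if "\<not> Im z > 0" for z using G that by (simp add: vv_forms_def)
  have G_law: "mult_factor (k + of_int p) \<upsilon> B z *s G (moebius_act B z) = \<rho> B *v G z"
    if "B \<in> modular_group" "Im z > 0" for B z
    using G that by (simp add: vv_forms_def slash_eq vec_eq_iff)
  define M where "M m z = (\<chi> i j. if j = m then G z $ i else sol_matrix z $ i $ j)" for m :: 3 and z
  define X where "X m z = det (M m z) / wronskian z" for m :: 3 and z
  have M_holo: "(\<lambda>z. M m z $ i $ j) holomorphic_on upper_half_plane" for m i j
    using G_holo sol_matrix_holomorphic by (cases "j = m") (simp_all add: M_def)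
  have X_holo: "X m holomorphic_on upper_half_plane" for m
    unfolding X_def[abs_def] using wronskian_nonzero by (intro holomorphic_on_divide det_holomorphic M_holo wronskian_holomorphic) auto
  have X: "sol_matrix z *v (\<chi> m. X m z) = G z" if "Im z > 0" for z
    using sol_matrix_det_nonzero[OF that] cramer[of "sol_matrix z" "\<chi> m. X m z" "G z"]
    by (simp add: X_def M_def wronskian_def)
  have Xn: "G z $ j = X 1 z * dsol 0 j z + X 2 z * dsol 1 j z + X 3 z * dsol 2 j z" if "Im z > 0" for z j
    unfolding X[OF that, symmetric] by (simp add: matrix3_vector_nth algebra_simps)
  have G_per: "G (z + 1) $ j = exp (2 * of_real pi * \<i> * of_real (l$j)) * G z $ j" if "Im z > 0" for z j
  proof -
    have "\<upsilon> T_mat \<noteq> 0" using mult_factor_rules(1)[OF mult] by simp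
    moreover have "inverse (\<upsilon> T_mat) * G (z + 1) $ j = t$j * G z $ j"
      using G_law[OF modular_group_generators(3) that]
      by (simp add: rho_T diag3_mult_vec vec_eq_iff mult_factor_generators generators_act)
    ultimately show ?thesis unfolding T_exponents by (simp add: field_simps)
  qed
  have X_bounded: "\<exists>Y B. \<forall>z. Im z > Y \<longrightarrow> norm (X m z) \<le> B" for m
  proof -
    have "\<exists>B. \<forall>z. Im z \<ge> 1 \<longrightarrow> norm (M m z $ i $ j) \<le> B * norm (qpow (l$i) z)" for i j
    proof (cases "j = m")
      case True
      then show ?thesis
        using moderate_growth_cusp_bounded[OF G_holo G_growth l_range(2) G_per, of i] by (simp add: M_def)
    next
      case False
      then show ?thesis using dsol_bounded exhaust_3[of j] by (auto simp: M_def)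
    qed
    then obtain B where B: "\<And>i j z. Im z \<ge> 1 \<Longrightarrow> norm (M m z $ i $ j) \<le> B i j * norm (qpow (l$i) z)"
      by metis
    define C where "C = Max (insert 0 ((\<lambda>(i, j). B i j) ` UNIV))"
    have C: "C \<ge> 0" "B i j \<le> C" for i j
    proof -
      have "B i j \<in> insert 0 ((\<lambda>(i, j). B i j) ` UNIV)" by force
      then show "B i j \<le> C" unfolding C_def by (intro Max_ge) auto
    qed (simp add: C_def)
    obtain Y c where Y: "Y > 0" "c > 0" "\<And>z. Im z > Y \<Longrightarrow> norm (wronskian z) \<ge> c * norm (qpow (l$1 + l$2 + l$3) z)"
      using wronskian_lower_bound by blast
    have "norm (X m z) \<le> 6 * C^3 / c" if z: "Im z > max Y 1" for z
    proof -
      have z1: "Im z \<ge> 1" "Im z > Y" using z by auto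
      have "norm (M m z $ i $ j) \<le> C * norm (qpow (l$i) z)" for i j
        by (rule order_trans[OF B[OF z1(1)] mult_right_mono[OF C(2) norm_ge_zero]])
      from norm_det_le[of "M m z" C "\<lambda>i. norm (qpow (l$i) z)", OF this C(1)]
      have d: "norm (det (M m z)) \<le> 6 * C^3 * norm (qpow (l$1 + l$2 + l$3) z)"
        by (simp add: qpow_add norm_mult)
      have q: "norm (qpow (l$1 + l$2 + l$3) z) > 0" by simp
      have "norm (X m z) \<le> (6 * C^3 * norm (qpow (l$1 + l$2 + l$3) z)) / (c * norm (qpow (l$1 + l$2 + l$3) z))"
        unfolding X_def norm_divide
        by (rule frac_le) (use d Y(3)[OF z1(2)] Y(2) q C(1) in auto)
      also have "\<dots> = 6 * C^3 / c" using q by simp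
      finally show ?thesis .
    qed
    then show ?thesis by blast
  qed
  have X_law: "X (coeff_index n) (moebius_act B z) = aut_factor B z powi (p - 2 * int n) * X (coeff_index n) z"
    if n: "n < 3" and B: "B \<in> modular_group" and z: "Im z > 0" for n B z
  proof -
    let ?w = "moebius_act B z" and ?\<alpha> = "aut_factor B z"
    have w: "Im ?w > 0" by (rule moebius_act_upper[OF B z])
    have \<alpha>: "?\<alpha> \<noteq> 0" by (rule aut_factor_nonzero[OF B z])
    define J where "J = mult_factor k \<upsilon> B z"
    have J: "J \<noteq> 0" unfolding J_def by (rule mult_factor_rules(4)[OF mult B z])
    have Jn: "mult_factor (k + 2 * real n) \<upsilon> B z = J * ?\<alpha> powi (- (2 * int n))" for n
      using mult_factor_shift[OF B z, of k "2 * int n"] by (simp add: J_def)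
    have Jp: "mult_factor (k + of_int p) \<upsilon> B z = J * ?\<alpha> powi (- p)"
      by (simp add: J_def mult_factor_shift[OF B z])
    have D: "\<rho> B *v dvec n z = (J * ?\<alpha> powi (- (2 * int n))) *s dvec n ?w" for n
      using dvec_law[OF B z, of n] by (simp add: Jn)
    have Gz: "G z = X 1 z *s dvec 0 z + X 2 z *s dvec 1 z + X 3 z *s dvec 2 z"
      using Xn[OF z] by (simp add: vec_eq_iff)
    have "(J * ?\<alpha> powi (- p)) *s G ?w = \<rho> B *v G z"
      using G_law[OF B z] by (simp add: Jp)
    also have "\<dots> = X 1 z *s (\<rho> B *v dvec 0 z) + X 2 z *s (\<rho> B *v dvec 1 z) + X 3 z *s (\<rho> B *v dvec 2 z)"
      unfolding Gz by (simp add: matrix_vector_right_distrib vector_scalar_commute)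
    finally have e: "(J * ?\<alpha> powi (- p)) *s G ?w = X 1 z *s (\<rho> B *v dvec 0 z) + X 2 z *s (\<rho> B *v dvec 1 z) + X 3 z *s (\<rho> B *v dvec 2 z)" .
    \<comment> \<open>Both sides of \<open>e\<close> are expanded in the columns of
      \<open>sol_matrix ?w\<close>, whose independence then compares the coefficients.\<close>
    have "(X 1 ?w * ?\<alpha> powi (- p) - X 1 z) * dsol 0 j ?w + (X 2 ?w * ?\<alpha> powi (- p) - X 2 z * ?\<alpha> powi (- 2)) * dsol 1 j ?w
      + (X 3 ?w * ?\<alpha> powi (- p) - X 3 z * ?\<alpha> powi (- 4)) * dsol 2 j ?w = 0" for j
    proof -
      have "J * (?\<alpha> powi (- p) * G ?w $ j) = J * (X 1 z * dsol 0 j ?w + X 2 z * (?\<alpha> powi (- 2) * dsol 1 j ?w)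
          + X 3 z * (?\<alpha> powi (- 4) * dsol 2 j ?w))"
        using arg_cong[OF e, of "\<lambda>x. x $ j"] unfolding D by (simp add: algebra_simps)
      then have "?\<alpha> powi (- p) * G ?w $ j = X 1 z * dsol 0 j ?w + X 2 z * (?\<alpha> powi (- 2) * dsol 1 j ?w)
          + X 3 z * (?\<alpha> powi (- 4) * dsol 2 j ?w)"
        using J by (subst (asm) mult_cancel_left) auto
      then show ?thesis unfolding Xn[OF w] by (simp add: algebra_simps)
    qed
    note inj = sol_matrix_injective[OF w this]
    have mult_powi: "x = ?\<alpha> powi (p - i) * y" if "x * ?\<alpha> powi (- p) = y * ?\<alpha> powi (- i)" for x y i
    proof -
      have "x = x * ?\<alpha> powi (- p) * ?\<alpha> powi p" using \<alpha> by (simp add: power_int_minus)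
      also have "\<dots> = y * (?\<alpha> powi (- i) * ?\<alpha> powi p)" unfolding that by simp
      also have "?\<alpha> powi (- i) * ?\<alpha> powi p = ?\<alpha> powi (p - i)"
        using \<alpha> by (simp flip: power_int_add)
      finally show ?thesis by (simp add: mult.commute)
    qed
    have "n = 0 \<or> n = 1 \<or> n = 2" using n by auto
    then show ?thesis
      using inj mult_powi[of "X 1 ?w" "X 1 z" 0] mult_powi[of "X 2 ?w" "X 2 z" 2] mult_powi[of "X 3 ?w" "X 3 z" 4]
      by (auto simp: coeff_index_def)
  qed
  define h where "h n z = (if Im z > 0 then X (coeff_index n) z else 0)" for n z
  have "scalar_form (p - 2 * int n) (h n)" if n: "n < 3" for n
    unfolding scalar_form_def
  proof (intro conjI ballI allI impI)
    show "h n z = 0" if "\<not> Im z > 0" for z using that by (simp add: h_def)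
    show "h n holomorphic_on upper_half_plane"
      by (rule holomorphic_transform[OF X_holo[of "coeff_index n"]]) (simp add: h_def)
    obtain Y B where B: "\<forall>z. Im z > Y \<longrightarrow> norm (X (coeff_index n) z) \<le> B" using X_bounded by blast
    have "norm (h n z) \<le> max B 0" if "Im z > Y" for z
      using B[rule_format, OF that] by (auto simp: h_def)
    then show "\<exists>Y B. \<forall>z. Im z > Y \<longrightarrow> norm (h n z) \<le> B" by blast
    show "h n (moebius_act B z) = aut_factor B z powi (p - 2 * int n) * h n z"
      if "B \<in> modular_group" "Im z > 0" for B z
      using X_law[OF n that] that moebius_act_upper[OF that] by (simp add: h_def)
  qed
  moreover have "G z = (\<Sum>n<3. h n z *s dvec n z)" for z
  proof (cases "Im z > 0")
    case True
    then show ?thesis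
      using Xn[OF True] by (simp add: vec_eq_iff h_def coeff_index_def numeral_3_eq_3 numeral_2_eq_2 lessThan_Suc)
  next
    case False
    then show ?thesis by (simp add: G_off h_def)
  qed
  ultimately show ?thesis by blast
qed

end

section \<open>The module structure\<close>

lemma sum_fun_apply: "(\<Sum>i\<in>I. f i) x = (\<Sum>i\<in>I. f i x)"
  by (induction I rule: infinite_finite_induct) auto

lemma zero_in_vv_forms: "0 \<in> vv_forms k \<rho> \<upsilon>"
proof -
  have "moderate_growth (\<lambda>z. 0)" unfolding moderate_growth_def by (rule exI[of _ 0]) simp
  then show ?thesis by (auto simp: vv_forms_def slash_eq matrix_vector_mult_0_right)
qed

lemma vv_forms_add:
  assumes F: "F \<in> vv_forms k \<rho> \<upsilon>" and G: "G \<in> vv_forms k \<rho> \<upsilon>"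
  shows "F + G \<in> vv_forms k \<rho> \<upsilon>"
proof -
  have "moderate_growth (\<lambda>z. (F + G) z $ j)" for j
  proof -
    have "moderate_growth (\<lambda>z. F z $ j)" "moderate_growth (\<lambda>z. G z $ j)"
      using F G by (simp_all add: vv_forms_def)
    then obtain M N where M: "\<forall>\<^sub>F y in at_top. \<forall>x::real. norm (F (Complex x y) $ j) < y ^ M"
      and N: "\<forall>\<^sub>F y in at_top. \<forall>x::real. norm (G (Complex x y) $ j) < y ^ N"
      unfolding moderate_growth_def by blast
    \<comment> \<open>The additional power of \<open>y\<close> absorbs the factor 2 once
      \<open>y \<ge> 2\<close>.\<close>
    have "\<forall>\<^sub>F y in at_top. \<forall>x. norm ((F + G) (Complex x y) $ j) < y ^ Suc (max M N)"
      using M N eventually_ge_at_top[of "2::real"]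
    proof eventually_elim
      case (elim y)
      show ?case
      proof
        fix x
        have "norm ((F + G) (Complex x y) $ j) \<le> norm (F (Complex x y) $ j) + norm (G (Complex x y) $ j)"
          by (simp add: norm_triangle_ineq)
        also have "\<dots> < y ^ M + y ^ N" using elim by (intro add_strict_mono) auto
        also have "\<dots> \<le> y ^ max M N + y ^ max M N"
          using elim by (intro add_mono power_increasing) auto
        also have "\<dots> = 2 * y ^ max M N" by simp
        also have "\<dots> \<le> y * y ^ max M N" using elim by (intro mult_right_mono) auto
        finally show "norm ((F + G) (Complex x y) $ j) < y ^ Suc (max M N)" by simp
      qed
    qed
    then show ?thesis unfolding moderate_growth_def by blast
  qed
  then show ?thesis
    using F G by (auto simp: vv_forms_def slash_eq distrib_left matrix_vector_right_distrib intro!: holomorphic_intros)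
qed

lemma vv_forms_sum:
  assumes "finite I" "\<And>i. i \<in> I \<Longrightarrow> F i \<in> vv_forms k \<rho> \<upsilon>"
  shows "(\<Sum>i\<in>I. F i) \<in> vv_forms k \<rho> \<upsilon>"
  using assms by (induction I rule: finite_induct) (auto intro: zero_in_vv_forms vv_forms_add)

lemma vv_forms_modular_mult:
  assumes F: "F \<in> vv_forms k \<rho> \<upsilon>" and g: "g \<in> modular_forms (2 * i)"
  shows "(\<lambda>z. g z *s F z) \<in> vv_forms (k + 2 * real i) \<rho> \<upsilon>"
proof -
  have "moderate_growth (\<lambda>z. (g z *s F z) $ j)" for j
  proof -
    have "moderate_growth (\<lambda>z. F z $ j)" using F by (simp add: vv_forms_def)
    then obtain N where N: "\<forall>\<^sub>F y in at_top. \<forall>x::real. norm (F (Complex x y) $ j) < y ^ N"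
      unfolding moderate_growth_def by blast
    obtain Y B where B: "\<And>z. Im z > Y \<Longrightarrow> norm (g z) \<le> B" using g by (auto simp: modular_forms_def)
    have "\<forall>\<^sub>F y in at_top. \<forall>x. norm ((g (Complex x y) *s F (Complex x y)) $ j) < y ^ Suc N"
      using N eventually_gt_at_top[of "max Y (max B 0)"]
    proof eventually_elim
      case (elim y)
      show ?case
      proof
        fix x
        have "norm ((g (Complex x y) *s F (Complex x y)) $ j) = norm (g (Complex x y)) * norm (F (Complex x y) $ j)"
          by (simp add: norm_mult)
        also have "\<dots> \<le> y * norm (F (Complex x y) $ j)"
          using B[of "Complex x y"] elim by (intro mult_right_mono) auto
        also have "\<dots> < y * y ^ N" using elim by (intro mult_strict_left_mono) auto
        finally show "norm ((g (Complex x y) *s F (Complex x y)) $ j) < y ^ Suc N" by simp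
      qed
    qed
    then show ?thesis unfolding moderate_growth_def by blast
  qed
  moreover have "slash (k + 2 * real i) \<upsilon> B (\<lambda>w. (g w *s F w) $ j) z = (\<rho> B *v (g z *s F z)) $ j"
    if B: "B \<in> modular_group" and z: "Im z > 0" for B z j
  proof -
    have nz: "aut_factor B z \<noteq> 0" by (rule aut_factor_nonzero[OF B z])
    have gB: "g (moebius_act B z) = aut_factor B z ^ (2 * i) * g z"
      using g B z by (simp add: modular_forms_def)
    have "aut_factor B z powi (- (2 * int i)) * aut_factor B z ^ (2 * i) = 1"
      using nz by (simp add: power_int_minus flip: power_int_of_nat)
    moreover have "mult_factor (k + 2 * real i) \<upsilon> B z = mult_factor k \<upsilon> B z * aut_factor B z powi (- (2 * int i))"
      using mult_factor_shift[OF B z, of k "2 * int i"] by simp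
    ultimately have m: "mult_factor (k + 2 * real i) \<upsilon> B z * aut_factor B z ^ (2 * i) = mult_factor k \<upsilon> B z"
      by simp
    have "slash (k + 2 * real i) \<upsilon> B (\<lambda>w. (g w *s F w) $ j) z =
        (mult_factor (k + 2 * real i) \<upsilon> B z * aut_factor B z ^ (2 * i)) * g z * F (moebius_act B z) $ j"
      by (simp add: slash_eq gB mult_ac)
    also have "\<dots> = g z * slash k \<upsilon> B (\<lambda>w. F w $ j) z" unfolding m by (simp add: slash_eq mult_ac)
    also have "slash k \<upsilon> B (\<lambda>w. F w $ j) z = (\<rho> B *v F z) $ j" using F B z by (simp add: vv_forms_def)
    finally show ?thesis by (simp add: vector_scalar_commute)
  qed
  ultimately show ?thesis
    using F g by (auto simp: vv_forms_def modular_forms_def intro!: holomorphic_intros)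
qed

lemma zero_in_modular_forms: "0 \<in> modular_forms n"
  by (auto simp: modular_forms_def zero_fun_def)

lemma modular_forms_cmult:
  assumes "f \<in> modular_forms n"
  shows "(\<lambda>z. c * f z) \<in> modular_forms n"
proof -
  obtain Y B where B: "\<forall>z. Im z > Y \<longrightarrow> norm (f z) \<le> B" using assms by (auto simp: modular_forms_def)
  have "\<exists>Y B. \<forall>z. Im z > Y \<longrightarrow> norm (c * f z) \<le> B"
    by (rule exI[of _ Y], rule exI[of _ "norm c * B"]) (use B in \<open>auto simp: norm_mult intro!: mult_left_mono\<close>)
  then show ?thesis using assms by (auto simp: modular_forms_def intro!: holomorphic_intros)
qed

context mmde_system
begin

definition mmde_coeff :: "nat \<Rightarrow> complex \<Rightarrow> complex"
  where "mmde_coeff n = (if n = 4 then (\<lambda>z. a * E4 z) else (\<lambda>z. b * E6 z))"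

lemma mmde_coeffs_mmde_coeff: "mmde_coeffs 3 mmde_coeff"
proof -
  have "i = 2 \<or> i = 3" if "i \<in> {2..3}" for i :: nat using that by auto
  moreover have "mmde_coeff (2 * 2) \<in> modular_forms (2 * 2)" "mmde_coeff (2 * 3) \<in> modular_forms (2 * 3)"
    using modular_forms_cmult[OF E4_modular] modular_forms_cmult[OF E6_modular] by (simp_all add: mmde_coeff_def)
  ultimately show ?thesis unfolding mmde_coeffs_def by metis
qed

lemma mmde_solutions_eq:
  "mmde_solutions k 3 mmde_coeff = {f. (\<forall>z. \<not> Im z > 0 \<longrightarrow> f z = 0) \<and> mmde_solution k a b f}"
proof -
  have "{2..3} = {2, 3::nat}" by auto
  then have "mmde_operator k 3 mmde_coeff f z =
      mod_deriv_iter k 3 f z + a * E4 z * mod_deriv_iter k 1 f z + b * E6 z * f z" for f z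
    by (simp add: mmde_operator_def mmde_coeff_def del: mod_deriv_iter.simps(2))
  then show ?thesis by (auto simp: mmde_solutions_def mmde_solution_def simp del: mod_deriv_iter.simps(2))
qed

text \<open>The relation may be differentiated, and the Wronskian matrix at \<open>\<i>\<close> is
  invertible.\<close>

lemma sol_independent:
  fixes c :: "3 \<Rightarrow> complex"
  assumes "\<And>z. Im z > 0 \<Longrightarrow> c 1 * sol 1 z + c 2 * sol 2 z + c 3 * sol 3 z = 0"
  shows "c j = 0"
proof -
  have "(\<Sum>m\<in>UNIV. c m * dsol n m z) = 0" if z: "Im z > 0" for n z
  proof -
    have "mod_deriv_iter k n (\<lambda>z. \<Sum>m\<in>UNIV. c m * sol m z) z = mod_deriv_iter k n (\<lambda>z. \<Sum>m\<in>(UNIV::3 set). 0 * sol m z) z"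
      by (rule mod_deriv_iter_cong) (use assms z in \<open>auto simp: sum_3\<close>)
    then show ?thesis
      unfolding dsol_def
      by (subst (asm) (1 2) mod_deriv_iter_linear) (auto simp: sol_holomorphic)
  qed
  then have "c 1 * dsol n 1 \<i> + c 2 * dsol n 2 \<i> + c 3 * dsol n 3 \<i> = 0" for n
    by (simp add: sum_3)
  from sol_transpose_injective[OF _ this] show ?thesis using exhaust_3[of j] by auto
qed

lemma inj_sol: "inj sol"
proof (rule injI, rule ccontr)
  fix i j assume e: "sol i = sol j" "i \<noteq> j"
  define c :: "3 \<Rightarrow> complex" where "c m = (if m = i then 1 else if m = j then -1 else 0)" for m
  have "c 1 * sol 1 z + c 2 * sol 2 z + c 3 * sol 3 z = 0" for z
    using e exhaust_3[of i] exhaust_3[of j] fun_cong[OF e(1), of z] by (auto simp: c_def)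
  from sol_independent[OF this, of i] show False by (simp add: c_def)
qed

lemma fundamental_system_sol: "fundamental_system k 3 mmde_coeff sol"
  unfolding fundamental_system_def
proof (intro conjI allI)
  show "inj sol" by (rule inj_sol)
  have sum_range: "(\<Sum>f\<in>range sol. (\<lambda>z. u f * f z)) = (\<lambda>z. u (sol 1) * sol 1 z + u (sol 2) * sol 2 z + u (sol 3) * sol 3 z)"
    for u :: "(complex \<Rightarrow> complex) \<Rightarrow> complex"
    by (subst sum.reindex[OF inj_sol]) (simp add: fun_eq_iff sum_fun_apply sum_3)
  show "cfun.independent (range sol)"
  proof
    assume "cfun.dependent (range sol)"
    then obtain u f where u: "f \<in> range sol" "u f \<noteq> 0" "(\<Sum>f\<in>range sol. (\<lambda>z. u f * f z)) = 0"
      by (auto simp: cfun.dependent_finite)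
    have "u (sol 1) * sol 1 z + u (sol 2) * sol 2 z + u (sol 3) * sol 3 z = 0" for z
      using fun_cong[OF u(3)[unfolded sum_range], of z] by simp
    from sol_independent[of "\<lambda>j. u (sol j)", OF this] show False using u(1,2) by auto
  qed
  show "cfun.span (range sol) = mmde_solutions k 3 mmde_coeff"
  proof
    have "range sol \<subseteq> mmde_solutions k 3 mmde_coeff"
      using sol_solution by (auto simp: mmde_solutions_eq sol_def qform_def)
    moreover have "cfun.subspace (mmde_solutions k 3 mmde_coeff)"
      unfolding cfun.subspace_def
    proof (intro conjI ballI allI)
      have lin: "mod_deriv_iter k n (\<lambda>z. c * f z + d * g z) = (\<lambda>z. c * mod_deriv_iter k n f z + d * mod_deriv_iter k n g z)"
        if "f holomorphic_on upper_half_plane" "g holomorphic_on upper_half_plane" for f g c d n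
        using mod_deriv_iter_linear[of "{False, True}" "\<lambda>i. if i then f else g" k n "\<lambda>i. if i then c else d"] that
        by (simp add: add.commute)
      have comb: "mmde_solution k a b (\<lambda>z. c * f z + d * g z)" if fg: "mmde_solution k a b f" "mmde_solution k a b g" for f g c d
      proof -
        have h: "f holomorphic_on upper_half_plane" "g holomorphic_on upper_half_plane"
          using fg by (auto simp: mmde_solution_def)
        have "mod_deriv_iter k 3 (\<lambda>z. c * f z + d * g z) z + a * E4 z * mod_deriv_iter k 1 (\<lambda>z. c * f z + d * g z) z
            + b * E6 z * (c * f z + d * g z) =
          c * (mod_deriv_iter k 3 f z + a * E4 z * mod_deriv_iter k 1 f z + b * E6 z * f z) +
          d * (mod_deriv_iter k 3 g z + a * E4 z * mod_deriv_iter k 1 g z + b * E6 z * g z)" for z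
          unfolding lin[OF h] by (simp add: algebra_simps del: mod_deriv_iter.simps)
        then show ?thesis
          using fg h by (auto simp: mmde_solution_def intro!: holomorphic_intros simp del: mod_deriv_iter.simps)
      qed
      show "0 \<in> mmde_solutions k 3 mmde_coeff"
        using comb[OF sol_solution sol_solution, of 0 1 0 1] by (simp add: mmde_solutions_eq zero_fun_def)
      fix f assume f: "f \<in> mmde_solutions k 3 mmde_coeff"
      show "f + g \<in> mmde_solutions k 3 mmde_coeff" if "g \<in> mmde_solutions k 3 mmde_coeff" for g
        using f that comb[of f g 1 1] by (simp add: mmde_solutions_eq plus_fun_def)
      show "(\<lambda>z. c * f z) \<in> mmde_solutions k 3 mmde_coeff" for c
        using f comb[of f f c 0] by (simp add: mmde_solutions_eq)
    qed
    ultimately show "cfun.span (range sol) \<subseteq> mmde_solutions k 3 mmde_coeff"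
      by (rule cfun.span_minimal)
    show "mmde_solutions k 3 mmde_coeff \<subseteq> cfun.span (range sol)"
    proof
      fix g assume g: "g \<in> mmde_solutions k 3 mmde_coeff"
      then have "mmde_solution k a b g" by (simp add: mmde_solutions_eq)
      from solution_is_combination[OF this] obtain x :: "complex^3"
        where x: "\<And>z. Im z > 0 \<Longrightarrow> g z = x$1 * sol 1 z + x$2 * sol 2 z + x$3 * sol 3 z" by blast
      have "g z = x$1 * sol 1 z + x$2 * sol 2 z + x$3 * sol 3 z" for z
        using g x[of z] by (cases "Im z > 0") (auto simp: mmde_solutions_eq sol_def qform_def)
      then have "g = (\<lambda>z. x$1 * sol 1 z) + (\<lambda>z. x$2 * sol 2 z) + (\<lambda>z. x$3 * sol 3 z)"
        by (simp add: fun_eq_iff)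
      also have "\<dots> \<in> cfun.span (range sol)"
        by (intro cfun.span_add cfun.span_scale cfun.span_base rangeI)
      finally show "g \<in> cfun.span (range sol)" .
    qed
  qed
  show "has_q_expansion (sol j)" for j
    unfolding has_q_expansion_def
  proof (intro exI ballI)
    fix z assume "z \<in> upper_half_plane"
    then have z: "Im z > 0" by simp
    from qfun_sums[OF disc_A[of j] z]
    show "summable (\<lambda>n. fps_nth (A j) n * exp (2 * of_real pi * \<i> * z) ^ n) \<and>
      sol j z = exp (2 * of_real pi * \<i> * of_real (l$j) * z) * (\<Sum>n. fps_nth (A j) n * exp (2 * of_real pi * \<i> * z) ^ n)"
      using z by (simp add: sums_iff sol_def qform_def qpow_def qexp_def)
  qed
qed

end

context equivariant_system
begin

text \<open>The coefficients in \<open>vv_form_decomposition\<close> have the weights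
  \<open>p\<close>, \<open>p - 2\<close>, \<open>p - 4\<close>, all negative or all odd.\<close>

lemma vv_forms_trivial:
  assumes "p < 0 \<or> odd p"
  shows "vv_forms (k + of_int p) \<rho> \<upsilon> = {0}"
proof -
  have "G = 0" if G: "G \<in> vv_forms (k + of_int p) \<rho> \<upsilon>" for G
  proof -
    obtain h where h: "\<And>n. n < 3 \<Longrightarrow> scalar_form (p - 2 * int n) (h n)" "\<And>z. G z = (\<Sum>n<3. h n z *s dvec n z)"
      using vv_form_decomposition[OF G] by blast
    have "h n = 0" if "n < 3" for n
      by (rule scalar_form_zero[OF h(1)[OF that]]) (use assms in auto)
    then show "G = 0" by (simp add: fun_eq_iff h(2))
  qed
  then show ?thesis using zero_in_vv_forms by blast
qed

text \<open>The range \<open>n \<le> N\<close> is that of the skew action in weight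
  \<open>k + 2 N\<close>: coefficients with \<open>n > N\<close> have negative weight and vanish,
  and from order 3 on they are filled up with 0.\<close>

lemma vv_form_coefficients:
  assumes G: "G \<in> vv_forms (k + 2 * real N) \<rho> \<upsilon>"
  shows "\<exists>h. (\<forall>n i. n + i = N \<longrightarrow> h n \<in> modular_forms (2 * i)) \<and> (\<forall>n. 3 \<le> n \<longrightarrow> h n = 0) \<and>
    (\<forall>z. G z = (\<Sum>n\<le>N. h n z *s dvec n z))"
proof -
  have "G \<in> vv_forms (k + of_int (2 * int N)) \<rho> \<upsilon>" using G by simp
  then obtain h0 where h0: "\<And>n. n < 3 \<Longrightarrow> scalar_form (2 * int N - 2 * int n) (h0 n)"
    "\<And>z. G z = (\<Sum>n<3. h0 n z *s dvec n z)"
    using vv_form_decomposition by blast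
  define h where "h n = (if n < 3 then h0 n else 0)" for n
  have "h n \<in> modular_forms (2 * i)" if "n + i = N" for n i
  proof (cases "n < 3")
    case True
    have "2 * int N - 2 * int n = int (2 * i)" using that by simp
    then show ?thesis using h0(1)[OF True] True by (auto simp: h_def intro!: scalar_form_modular)
  qed (simp add: h_def zero_in_modular_forms)
  moreover have "G z = (\<Sum>n\<le>N. h n z *s dvec n z)" for z
  proof -
    have large: "h n = 0" if "n > N" for n
    proof (cases "n < 3")
      case True
      show ?thesis using True that by (auto simp: h_def intro!: scalar_form_zero[OF h0(1)])
    qed (simp add: h_def)
    have "G z = (\<Sum>n<3. h n z *s dvec n z)" unfolding h0(2) by (simp add: h_def)
    also have "\<dots> = (\<Sum>n\<in>{..<3} \<union> {..N}. h n z *s dvec n z)"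
      by (rule sum.mono_neutral_left) (auto simp: h_def)
    also have "\<dots> = (\<Sum>n\<le>N. h n z *s dvec n z)"
      by (rule sum.mono_neutral_right) (auto simp: large)
    finally show ?thesis .
  qed
  ultimately show ?thesis by (intro exI[of _ h]) (auto simp: h_def)
qed

lemma weights_mem: "k + 2 * real N \<in> multiplier_weights \<upsilon>"
  using mult_shift by (simp add: multiplier_weights_def)

lemma vv_forms_nonzero_weight:
  assumes w: "w \<in> multiplier_weights \<upsilon>" and ne: "vv_forms w \<rho> \<upsilon> \<noteq> {0}"
  shows "\<exists>N::nat. w = k + 2 * real N"
proof -
  have "w - k \<in> \<int>" using multiplier_weights_diff[OF _ mult] w by (simp add: multiplier_weights_def)
  then obtain p :: int where p: "w - k = of_int p" by (auto elim: Ints_cases)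
  then have "w = k + of_int p" by simp
  with vv_forms_trivial[of p] ne have "\<not> p < 0" "even p" by auto
  then obtain q where "p = 2 * q" "q \<ge> 0" by (auto elim!: evenE)
  then have "w = k + 2 * real (nat q)" using p by simp
  then show ?thesis by blast
qed

lemma minimal_weight_k: "minimal_weight \<rho> \<upsilon> k"
proof -
  have "dvec 0 \<in> vv_forms k \<rho> \<upsilon>" using dvec_in_vv_forms[of 0] by simp
  moreover have "dvec 0 \<noteq> 0"
  proof
    assume "dvec 0 = 0"
    then have "dsol 0 j \<i> = 0" for j using dvec_nth[of 0 \<i> j] by simp
    then have "wronskian \<i> = 0" by (simp add: wronskian_def det_3)
    then show False using wronskian_nonzero[of \<i>] by simp
  qed
  moreover have "k \<le> w" if "w \<in> multiplier_weights \<upsilon>" "vv_forms w \<rho> \<upsilon> \<noteq> {0}" for w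
    using vv_forms_nonzero_weight[OF that] by auto
  ultimately show ?thesis using weights_mem[of 0] by (auto simp: minimal_weight_def)
qed

lemma graded_vv_forms_eq:
  "graded_vv_forms \<rho> \<upsilon> = direct_sum (range (\<lambda>N::nat. k + 2 * real N)) (\<lambda>w. vv_forms w \<rho> \<upsilon>)"
proof -
  let ?I = "multiplier_weights \<upsilon>" and ?J = "range (\<lambda>N::nat. k + 2 * real N)"
  have sub: "?J \<subseteq> ?I" using weights_mem by auto
  have triv: "vv_forms w \<rho> \<upsilon> = {0}" if "w \<in> ?I" "w \<notin> ?J" for w
    using vv_forms_nonzero_weight[OF that(1)] that(2) by auto
  have eq: "(\<forall>i\<in>?I. G i \<in> vv_forms i \<rho> \<upsilon>) \<and> (\<forall>i. i \<notin> ?I \<longrightarrow> G i = 0) \<longleftrightarrow>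
    (\<forall>i\<in>?J. G i \<in> vv_forms i \<rho> \<upsilon>) \<and> (\<forall>i. i \<notin> ?J \<longrightarrow> G i = 0)" (is "?lhs \<longleftrightarrow> ?rhs") for G
  proof
    assume G: ?lhs
    then have "G w = 0" if "w \<notin> ?J" for w
      using triv[of w] that by (cases "w \<in> ?I") auto
    then show ?rhs using G sub by auto
  next
    assume G: ?rhs
    then have "G w \<in> vv_forms w \<rho> \<upsilon>" for w
      using zero_in_vv_forms[of w \<rho> \<upsilon>] by (cases "w \<in> ?J") auto
    then show ?lhs using G sub by auto
  qed
  show ?thesis
    unfolding graded_vv_forms_def direct_sum_def conj_assoc [symmetric] eq ..
qed

lemma D_vec_homogeneous: "(D_vec ^^ n) (homogeneous k (dvec 0)) = homogeneous (k + 2 * real n) (dvec n)"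
proof (induction n)
  case 0
  then show ?case by simp
next
  case (Suc n)
  have zero: "mod_deriv v (\<lambda>u. 0) = (\<lambda>z. 0)" for v by (simp add: mod_deriv_def fun_eq_iff)
  have "D_vec (homogeneous (k + 2 * real n) (dvec n)) w z = homogeneous (k + 2 * real (Suc n)) (dvec (Suc n)) w z" for w z
  proof (cases "w - 2 = k + 2 * real n")
    case True
    then have "w = k + 2 * real (Suc n)" by simp
    then show ?thesis
      using True by (simp add: D_vec_def homogeneous_def vec_eq_iff dsol_def)
  next
    case False
    then have "w \<noteq> k + 2 * real (Suc n)" by auto
    then show ?thesis using False by (simp add: D_vec_def homogeneous_def vec_eq_iff zero)
  qed
  then have "D_vec (homogeneous (k + 2 * real n) (dvec n)) = homogeneous (k + 2 * real (Suc n)) (dvec (Suc n))"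
    by (intro ext)
  then show ?case using Suc by simp
qed

lemma scalar_act_homogeneous:
  assumes "finite {i. g i \<noteq> 0}"
  shows "scalar_act g (homogeneous (k + 2 * real n) F) (k + 2 * real N) z = (if n \<le> N then g (N - n) z *s F z else 0)"
proof -
  have "scalar_act g (homogeneous (k + 2 * real n) F) (k + 2 * real N) z =
      (\<Sum>i | g i \<noteq> 0. if n \<le> N \<and> i = N - n then g (N - n) z *s F z else 0)"
    unfolding scalar_act_def
  proof (intro sum.cong refl)
    fix i
    have "k + 2 * real N - 2 * real i = k + 2 * real n \<longleftrightarrow> real N = real (n + i)" by auto
    also have "\<dots> \<longleftrightarrow> n \<le> N \<and> i = N - n" by (simp only: of_nat_eq_iff) auto
    finally show "g i z *s homogeneous (k + 2 * real n) F (k + 2 * real N - 2 * real i) z =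
        (if n \<le> N \<and> i = N - n then g (N - n) z *s F z else 0)"
      by (simp add: homogeneous_def)
  qed
  \<comment> \<open>If \<open>g (N - n)\<close> is 0 its index is missing from the sum, but its term
    is 0 as well.\<close>
  also have "\<dots> = (if n \<le> N then g (N - n) z *s F z else 0)"
    using assms by (cases "n \<le> N") (auto simp: sum.delta')
  finally show ?thesis .
qed

lemma scalar_act_homogeneous_off:
  assumes "\<And>N. w \<noteq> k + 2 * real N"
  shows "scalar_act g (homogeneous (k + 2 * real n) F) w z = 0"
  unfolding scalar_act_def
proof (rule sum.neutral, rule ballI)
  fix i
  have "w - 2 * real i \<noteq> k + 2 * real n" using assms[of "n + i"] by auto
  then show "g i z *s homogeneous (k + 2 * real n) F (w - 2 * real i) z = 0"
    by (simp add: homogeneous_def)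
qed

text \<open>The power \<open>d^n\<close> raises the weight by \<open>2 n\<close>, so its coefficient
  acts through the component of weight \<open>2 (N - n)\<close>; components are indexed by half the
  weight.\<close>

lemma skew_act_eq:
  assumes P: "\<And>n. finite {i. P n i \<noteq> 0}" and fin: "finite {n. P n \<noteq> 0}"
  shows "skew_act P (homogeneous k (dvec 0)) (k + 2 * real N) z = (\<Sum>n\<le>N. P n (N - n) z *s dvec n z)"
    and "(\<And>N. w \<noteq> k + 2 * real N) \<Longrightarrow> skew_act P (homogeneous k (dvec 0)) w z = 0"
proof -
  have "skew_act P (homogeneous k (dvec 0)) (k + 2 * real N) z =
      (\<Sum>n | P n \<noteq> 0. if n \<le> N then P n (N - n) z *s dvec n z else 0)"
    by (simp add: skew_act_def sum_fun_apply D_vec_homogeneous scalar_act_homogeneous[OF P])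
  also have "\<dots> = (\<Sum>n\<in>{n. P n \<noteq> 0} \<union> {..N}. if n \<le> N then P n (N - n) z *s dvec n z else 0)"
    using fin by (intro sum.mono_neutral_left) auto
  also have "\<dots> = (\<Sum>n\<le>N. P n (N - n) z *s dvec n z)"
    using fin by (intro sum.mono_neutral_cong_right) auto
  finally show "skew_act P (homogeneous k (dvec 0)) (k + 2 * real N) z = (\<Sum>n\<le>N. P n (N - n) z *s dvec n z)" .
  show "skew_act P (homogeneous k (dvec 0)) w z = 0" if "\<And>N. w \<noteq> k + 2 * real N"
    by (simp add: skew_act_def sum_fun_apply D_vec_homogeneous scalar_act_homogeneous_off[OF that])
qed

lemma cyclic_submodule_subset: "cyclic_submodule (homogeneous k (dvec 0)) \<subseteq> graded_vv_forms \<rho> \<upsilon>"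
proof
  fix G assume "G \<in> cyclic_submodule (homogeneous k (dvec 0))"
  then obtain P where P: "P \<in> carrier skew_ring" and G: "G = skew_act P (homogeneous k (dvec 0))"
    by (auto simp: cyclic_submodule_def)
  have gr: "P n \<in> graded_modular_forms" for n using P by (simp add: skew_ring_def)
  have fin: "finite {n. P n \<noteq> 0}" using P by (simp add: skew_ring_def)
  have Pfin: "finite {i. P n i \<noteq> 0}" and Pmod: "P n i \<in> modular_forms (2 * i)" for n i
    using gr[of n] by (auto simp: graded_modular_forms_def direct_sum_def)
  note act = skew_act_eq[OF Pfin fin]
  have G_eq: "G (k + 2 * real N) = (\<Sum>n\<le>N. (\<lambda>z. P n (N - n) z *s dvec n z))" for N
    unfolding G by (rule ext) (simp only: act(1) sum_fun_apply)
  have "G w \<in> vv_forms w \<rho> \<upsilon>" if w_mem: "w \<in> range (\<lambda>N::nat. k + 2 * real N)" for w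
  proof -
    obtain N where w: "w = k + 2 * real N" using w_mem by auto
    show ?thesis
      unfolding w G_eq
    proof (rule vv_forms_sum)
      fix n assume "n \<in> {..N}"
      then have "k + 2 * real n + 2 * real (N - n) = k + 2 * real N" by (simp add: of_nat_diff)
      then show "(\<lambda>z. P n (N - n) z *s dvec n z) \<in> vv_forms (k + 2 * real N) \<rho> \<upsilon>"
        using vv_forms_modular_mult[OF dvec_in_vv_forms[of n] Pmod[of n "N - n"]] by simp
    qed simp
  qed
  moreover have off: "G w = 0" if "w \<notin> range (\<lambda>N::nat. k + 2 * real N)" for w
    unfolding G by (rule ext) (use that in \<open>auto intro!: act(2)\<close>)
  moreover have "finite {w. G w \<noteq> 0}"
  proof (rule finite_subset)
    show "{w. G w \<noteq> 0} \<subseteq> (\<lambda>(n, i). k + 2 * real (n + i)) ` (SIGMA n:{n. P n \<noteq> 0}. {i. P n i \<noteq> 0})"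
    proof
      fix w assume w: "w \<in> {w. G w \<noteq> 0}"
      then have "G w \<noteq> 0" by simp
      then have "w \<in> range (\<lambda>N::nat. k + 2 * real N)" using off by blast
      then obtain N where N: "w = k + 2 * real N" by blast
      then have "(\<Sum>n\<le>N. (\<lambda>z. P n (N - n) z *s dvec n z)) \<noteq> 0" using w G_eq by simp
      then obtain n where n: "n \<le> N" "(\<lambda>z. P n (N - n) z *s dvec n z) \<noteq> 0"
        by (meson atMost_iff sum.neutral)
      then have "P n (N - n) \<noteq> 0" by (auto simp: fun_eq_iff)
      moreover from this have "P n \<noteq> 0" by auto
      ultimately show "w \<in> (\<lambda>(n, i). k + 2 * real (n + i)) ` (SIGMA n:{n. P n \<noteq> 0}. {i. P n i \<noteq> 0})"
        using n(1) N by (intro image_eqI[of _ _ "(n, N - n)"]) auto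
    qed
  qed (intro finite_imageI finite_SigmaI fin Pfin)
  ultimately show "G \<in> graded_vv_forms \<rho> \<upsilon>"
    unfolding graded_vv_forms_eq by (simp add: direct_sum_def)
qed

lemma graded_subset_cyclic: "graded_vv_forms \<rho> \<upsilon> \<subseteq> cyclic_submodule (homogeneous k (dvec 0))"
proof
  fix G assume "G \<in> graded_vv_forms \<rho> \<upsilon>"
  then have G: "\<And>N. G (k + 2 * real N) \<in> vv_forms (k + 2 * real N) \<rho> \<upsilon>"
    "\<And>w. w \<notin> range (\<lambda>N::nat. k + 2 * real N) \<Longrightarrow> G w = 0" "finite {w. G w \<noteq> 0}"
    by (auto simp: graded_vv_forms_eq direct_sum_def)
  \<comment> \<open>The last condition keeps the chosen coefficients finitely supported: weights in
    which \<open>G\<close> vanishes contribute 0.\<close>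
  define Q where "Q N h \<longleftrightarrow> (\<forall>n i. n + i = N \<longrightarrow> h n \<in> modular_forms (2 * i)) \<and> (\<forall>n. 3 \<le> n \<longrightarrow> h n = 0) \<and>
    (\<forall>z. G (k + 2 * real N) z = (\<Sum>n\<le>N. h n z *s dvec n z)) \<and> (G (k + 2 * real N) = 0 \<longrightarrow> h = 0)" for N h
  have "\<exists>h. Q N h" for N
  proof (cases "G (k + 2 * real N) = 0")
    case True
    then show ?thesis by (intro exI[of _ 0]) (auto simp: Q_def zero_in_modular_forms)
  next
    case False
    then show ?thesis using vv_form_coefficients[OF G(1)[of N]] unfolding Q_def by blast
  qed
  then obtain h where "\<And>N. Q N (h N)" by metis
  then have h: "\<And>N n i. n + i = N \<Longrightarrow> h N n \<in> modular_forms (2 * i)"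
    "\<And>N n. 3 \<le> n \<Longrightarrow> h N n = 0" "\<And>N z. G (k + 2 * real N) z = (\<Sum>n\<le>N. h N n z *s dvec n z)"
    "\<And>N. G (k + 2 * real N) = 0 \<Longrightarrow> h N = 0"
    unfolding Q_def by blast+
  \<comment> \<open>The component of weight \<open>2 i\<close> in the coefficient of
    \<open>d^n\<close> stems from the decomposition in weight \<open>k + 2 (n + i)\<close>.\<close>
  define P where "P n i = h (n + i) n" for n i
  have "P n = 0" if "3 \<le> n" for n using h(2)[OF that] by (simp add: P_def fun_eq_iff)
  then have "{n. P n \<noteq> 0} \<subseteq> {..<3}" using not_le by blast
  then have fin: "finite {n. P n \<noteq> 0}" by (rule finite_subset) simp
  have Pfin: "finite {i. P n i \<noteq> 0}" for n
  proof -
    have "inj (\<lambda>i. k + 2 * real (n + i))" by (auto simp: inj_def)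
    then have "finite ((\<lambda>i. k + 2 * real (n + i)) -` {w. G w \<noteq> 0})"
      using G(3) by (intro finite_vimageI) auto
    moreover have "{i. P n i \<noteq> 0} \<subseteq> (\<lambda>i. k + 2 * real (n + i)) -` {w. G w \<noteq> 0}"
      using h(4) by (force simp: P_def)
    ultimately show ?thesis by (rule finite_subset[rotated])
  qed
  have "P \<in> carrier skew_ring"
    using fin Pfin h(1) by (auto simp: skew_ring_def graded_modular_forms_def direct_sum_def P_def)
  moreover have "G w z = skew_act P (homogeneous k (dvec 0)) w z" for w z
  proof (cases "\<exists>N::nat. w = k + 2 * real N")
    case True
    then obtain N :: nat where w: "w = k + 2 * real N" by blast
    have "(\<Sum>n\<le>N. h N n z *s dvec n z) = (\<Sum>n\<le>N. P n (N - n) z *s dvec n z)"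
      by (intro sum.cong refl) (simp add: P_def)
    then show ?thesis unfolding w h(3) skew_act_eq(1)[OF Pfin fin] .
  next
    case False
    then have "G w = 0" by (intro G(2)) auto
    moreover have "skew_act P (homogeneous k (dvec 0)) w z = 0"
      using False by (intro skew_act_eq(2)[OF Pfin fin]) auto
    ultimately show ?thesis by simp
  qed
  then have "G = skew_act P (homogeneous k (dvec 0))" by (simp add: fun_eq_iff)
  ultimately show "G \<in> cyclic_submodule (homogeneous k (dvec 0))"
    by (auto simp: cyclic_submodule_def)
qed

lemma cyclic_module:
  "minimal_weight \<rho> \<upsilon> k \<and>
    graded_vv_forms \<rho> \<upsilon> = direct_sum (range (\<lambda>N::nat. k + 2 * real N)) (\<lambda>w. vv_forms w \<rho> \<upsilon>) \<and>
    dvec 0 \<in> vv_forms k \<rho> \<upsilon> \<and>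
    graded_vv_forms \<rho> \<upsilon> = cyclic_submodule (homogeneous k (dvec 0)) \<and>
    (\<exists>M. mmde_coeffs 3 M \<and> fundamental_system k 3 M (\<lambda>j z. dvec 0 z $ j))"
proof -
  have "(\<lambda>j z. dvec 0 z $ j) = sol" by (simp add: dsol_0)
  then have "fundamental_system k 3 mmde_coeff (\<lambda>j z. dvec 0 z $ j)"
    using fundamental_system_sol by simp
  then show ?thesis
    using minimal_weight_k graded_vv_forms_eq dvec_in_vv_forms[of 0] cyclic_submodule_subset
      graded_subset_cyclic mmde_coeffs_mmde_coeff by auto
qed

end

section \<open>The representation on the solution space\<close>

context mmde_system
begin

text \<open>All three terms of the equation have weight \<open>k + 6\<close>, so inversion
  multiplies it by one common power of \<open>z\<close>.\<close>

lemma mmde_solution_inversion: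
  assumes f: "mmde_solution k a b f"
  shows "mmde_solution k a b (\<lambda>z. c * (z powr of_real (- k) * f (- 1 / z)))"
proof -
  let ?g = "\<lambda>z. z powr of_real (- k) * f (- 1 / z)"
  have fh: "f holomorphic_on upper_half_plane" using f by (simp add: mmde_solution_def)
  have gh: "?g holomorphic_on upper_half_plane"
  proof (rule holomorphic_upper_half_planeI)
    fix z assume z: "Im z > 0"
    have z0: "z \<noteq> 0" using z by auto
    have "((\<lambda>z. f (- 1 / z)) has_field_derivative deriv f (- 1 / z) * (1 / z^2)) (at z)"
      by (intro DERIV_chain2[where f = f] holomorphic_upper_half_planeD fh z inversion_deriv z0
          Im_inversion_pos)
    from DERIV_mult[OF has_field_derivative_powr[OF upper_not_nonpos_Reals[OF z], of "of_real (- k)"] this]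
    show "(?g has_field_derivative (of_real (- k) * z powr (of_real (- k) - 1) * f (- 1 / z) +
        deriv f (- 1 / z) * (1 / z^2) * z powr of_real (- k))) (at z)" .
  qed
  have "mod_deriv_iter k 3 (\<lambda>z. c * ?g z) z + a * E4 z * mod_deriv_iter k 1 (\<lambda>z. c * ?g z) z
      + b * E6 z * (c * ?g z) = 0" if z: "Im z > 0" for z
  proof -
    let ?v = "- 1 / z"
    have z0: "z \<noteq> 0" using z by auto
    have v: "Im ?v > 0" by (rule Im_inversion_pos[OF z])
    have it: "mod_deriv_iter k n (\<lambda>z. c * ?g z) z = c * (z powr of_real (- (k + 2 * real n)) * mod_deriv_iter k n f ?v)" for n
      using mod_deriv_iter_linear[of "{()}" "\<lambda>_. ?g" k n "\<lambda>_. c"] gh mod_deriv_iter_inversion[OF fh z, of k n]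
      by simp
    define p where "p = z powr of_real (- (k + 2 * real 3))"
    have pw: "z powr of_real (- (k + 2 * real n)) = p * z ^ (6 - 2 * n)" if "n \<le> 3" for n
    proof -
      have "of_real (- (k + 2 * real n)) = of_real (- (k + 2 * real 3)) + (of_nat (6 - 2 * n) :: complex)"
        using that by (simp add: of_nat_diff)
      then show ?thesis using z0 by (simp only: powr_add p_def powr_nat' if_False) simp
    qed
    have "mod_deriv_iter k 3 f ?v + a * E4 ?v * mod_deriv_iter k 1 f ?v + b * E6 ?v * f ?v = 0"
      using f v by (simp add: mmde_solution_def del: mod_deriv_iter.simps(2))
    then have e: "mod_deriv_iter k 3 f ?v + a * (z^4 * E4 z) * mod_deriv_iter k 1 f ?v + b * (z^6 * E6 z) * f ?v = 0"
      unfolding E4_inversion[OF z] E6_inversion[OF z] .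
    have "mod_deriv_iter k 3 (\<lambda>z. c * ?g z) z + a * E4 z * mod_deriv_iter k 1 (\<lambda>z. c * ?g z) z + b * E6 z * (c * ?g z) =
      c * p * (mod_deriv_iter k 3 f ?v + a * (z^4 * E4 z) * mod_deriv_iter k 1 f ?v + b * (z^6 * E6 z) * f ?v)"
      unfolding it using pw[of 0] pw[of 1] pw[of 3]
      by (simp add: algebra_simps del: mod_deriv_iter.simps(2))
    then show ?thesis unfolding e by simp
  qed
  then show ?thesis
    using gh by (auto simp: mmde_solution_def intro!: holomorphic_on_mult simp del: mod_deriv_iter.simps(2))
qed

text \<open>The space of solutions is stable under the slash operator of \<open>S\<close>. At the elliptic points
  \<open>i\<close> and \<open>omega\<close> the columns of the Wronskian matrix are eigenvectors of the resulting matrices of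
  \<open>S\<close> and \<open>S T\<close>, with explicit eigenvalues.\<close>

lemma inversion_reflection_pair:
  assumes mult: "multiplier_system k \<upsilon>"
    and t: "\<And>j. exp (2 * of_real pi * \<i> * of_real (l$j)) = \<upsilon> T_mat * t$j"
  shows "\<exists>R s u v. reflection_pair t R s u v \<and>
    (\<forall>z j. Im z > 0 \<longrightarrow> slash k \<upsilon> S_mat (sol j) z = (R *v (\<chi> m. sol m z)) $ j)"
proof -
  have nz: "\<upsilon> S_mat \<noteq> 0" "\<upsilon> T_mat \<noteq> 0" using mult_factor_rules(1)[OF mult] by auto
  have "\<exists>x::complex^3. \<forall>z. Im z > 0 \<longrightarrow> slash k \<upsilon> S_mat (sol j) z = x$1 * sol 1 z + x$2 * sol 2 z + x$3 * sol 3 z" for j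
    using solution_is_combination[OF mmde_solution_inversion[OF sol_solution[of j], of "inverse (\<upsilon> S_mat)"]]
    by (simp add: slash_eq mult_factor_generators generators_act mult.assoc)
  then obtain X :: "3 \<Rightarrow> complex^3" where X: "\<And>j z. Im z > 0 \<Longrightarrow>
      slash k \<upsilon> S_mat (sol j) z = X j$1 * sol 1 z + X j$2 * sol 2 z + X j$3 * sol 3 z" by metis
  define R :: "complex^3^3" where "R = (\<chi> j. X j)"
  have law: "slash k \<upsilon> S_mat (sol j) z = (R *v (\<chi> m. sol m z)) $ j" if "Im z > 0" for j z
    using X[OF that] by (simp add: R_def matrix3_vector_nth)
  have dlaw: "inverse (\<upsilon> S_mat) * z powr of_real (- (k + 2 * real n)) * dsol n j (- 1 / z) = (\<Sum>m\<in>UNIV. R$j$m * dsol n m z)"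
    if z: "Im z > 0" for n j z
  proof -
    have "w powr of_real (- k) * sol j (- 1 / w) = (\<Sum>m\<in>UNIV. (\<upsilon> S_mat * R$j$m) * sol m w)" if "Im w > 0" for w
    proof -
      have "w powr of_real (- k) * sol j (- 1 / w) = \<upsilon> S_mat * slash k \<upsilon> S_mat (sol j) w"
        using nz by (simp add: slash_eq mult_factor_generators generators_act)
      then show ?thesis
        unfolding law[OF that] by (simp add: matrix_vector_mult_def sum_distrib_left mult.assoc)
    qed
    from dsol_inversion[OF this z, of n]
    have "inverse (\<upsilon> S_mat) * (z powr of_real (- (k + 2 * real n)) * dsol n j (- 1 / z)) =
       (\<Sum>m\<in>UNIV. inverse (\<upsilon> S_mat) * (\<upsilon> S_mat * R$j$m * dsol n m z))"
      unfolding sum_distrib_left[symmetric] by simp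
    then show ?thesis using nz(1) by (simp flip: mult.assoc)
  qed
  have powr: "z powr of_real (- (k + 2 * real n)) = z powr of_real (- k) * (inverse (z^2)) ^ n" if "z \<noteq> 0" for z :: complex and n
  proof -
    have "of_real (- (k + 2 * real n)) = of_real (- k) + (- of_nat (2 * n) :: complex)" by simp
    then have "z powr of_real (- (k + 2 * real n)) = z powr of_real (- k) * z powr (- of_nat (2 * n))"
      by (simp only: powr_add)
    also have "z powr (- of_nat (2 * n)) = inverse (z ^ (2 * n))"
      using that by (simp only: powr_minus powr_nat' simp_thms)
    finally show ?thesis by (simp only: power_mult power_inverse)
  qed
  define s where "s = mult_factor k \<upsilon> S_mat \<i>"
  define x where "x = mult_factor k \<upsilon> (S_mat ** T_mat) omega"
  have s0: "s \<noteq> 0" unfolding s_def using mult_factor_rules(4)[OF mult] by simp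
  have xs: "x^3 = s^2" unfolding x_def s_def by (rule multiplier_relations(1)[OF mult])
  have x: "x = inverse (\<upsilon> T_mat) * (inverse (\<upsilon> S_mat) * (omega + 1) powr of_real (- k))"
    unfolding x_def multiplier_relations(3)[OF mult] by (simp add: mult_factor_generators)
  \<comment> \<open>Since \<open>(omega + 1)^2 = omega\<close>, this is the inverse of
    \<open>omega\<close>, again a primitive cube root of unity.\<close>
  define w where "w = inverse ((omega + 1)^2)"
  have w0: "omega + 1 \<noteq> 0" using omega_rules(1) by (auto simp: complex_eq_iff)
  have "omega * omega = (omega^2 + omega + 1) - 1 - omega" by (simp add: power2_eq_square)
  then have om: "omega * omega = - 1 - omega" unfolding omega_rules(2) by simp
  then have sq: "(omega + 1)^2 = omega" by (simp add: power2_eq_square algebra_simps)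
  have "omega * (- 1 - omega) = 1" by (simp add: right_diff_distrib om)
  then have "inverse omega = - 1 - omega" by (rule inverse_unique)
  then have w_eq: "w = - 1 - omega" unfolding w_def sq .
  have w: "w^2 + w + 1 = 0"
    unfolding w_eq by (simp add: power2_eq_square algebra_simps om)
  have inv_omega: "- 1 / (omega + 1) = omega"
  proof -
    have "omega * (omega + 1) = - 1" by (simp add: distrib_left om)
    then show ?thesis using w0 by (metis nonzero_mult_div_cancel_right)
  qed
  have "(R ** sol_matrix \<i>) $ j $ m = (sol_matrix \<i> ** diag3 (vector [s, - s, s])) $ j $ m" for j m
  proof -
    \<comment> \<open>At \<open>\<i>\<close> each derivative contributes a further factor
      \<open>\<i>^(-2) = -1\<close>.\<close>
    have e: "(\<Sum>m\<in>UNIV. R$j$m * dsol n m \<i>) = s * (- 1) ^ n * dsol n j \<i>" for n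
      using dlaw[of \<i> n j] unfolding powr[OF complex_i_not_zero] by (simp add: s_def mult_factor_generators mult.assoc)
    show ?thesis
      using exhaust_3[of m] e[of 0] e[of 1] e[of 2]
      by (auto simp: matrix3_mult_nth diag3_nth sum_3)
  qed
  then have RS: "R ** sol_matrix \<i> = sol_matrix \<i> ** diag3 (vector [s, - s, s])" by (simp add: vec_eq_iff)
  have "((R ** diag3 t) ** sol_matrix omega) $ j $ m = (sol_matrix omega ** diag3 (vector [x, x * w, x * w^2])) $ j $ m" for j m
  proof -
    \<comment> \<open>\<open>T\<close> carries \<open>omega\<close> to \<open>omega + 1\<close>, and
      \<open>S\<close> carries it back.\<close>
    have e: "(\<Sum>m\<in>UNIV. R$j$m * (t$m * dsol n m omega)) = x * w ^ n * dsol n j omega" for n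
    proof -
      have "(\<Sum>m\<in>UNIV. R$j$m * dsol n m (omega + 1)) = inverse (\<upsilon> S_mat) * (omega + 1) powr of_real (- (k + 2 * real n)) * dsol n j (- 1 / (omega + 1))"
        using dlaw[of "omega + 1" n j] omega_rules(1) by simp
      also have "\<dots> = \<upsilon> T_mat * (x * w ^ n * dsol n j omega)"
        unfolding inv_omega powr[OF w0] w_def[symmetric] x using nz by simp
      finally have 1: "(\<Sum>m\<in>UNIV. R$j$m * dsol n m (omega + 1)) = \<upsilon> T_mat * (x * w ^ n * dsol n j omega)" .
      have "dsol n m (omega + 1) = \<upsilon> T_mat * (t$m * dsol n m omega)" for m
        using dsol_plus_1[OF omega_rules(1), of n m] unfolding t by (simp only: mult.assoc)
      then have "\<upsilon> T_mat * (\<Sum>m\<in>UNIV. R$j$m * (t$m * dsol n m omega)) = \<upsilon> T_mat * (x * w ^ n * dsol n j omega)"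
        using 1 by (simp add: sum_distrib_left mult.left_commute)
      then show ?thesis using nz(2) by simp
    qed
    show ?thesis
      using exhaust_3[of m] e[of 0] e[of 1] e[of 2]
      by (auto simp: matrix3_mult_nth diag3_nth sum_3 algebra_simps)
  qed
  then have RR: "(R ** diag3 t) ** sol_matrix omega = sol_matrix omega ** diag3 (vector [x, x * w, x * w^2])"
    by (simp add: vec_eq_iff)
  have "\<exists>u v. reflection_pair t R s u v"
    by (rule diagonalizable_reflection_pair[OF _ RS s0 _ RR w xs])
       (auto intro!: sol_matrix_det_nonzero omega_rules)
  then show ?thesis using law by blast
qed

end

section \<open>Rescaling the solutions to the given representation\<close>

lemma fps_mod_deriv_scale: "fps_mod_deriv l k (fps_const c * A) = fps_const c * fps_mod_deriv l k A"
  by (simp add: fps_mod_deriv_def algebra_simps)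

lemma fps_mmde_scale: "fps_mmde l k a b (fps_const c * A) = fps_const c * fps_mmde l k a b A"
  unfolding fps_mmde_def fps_mod_deriv_scale by (simp add: algebra_simps)

theorem theorem4p1:
  fixes \<rho> :: "int^2^2 \<Rightarrow> complex^3^3" and \<upsilon> :: "int^2^2 \<Rightarrow> complex"
    and r l :: "real^3"
  assumes "irreducible_representation \<rho>"
    and "\<forall>j. 0 \<le> r$j \<and> r$j < 1"
    and "\<rho> T_mat = (\<chi> i j. if i = j then exp (2 * of_real pi * \<i> * of_real (r$j)) else 0)"
    and "\<exists>k. multiplier_system k \<upsilon>"
    and "minimal_admissible r \<upsilon> l"
  shows "\<exists>k0 F0. minimal_weight \<rho> \<upsilon> k0 \<and> k0 = 4 * (l$1 + l$2 + l$3) - 2 \<and>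
    graded_vv_forms \<rho> \<upsilon> = direct_sum (range (\<lambda>k::nat. k0 + 2 * real k)) (\<lambda>k. vv_forms k \<rho> \<upsilon>) \<and>
    F0 \<in> vv_forms k0 \<rho> \<upsilon> \<and>
    graded_vv_forms \<rho> \<upsilon> = cyclic_submodule (homogeneous k0 F0) \<and>
    (\<exists>M. mmde_coeffs 3 M \<and> fundamental_system k0 3 M (\<lambda>j z. F0 z $ j))"
proof -
  define e :: "real \<Rightarrow> complex" where "e x = exp (2 * of_real pi * \<i> * of_real x)" for x
  have e_add: "e (x + y) = e x * e y" for x y by (simp add: e_def exp_add [symmetric] algebra_simps)
  have e_int: "e x = e y \<longleftrightarrow> x - y \<in> \<int>" for x y unfolding e_def by (rule exp_2pi_i_eq)
  define t :: "complex^3" where "t = (\<chi> j. e (r$j))"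
  have T: "\<rho> T_mat = diag3 t"
    using assms(3) by (simp add: diag3_def t_def e_def vec_eq_iff)
  obtain t_dist: "t$1 \<noteq> t$2" "t$1 \<noteq> t$3" "t$2 \<noteq> t$3" and "\<exists>s u v. reflection_pair t (\<rho> S_mat) s u v \<and> s^4 = 1 \<and>
      (\<forall>i. u$i \<noteq> 0) \<and> (\<forall>i. v$i \<noteq> 0)"
    using irreducible_reflection_pair[OF assms(1) T] by blast
  then obtain s u v where S: "reflection_pair t (\<rho> S_mat) s u v" and s4: "s^4 = 1"
    and uv: "\<And>i. u$i \<noteq> 0" "\<And>i. v$i \<noteq> 0" by blast
  have rep: "representation \<rho>" using assms(1) by (simp add: irreducible_representation_def)
  obtain k1 where k1: "multiplier_system k1 \<upsilon>" using assms(4) by blast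
  have "norm (\<upsilon> T_mat) = 1" using k1 by (simp add: multiplier_system_def)
  then have T_mult: "\<upsilon> T_mat = e (cusp_parameter \<upsilon> / 12)"
    unfolding e_def by (rule cusp_parameter_rule)
  have l: "0 \<le> l$j" "l$j < 1" "l$j - (r$j + cusp_parameter \<upsilon> / 12) \<in> \<int>" for j
    using assms(5) by (auto simp: minimal_admissible_def)
  have lt: "e (l$j) = \<upsilon> T_mat * t$j" for j
    using l(3)[of j] by (simp add: t_def T_mult e_int mult.commute flip: e_add)
  have T0: "\<upsilon> T_mat \<noteq> 0" by (simp add: T_mult e_def)
  have l_dist: "l$i \<noteq> l$j" if "i \<noteq> j" for i j
  proof
    assume "l$i = l$j"
    then have "t$i = t$j" using lt[of i] lt[of j] T0 by simp
    then show False using that t_dist exhaust_3[of i] exhaust_3[of j] by auto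
  qed
  define k where "k = 4 * (l$1 + l$2 + l$3) - 2"
  \<comment> \<open>By \<open>s t1 t2 t3 = -1\<close> and \<open>s^4 = 1\<close> the fourth power of
    \<open>t1 t2 t3\<close> is 1, so \<open>e k\<close> and \<open>e k1\<close> are both the twelfth
    power of \<open>\<upsilon> T_mat\<close>.\<close>
  have k_weight: "multiplier_system k \<upsilon>"
  proof -
    have "t$1 * t$2 * t$3 \<noteq> 0" by (simp add: t_def e_def)
    have "(s * (t$1 * t$2 * t$3)) ^ 4 = 1" using reflection_pair_facts(1)[OF S] by simp
    then have t4: "(t$1 * t$2 * t$3) ^ 4 = 1" using s4 by (simp add: power_mult_distrib)
    have "k = ((l$1 + l$2 + l$3) + (l$1 + l$2 + l$3)) + ((l$1 + l$2 + l$3) + (l$1 + l$2 + l$3)) + (- 2)"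
      by (simp add: k_def)
    then have "e k = (e (l$1) * e (l$2) * e (l$3)) ^ 4 * e (- 2)"
      by (simp only: e_add) (simp add: power4_eq_xxxx mult_ac)
    also have "e (- 2) = 1" using e_int[of "- 2" 0] by (simp add: e_def)
    also have "(e (l$1) * e (l$2) * e (l$3)) ^ 4 = \<upsilon> T_mat ^ 12 * (t$1 * t$2 * t$3) ^ 4"
      unfolding lt by (simp add: power_mult_distrib mult_ac flip: power_add)
    finally have "e k = \<upsilon> T_mat ^ 12" using t4 by simp
    then have "e k = e k1" using multiplier_relations(2)[OF k1] by (simp add: e_def)
    then obtain n :: int where "k - k1 = of_int n" unfolding e_int by (auto elim: Ints_cases)
    then have "k = k1 + of_int n" by simp
    then show ?thesis using multiplier_system_shift[OF k1] by simp
  qed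
  define a where "a = complex_of_real (l$1 * l$2 + l$1 * l$3 + l$2 * l$3 - (3 * k^2 + 12 * k + 8) / 144)"
  define b where "b = complex_of_real ((k / 12 - l$1) * (k / 12 - l$2) * (k / 12 - l$3))"
  \<comment> \<open>\<open>fps_mmde_solution\<close> solves for the exponent in first position;
    \<open>k\<close>, \<open>a\<close> and \<open>b\<close> are symmetric in the three exponents, so
    one equation serves all of them.\<close>
  have "\<exists>A. disc_fps A \<and> fps_nth A 0 = 1 \<and> fps_mmde (l$j) k a b A = 0" for j
  proof -
    have "k = 4 * (l$2 + l$1 + l$3) - 2" "k = 4 * (l$3 + l$1 + l$2) - 2" by (simp_all add: k_def)
    moreover have "a = of_real (l$2 * l$1 + l$2 * l$3 + l$1 * l$3 - (3 * k^2 + 12 * k + 8) / 144)"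
      "a = of_real (l$3 * l$1 + l$3 * l$2 + l$1 * l$2 - (3 * k^2 + 12 * k + 8) / 144)"
      unfolding a_def of_real_eq_iff by (simp_all add: mult.commute)
    moreover have "b = of_real ((k / 12 - l$2) * (k / 12 - l$1) * (k / 12 - l$3))"
      "b = of_real ((k / 12 - l$3) * (k / 12 - l$1) * (k / 12 - l$2))"
      unfolding b_def of_real_eq_iff by (simp_all only: mult_ac)
    ultimately have "\<exists>A. disc_fps A \<and> fps_nth A 0 = 1 \<and> fps_mmde (l$1) k a b A = 0"
      "\<exists>A. disc_fps A \<and> fps_nth A 0 = 1 \<and> fps_mmde (l$2) k a b A = 0"
      "\<exists>A. disc_fps A \<and> fps_nth A 0 = 1 \<and> fps_mmde (l$3) k a b A = 0"
      using fps_mmde_solution[OF l(1,2) l(1,2) l(1,2) k_def a_def b_def]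
        fps_mmde_solution[OF l(1,2) l(1,2) l(1,2), of k 2 1 3 a b]
        fps_mmde_solution[OF l(1,2) l(1,2) l(1,2), of k 3 1 2 a b] by simp_all
    then show ?thesis using exhaust_3[of j] by auto
  qed
  then obtain A where A: "\<And>j. disc_fps (A j) \<and> fps_nth (A j) 0 = 1 \<and> fps_mmde (l$j) k a b (A j) = 0"
    by metis
  interpret A: mmde_system l k a b A
    by unfold_locales (use A l l_dist in \<open>auto simp: k_def\<close>)
  obtain R s' u' v' where R: "reflection_pair t R s' u' v'"
    and law: "\<And>z j. Im z > 0 \<Longrightarrow> slash k \<upsilon> S_mat (A.sol j) z = (R *v (\<chi> m. A.sol m z)) $ j"
    using A.inversion_reflection_pair[OF k_weight, of t] lt by (auto simp: e_def)
  \<comment> \<open>Both reflections have the invariants dictated by \<open>t\<close>; rescaling the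
    solutions by \<open>c\<close> makes them transform exactly by \<open>\<rho>\<close>.\<close>
  obtain c :: "complex^3" where c: "\<And>i. c$i \<noteq> 0" and conj: "\<rho> S_mat ** diag3 c = diag3 c ** R"
    using reflection_pair_conjugate[OF S R t_dist uv] by blast
  define B where "B j = fps_const (c$j) * A j" for j
  interpret B: mmde_system l k a b B
    by unfold_locales (use A l l_dist c in \<open>auto simp: k_def B_def fps_mmde_scale\<close>)
  have BA: "B.sol j = (\<lambda>z. c$j * A.sol j z)" for j
    using A by (auto simp: fun_eq_iff B.sol_def A.sol_def qform_def B_def qfun_arith)
  have diag_c: "diag3 c *v x = (\<chi> j. c$j * x$j)" for x
    by (simp add: vec3_eq_iff matrix3_vector_nth diag3_nth)
  interpret B: equivariant_system l k a b B \<rho> \<upsilon> t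
  proof unfold_locales
    show "exp (2 * of_real pi * \<i> * of_real (l$j)) = \<upsilon> T_mat * t$j" for j
      using lt by (simp add: e_def)
    fix z :: complex and j assume z: "Im z > 0"
    have "slash k \<upsilon> S_mat (B.sol j) z = (diag3 c *v (R *v (\<chi> m. A.sol m z))) $ j"
      using law[OF z, of j] by (simp add: BA slash_eq diag_c mult_ac)
    also have "diag3 c *v (R *v (\<chi> m. A.sol m z)) = \<rho> S_mat *v (diag3 c *v (\<chi> m. A.sol m z))"
      by (simp add: matrix_vector_mul_assoc conj)
    also have "diag3 c *v (\<chi> m. A.sol m z) = (\<chi> m. B.sol m z)" by (simp add: diag_c BA vec_eq_iff)
    finally show "slash k \<upsilon> S_mat (B.sol j) z = (\<rho> S_mat *v (\<chi> m. B.sol m z)) $ j" .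
  qed (use rep k_weight T in auto)
  show ?thesis
    by (rule exI[of _ k], rule exI[of _ "B.dvec 0"]) (use B.cyclic_module k_def in blast)
qed

end
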